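(* Let $K \subset \mathbb{R}^n$ be an $n$-dimensional closed convex set distinct from $\mathbb{R}^n$, $n \ge 3$, and let $\delta(u)$ be a continuous real-valued function on the unit sphere $S^{n-1} \subset \mathbb{R}^n$ such that for each vector $u \in S^{n-1}$ the hyperplane $H(u) = \{ x \mid x \cdot u = \delta(u) \}$ either lies in $K$ or intersects the boundary $\mathrm{bd}\, K$ along an $(n-1)$-dimensional convex quadric. Then $\mathrm{bd}\, K$ is a convex quadric.
   Context: A quadric surface in $\mathbb{R}^m$, $m\ge 2$, is the locus of points $x=(\xi_1,\dots,\xi_m)$ satisfying an equation $\sum_{i,k=1}^m a_{ik}\xi_i\xi_k + 2\sum_{i=1}^m b_i\xi_i + c = 0$ with real coefficients, where not all $a_{ik}$ are zero; it is real if this locus is nonempty. A convex surface in $\mathbb{R}^m$ is the boundary of an $m$-dimensional convex set distinct from $\mathbb{R}^m$. A convex surface $S \subset \mathbb{R}^m$ is a convex quadric if there is a real quadric surface $Q \subset \mathbb{R}^m$ and a convex connected component $U$ of $\mathbb{R}^m \setminus Q$ such that $S$ is the boundary of $U$. An $(n-1)$-dimensional convex quadric in a hyperplane $H$ is a set which is a convex quadric in $H$ when $H$ is identified isometrically with $\mathbb{R}^{n-1}$ (so the dimension refers to the ambient plane, and boundaries and components are taken relative to $H$). *)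

theory Defs
  imports "HOL-Analysis.Analysis"
begin

definition quadric_surface :: "'a::euclidean_space set \<Rightarrow> bool" where
  "quadric_surface Q \<longleftrightarrow>
     (\<exists>(a :: 'a \<Rightarrow> 'a \<Rightarrow> real) (b :: 'a \<Rightarrow> real) (c :: real).
        (\<exists>i\<in>Basis. \<exists>k\<in>Basis. a i k \<noteq> 0) \<and>
        Q = {x. (\<Sum>i\<in>Basis. \<Sum>k\<in>Basis. a i k * (x \<bullet> i) * (x \<bullet> k))
                + 2 * (\<Sum>i\<in>Basis. b i * (x \<bullet> i)) + c = 0})"

definition convex_surface :: "'a::euclidean_space set \<Rightarrow> bool" where
  "convex_surface S \<longleftrightarrow>
     (\<exists>C. convex C \<and> aff_dim C = int DIM('a) \<and> C \<noteq> UNIV \<and> S = frontier C)"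

definition convex_quadric :: "'a::euclidean_space set \<Rightarrow> bool" where
  "convex_quadric S \<longleftrightarrow> convex_surface S \<and>
     (\<exists>Q U. quadric_surface Q \<and> Q \<noteq> {} \<and>
            U \<in> components (UNIV - Q) \<and> convex U \<and> S = frontier U)"

text \<open>
  The same notions relative to a plane \<open>H\<close>. An isometric identification of an
  \<open>m\<close>-dimensional plane \<open>H\<close> with \<open>m\<close>-dimensional Euclidean space is a Cartesian
  frame of \<open>H\<close>: an origin \<open>p\<close> in \<open>H\<close> and an orthonormal basis \<open>B\<close> of the direction
  space of \<open>H\<close>, the coordinates of \<open>x \<in> H\<close> being \<open>(x - p) \<bullet> e\<close> for \<open>e \<in> B\<close>. Working
  with frames avoids a separate type of dimension \<open>m\<close>. Convexity, components and
  relative boundaries are invariant under the identification and are therefore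
  taken directly in \<open>H\<close>.
\<close>

definition cartesian_frame :: "'a::euclidean_space set \<Rightarrow> 'a \<Rightarrow> 'a set \<Rightarrow> bool" where
  "cartesian_frame H p B \<longleftrightarrow>
     pairwise orthogonal B \<and> (\<forall>e\<in>B. norm e = 1) \<and> H = (\<lambda>v. p + v) ` span B"

definition quadric_surface_in :: "'a::euclidean_space set \<Rightarrow> 'a set \<Rightarrow> bool" where
  "quadric_surface_in H Q \<longleftrightarrow>
     (\<exists>(p :: 'a) (B :: 'a set) (a :: 'a \<Rightarrow> 'a \<Rightarrow> real) (b :: 'a \<Rightarrow> real) (c :: real).
        cartesian_frame H p B \<and>
        (\<exists>i\<in>B. \<exists>k\<in>B. a i k \<noteq> 0) \<and>
        Q = {x \<in> H. (\<Sum>i\<in>B. \<Sum>k\<in>B. a i k * ((x - p) \<bullet> i) * ((x - p) \<bullet> k))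
                    + 2 * (\<Sum>i\<in>B. b i * ((x - p) \<bullet> i)) + c = 0})"

definition convex_surface_in :: "'a::euclidean_space set \<Rightarrow> 'a set \<Rightarrow> bool" where
  "convex_surface_in H S \<longleftrightarrow>
     (\<exists>C. C \<subseteq> H \<and> convex C \<and> aff_dim C = aff_dim H \<and> C \<noteq> H \<and>
          S = (top_of_set H) frontier_of C)"

definition convex_quadric_in :: "'a::euclidean_space set \<Rightarrow> 'a set \<Rightarrow> bool" where
  "convex_quadric_in H S \<longleftrightarrow> convex_surface_in H S \<and>
     (\<exists>Q U. quadric_surface_in H Q \<and> Q \<noteq> {} \<and>
            U \<in> components (H - Q) \<and> convex U \<and> S = (top_of_set H) frontier_of U)"

end

(* For u <> 0 put D u = |u| \<delta>(u/|u|), so that the planes of the family are x . u = D u. If K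
   contains a line, one section orthogonal to it already determines K as a cylinder. Otherwise every
   plane meets the interior of K. Let W be the open cone of normals u whose sections are bounded.
   A quadratic function vanishing on the boundary of a bounded section is unique up to a factor, so
   three such sections that cross pairwise inside K are glued to one quadratic function Q, and every
   further section crossing all three lies on Q = 0 as well. This gives a relatively open part of the
   boundary on Q = 0. It spreads: continuity of D puts any two nearby boundary points at about the
   same height over u0 in W on a common plane with normal in W, as soon as they lie beyond the plane
   of u0. The remaining boundary points lie on unbounded sections, whose far parts are already on
   Q = 0; chords joining far parts show that Q is proportional to the quadratic of the section. *)

theory Submission
  imports Defs
begin

section \<open>Quadratic functions\<close>

text \<open>Every comparison of quadratic functions rests on chords. On a line through an interior
  point z of a section, a quadratic function vanishing at the two boundary points is fixed by its
  value at z. The boundary points depend on K alone, so functions of two planes that cross inside K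
  are proportional on the common part of these planes. Two planes would leave a multiple of the
  product of their affine equations undetermined; a third removes this freedom. With three planes
  the last pair agrees only up to a factor, which is compared at the point common to all three. If
  that point lies on the boundary, all functions vanish there and derivatives take the place of
  values. The function \<delta> need not be odd, so a normal and its opposite may give different
  planes, and the boundary points below either one have to be reached. The dimension enters through
  a direction orthogonal to two given vectors and through the connectedness of the boundary of a
  bounded section.\<close>

definition quadratic :: "('a::euclidean_space \<Rightarrow> real) \<Rightarrow> bool" where
  "quadratic q \<longleftrightarrow> (\<exists>B l c. bilinear B \<and> linear l \<and> (\<forall>x. q x = B x x + l x + c))"

lemma quadraticI:
  assumes "bilinear B" "linear l" "\<And>x. q x = B x x + l x + c"
  shows "quadratic q"
  using assms unfolding quadratic_def by blast

lemma bilinear_zero: "bilinear (\<lambda>x y. 0::real)"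
  by (simp add: bilinear_def linear_zero)

lemma bilinear_add':
  assumes "bilinear (f :: 'a::real_vector \<Rightarrow> 'b::real_vector \<Rightarrow> real)" "bilinear g"
  shows "bilinear (\<lambda>x y. f x y + g x y)"
  using assms unfolding bilinear_def by (auto intro: linear_compose_add)

lemma quadratic_const: "quadratic (\<lambda>x. c)"
  by (rule quadraticI[OF bilinear_zero linear_zero]) simp

lemma quadratic_linear: "linear l \<Longrightarrow> quadratic l"
  by (rule quadraticI[OF bilinear_zero, where l=l and c=0]) auto

lemma quadratic_add:
  assumes "quadratic f" "quadratic g"
  shows "quadratic (\<lambda>x. f x + g x)"
proof -
  obtain B l c where f: "bilinear B" "linear l" "\<And>x. f x = B x x + l x + c"
    using assms(1) unfolding quadratic_def by blast
  obtain B' l' c' where g: "bilinear B'" "linear l'" "\<And>x. g x = B' x x + l' x + c'"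
    using assms(2) unfolding quadratic_def by blast
  show ?thesis
    by (rule quadraticI[OF bilinear_add'[OF f(1) g(1)] linear_compose_add[OF f(2) g(2)], where c="c+c'"])
      (simp add: f g)
qed

lemma quadratic_cmult:
  assumes "quadratic f"
  shows "quadratic (\<lambda>x. k * f x)"
proof -
  obtain B l c where f: "bilinear B" "linear l" "\<And>x. f x = B x x + l x + c"
    using assms(1) unfolding quadratic_def by blast
  have "linear (\<lambda>x. k * l x)"
    using linear_compose_scale_right[OF f(2), of k] by simp
  moreover have "bilinear (\<lambda>x y. k * B x y)"
    using f(1) linear_compose_scale_right[where c=k and 'b=real] unfolding bilinear_def by fastforce
  ultimately show ?thesis
    by (intro quadraticI[where c="k*c" and B="\<lambda>x y. k * B x y" and l="\<lambda>x. k * l x"])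
      (auto simp: f(3) algebra_simps)
qed

lemma quadratic_diff:
  assumes "quadratic f" "quadratic g"
  shows "quadratic (\<lambda>x. f x - g x)"
  using quadratic_add[OF assms(1) quadratic_cmult[OF assms(2), of "-1"]] by simp

lemma quadratic_sum:
  assumes "\<And>i. i \<in> I \<Longrightarrow> quadratic (f i)"
  shows "quadratic (\<lambda>x. \<Sum>i\<in>I. f i x)"
  using assms
  by (induction I rule: infinite_finite_induct) (auto intro: quadratic_const quadratic_add)

lemma quadratic_mult_inner: "quadratic (\<lambda>x. (x \<bullet> a) * (x \<bullet> b))"
proof -
  have "bilinear (\<lambda>x y. (x \<bullet> a) * (y \<bullet> b))"
    unfolding bilinear_def by (auto intro!: linearI simp: algebra_simps)
  then show ?thesis
    by (rule quadraticI[OF _ linear_zero, where c=0]) auto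
qed

lemma quadratic_inner: "quadratic (\<lambda>x. x \<bullet> a)"
  by (intro quadratic_linear linearI) (auto simp: algebra_simps)

lemma quadratic_compose_affine:
  assumes "quadratic q" "linear h"
  shows "quadratic (\<lambda>x. q (h x + a))"
proof -
  obtain B l c where q: "bilinear B" "linear l" "\<And>x. q x = B x x + l x + c"
    using assms(1) unfolding quadratic_def by blast
  have "bilinear (\<lambda>x y. B (h x) (h y))"
    using q(1) assms(2) linear_compose unfolding bilinear_def o_def by blast
  moreover have "linear (\<lambda>x. B (h x) a + B a (h x) + l (h x))"
    using q(1,2) assms(2) linear_compose[OF assms(2)] unfolding bilinear_def o_def
    by (intro linear_compose_add) auto
  moreover have "q (h x + a) = B (h x) (h x) + (B (h x) a + B a (h x) + l (h x)) + (B a a + l a + c)" for x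
    using q(1) by (simp add: q(3) bilinear_ladd bilinear_radd linear_add[OF q(2)])
  ultimately show ?thesis by (rule quadraticI)
qed

lemma quadratic_expand:
  assumes "quadratic q"
  obtains B L where "bilinear B" "linear L" "\<And>w. q (x + w) = q x + L w + B w w"
proof -
  obtain B l c where q: "bilinear B" "linear l" "\<And>x. q x = B x x + l x + c"
    using assms(1) unfolding quadratic_def by blast
  have "linear (\<lambda>w. B w x + B x w + l w)"
    using q(1,2) unfolding bilinear_def by (intro linear_compose_add) auto
  moreover have "q (x + w) = q x + (B w x + B x w + l w) + B w w" for w
    using q(1) by (simp add: q(3) bilinear_ladd bilinear_radd linear_add[OF q(2)])
  ultimately show thesis using q(1) that by blast
qed

lemma quadratic_line:
  assumes "quadratic q"
  obtains a b where "\<And>t. q (x + t *\<^sub>R d) = q x + a * t + b * t\<^sup>2"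
proof -
  obtain B L where "bilinear B" "linear L" "\<And>w. q (x + w) = q x + L w + B w w"
    using quadratic_expand[OF assms] by metis
  then have "q (x + t *\<^sub>R d) = q x + L d * t + B d d * t\<^sup>2" for t
    by (simp add: linear_cmul bilinear_lmul bilinear_rmul power2_eq_square)
  then show thesis using that by blast
qed

text \<open>Along a line q is a polynomial of degree at most two, and two zeros leave only its value
  at \<open>z\<close> free.\<close>

lemma quadratic_two_roots:
  assumes "quadratic q" "q (z + t1 *\<^sub>R d) = 0" "q (z + t2 *\<^sub>R d) = 0"
    and "t1 \<noteq> t2" "t1 \<noteq> 0" "t2 \<noteq> 0"
  shows "q (z + t *\<^sub>R d) = q z * (1 - t / t1) * (1 - t / t2)"
proof -
  obtain a b where q: "\<And>t. q (z + t *\<^sub>R d) = q z + a * t + b * t\<^sup>2"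
    using quadratic_line[OF assms(1)] by metis
  have 1: "q z + a * t1 + b * t1\<^sup>2 = 0" and 2: "q z + a * t2 + b * t2\<^sup>2 = 0"
    using assms q by metis+
  have "(a + b * (t1 + t2)) * (t1 - t2) = 0"
    using 1 2 by (simp add: algebra_simps power2_eq_square)
  then have a: "a = - b * (t1 + t2)" using assms(4) by simp
  have c: "q z = b * t1 * t2"
    using 1 unfolding a by (simp add: algebra_simps power2_eq_square)
  show ?thesis
    unfolding q a unfolding c using assms(5,6) by (simp add: field_simps power2_eq_square)
qed

lemma linear_quadratic_zero_near:
  fixes a b c e :: real
  assumes "e > 0" "\<And>t. \<bar>t\<bar> < e \<Longrightarrow> a + b * t + c * t\<^sup>2 = 0"
  shows "a = 0 \<and> b = 0 \<and> c = 0"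
proof -
  have a: "a = 0" using assms(2)[of 0] assms(1) by simp
  have 1: "b * (e/2) + c * (e/2)\<^sup>2 = 0" using assms(2)[of "e/2"] assms(1) a by simp
  have 2: "- (b * (e/2)) + c * (e/2)\<^sup>2 = 0"
    using assms(2)[of "-(e/2)"] assms(1) a by (simp only: power2_minus mult_minus_right) simp
  have "c * (e/2)\<^sup>2 = 0" using 1 2 by linarith
  then have "c = 0" using assms(1) by simp
  then show ?thesis using 1 a assms(1) by simp
qed

text \<open>Two further zeros on every line through \<open>z\<close> whose direction is close to \<open>d0\<close> force
  the linear and the quadratic part at \<open>z\<close> to vanish on an open set of directions.\<close>

lemma quadratic_vanishes_on_subspace:
  assumes q: "quadratic q" and S: "subspace S" "d0 \<in> S" and "e > 0" "q z = 0"
    and roots: "\<And>d. d \<in> S \<Longrightarrow> norm (d - d0) < e \<Longrightarrow>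
      \<exists>t1 t2. t1 > 0 \<and> t2 < 0 \<and> q (z + t1 *\<^sub>R d) = 0 \<and> q (z + t2 *\<^sub>R d) = 0"
    and "h \<in> S"
  shows "q (z + h) = 0"
proof -
  obtain B L where B: "bilinear B" and L: "linear L" and BL: "\<And>w. q (z + w) = q z + L w + B w w"
    using quadratic_expand[OF q] by metis
  have line: "L d = 0 \<and> B d d = 0" if d: "d \<in> S" "norm (d - d0) < e" for d
  proof -
    obtain t1 t2 where t: "t1 > 0" "t2 < 0" "q (z + t1 *\<^sub>R d) = 0" "q (z + t2 *\<^sub>R d) = 0"
      using roots[OF d] by blast
    have "q (z + t *\<^sub>R d) = 0" for t
      using quadratic_two_roots[OF q t(3,4)] t assms(5) by simp
    then have "0 + L d * t + B d d * t\<^sup>2 = 0" for t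
      using BL[of "t *\<^sub>R d"] assms(5) B L
      by (simp add: linear_cmul bilinear_lmul bilinear_rmul power2_eq_square algebra_simps)
    then show ?thesis using linear_quadratic_zero_near[of 1 0 "L d" "B d d"] by simp
  qed
  \<comment> \<open>For \<open>\<bar>t\<bar> < e'\<close> the direction
    \<open>d0 + t *\<^sub>R h\<close> stays within \<open>e\<close> of \<open>d0\<close>; the
    summand 1 covers \<open>h = 0\<close>.\<close>
  define e' where "e' = e / (norm h + 1)"
  have e': "e' > 0" using assms(4) by (simp add: e'_def add_nonneg_pos)
  have small: "norm ((d0 + t *\<^sub>R h) - d0) < e" if "\<bar>t\<bar> < e'" for t
  proof -
    have "\<bar>t\<bar> * norm h \<le> \<bar>t\<bar> * (norm h + 1)" by (simp add: algebra_simps)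
    also have "\<dots> < e" using that by (simp add: e'_def pos_less_divide_eq add_nonneg_pos)
    finally show ?thesis by simp
  qed
  have "d0 + t *\<^sub>R h \<in> S" for t
    using S assms(7) by (simp add: subspace_add subspace_scale)
  then have *: "L (d0 + t *\<^sub>R h) = 0" "B (d0 + t *\<^sub>R h) (d0 + t *\<^sub>R h) = 0" if "\<bar>t\<bar> < e'" for t
    using line small that by blast+
  \<comment> \<open>Along these directions \<open>L\<close> and \<open>B\<close> give polynomials in
    \<open>t\<close> that vanish near 0; their top coefficients are \<open>L h\<close> and
    \<open>B h h\<close>.\<close>
  have "L d0 + L h * t + 0 * t\<^sup>2 = 0" if "\<bar>t\<bar> < e'" for t
    using *(1)[OF that] L by (simp add: linear_add linear_cmul mult.commute)
  then have "L h = 0" using linear_quadratic_zero_near[OF e'] by blast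
  moreover have "B d0 d0 + (B d0 h + B h d0) * t + B h h * t\<^sup>2 = 0" if "\<bar>t\<bar> < e'" for t
    using *(2)[OF that] B
    by (simp add: bilinear_ladd bilinear_radd bilinear_lmul bilinear_rmul power2_eq_square algebra_simps)
  then have "B h h = 0" using linear_quadratic_zero_near[OF e'] by blast
  ultimately show ?thesis using BL assms(5) by simp
qed

lemma quadratic_coordinates:
  assumes "quadratic q"
  obtains a b c where "\<And>x. q x = (\<Sum>i\<in>Basis. \<Sum>k\<in>Basis. a i k * (x \<bullet> i) * (x \<bullet> k))
                + 2 * (\<Sum>i\<in>Basis. b i * (x \<bullet> i)) + c"
proof -
  obtain B l c where q: "bilinear B" "linear l" "\<And>x. q x = B x x + l x + c"
    using assms(1) unfolding quadratic_def by blast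
  have l: "l x = (\<Sum>i\<in>Basis. l i * (x \<bullet> i))" for x
  proof -
    have "l x = l (\<Sum>i\<in>Basis. (x \<bullet> i) *\<^sub>R i)" by (simp add: euclidean_representation)
    also have "\<dots> = (\<Sum>i\<in>Basis. l i * (x \<bullet> i))"
      by (simp add: linear_sum[OF q(2)] linear_cmul[OF q(2)] mult.commute)
    finally show ?thesis .
  qed
  have B: "B x x = (\<Sum>i\<in>Basis. \<Sum>k\<in>Basis. B i k * (x \<bullet> i) * (x \<bullet> k))" for x
  proof -
    have "B x x = B (\<Sum>i\<in>Basis. (x \<bullet> i) *\<^sub>R i) (\<Sum>k\<in>Basis. (x \<bullet> k) *\<^sub>R k)"
      by (simp add: euclidean_representation)
    also have "\<dots> = (\<Sum>(i,k)\<in>Basis\<times>Basis. B i k * (x \<bullet> i) * (x \<bullet> k))"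
      by (subst bilinear_sum[OF q(1)])
        (auto intro!: sum.cong simp: bilinear_lmul[OF q(1)] bilinear_rmul[OF q(1)])
    finally show ?thesis by (simp add: sum.cartesian_product)
  qed
  have "q x = (\<Sum>i\<in>Basis. \<Sum>k\<in>Basis. B i k * (x \<bullet> i) * (x \<bullet> k))
                + 2 * (\<Sum>i\<in>Basis. (l i / 2) * (x \<bullet> i)) + c" for x
    by (simp add: q(3) B[of x] l[of x] sum_distrib_left)
  then show thesis using that[of "\<lambda>i k. B i k" "\<lambda>i. l i / 2" c] by blast
qed

section \<open>Convex sets bounded by a quadric\<close>

text \<open>\<open>quadric_surface\<close> demands a nonzero second-order coefficient. An affine
  \<open>q\<close> is replaced by its square, which has the same zeros; the values at
  \<open>x0\<close> and \<open>x1\<close> ensure that the linear part is nonzero.\<close>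

lemma quadric_surface_zeros:
  fixes q :: "'a::euclidean_space \<Rightarrow> real"
  assumes "quadratic q" "q x0 = 0" "q x1 \<noteq> 0"
  shows "quadric_surface {x. q x = 0}"
proof -
  obtain a b c where q: "\<And>x. q x = (\<Sum>i\<in>Basis. \<Sum>k\<in>Basis. a i k * (x \<bullet> i) * (x \<bullet> k))
                + 2 * (\<Sum>i\<in>Basis. b i * (x \<bullet> i)) + c"
    using quadratic_coordinates[OF assms(1)] by blast
  show ?thesis
  proof (cases "\<exists>i\<in>Basis. \<exists>k\<in>Basis. a i k \<noteq> 0")
    case True
    have "{x. q x = 0} = {x. (\<Sum>i\<in>Basis. \<Sum>k\<in>Basis. a i k * (x \<bullet> i) * (x \<bullet> k))
                + 2 * (\<Sum>i\<in>Basis. b i * (x \<bullet> i)) + c = 0}"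
      by (simp add: q)
    then show ?thesis
      unfolding quadric_surface_def using True by blast
  next
    case False
    then have aff: "q x = 2 * (\<Sum>i\<in>Basis. b i * (x \<bullet> i)) + c" for x
      by (simp add: q)
    have "\<exists>i\<in>Basis. b i \<noteq> 0"
    proof (rule ccontr)
      assume "\<not> ?thesis"
      then have "q x = c" for x by (simp add: aff)
      then show False using assms by simp
    qed
    then have nz: "\<exists>i\<in>Basis. \<exists>k\<in>Basis. 4 * b i * b k \<noteq> 0" by auto
    have "(q x)\<^sup>2 = (\<Sum>i\<in>Basis. \<Sum>k\<in>Basis. (4 * b i * b k) * (x \<bullet> i) * (x \<bullet> k))
        + 2 * (\<Sum>i\<in>Basis. (2 * c * b i) * (x \<bullet> i)) + c\<^sup>2" (is "_ = ?Q x") for x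
    proof -
      let ?S = "\<Sum>i\<in>Basis. b i * (x \<bullet> i)"
      have 1: "(\<Sum>i\<in>Basis. \<Sum>k\<in>Basis. (4 * b i * b k) * (x \<bullet> i) * (x \<bullet> k)) = 4 * (?S * ?S)"
        unfolding sum_product by (simp add: sum_distrib_left mult_ac)
      have 2: "(\<Sum>i\<in>Basis. (2 * c * b i) * (x \<bullet> i)) = 2 * c * ?S"
        unfolding sum_distrib_left by (intro sum.cong refl) (simp add: algebra_simps)
      show ?thesis unfolding 1 2 aff by (simp add: power2_eq_square algebra_simps)
    qed
    then have "{x. q x = 0} = {x. ?Q x = 0}"
      by (metis (mono_tags, lifting) zero_eq_power2)
    then show ?thesis
      unfolding quadric_surface_def using nz
      by (intro exI[of _ "\<lambda>i k. 4 * b i * b k"] exI[of _ "\<lambda>i. 2 * c * b i"] exI[of _ "c\<^sup>2"]) simp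
  qed
qed

text \<open>A linear functional bounded below on \<open>K\<close> cannot decrease along
  \<open>d\<close>, so nothing separates \<open>x + t *\<^sub>R d\<close> from
  \<open>K\<close>.\<close>

lemma recession_direction:
  fixes K :: "'a::euclidean_space set"
  assumes "closed K" "convex K" "\<And>t. t \<ge> 0 \<Longrightarrow> p + t *\<^sub>R d \<in> K" "x \<in> K" "t \<ge> 0"
  shows "x + t *\<^sub>R d \<in> K"
proof (rule ccontr)
  assume "x + t *\<^sub>R d \<notin> K"
  then obtain a b where ab: "a \<bullet> (x + t *\<^sub>R d) < b" "\<And>y. y \<in> K \<Longrightarrow> b < a \<bullet> y"
    using separating_hyperplane_closed_point[OF assms(2,1)] by metis
  have "a \<bullet> d \<ge> 0"
  proof (rule ccontr)
    assume neg: "\<not> a \<bullet> d \<ge> 0"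
    \<comment> \<open>At this parameter the ray from \<open>p\<close> reaches the level
      \<open>b\<close>, above which all of \<open>K\<close> lies.\<close>
    define s where "s = (a \<bullet> p - b) / (- (a \<bullet> d))"
    have "p \<in> K" using assms(3)[of 0] by simp
    then have "s \<ge> 0" using ab(2)[of p] neg by (simp add: s_def divide_nonneg_neg divide_nonpos_neg)
    then have "b < a \<bullet> (p + s *\<^sub>R d)" using ab(2) assms(3) by blast
    moreover have "a \<bullet> (p + s *\<^sub>R d) = b"
      using neg by (simp add: s_def inner_add_right inner_diff_right field_simps)
    ultimately show False by simp
  qed
  then have "a \<bullet> x \<le> a \<bullet> (x + t *\<^sub>R d)" using assms(5) by (simp add: inner_add_right)
  then show False using ab(1) ab(2)[OF assms(4)] by linarith
qed

lemma interior_segment: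
  fixes K :: "'a::euclidean_space set"
  assumes "convex K" "c \<in> interior K" "x \<in> K" "0 \<le> s" "s < 1"
  shows "c + s *\<^sub>R (x - c) \<in> interior K"
proof -
  have "x - (1 - s) *\<^sub>R (x - c) \<in> interior K"
    by (rule mem_interior_convex_shrink[OF assms(1,2,3)]) (use assms in auto)
  then show ?thesis by (simp add: algebra_simps)
qed

lemma frontier_on_segment:
  fixes K :: "'a::euclidean_space set"
  assumes "closed K" "a \<in> interior K" "b \<notin> interior K"
  obtains s where "0 < s" "s \<le> 1" "a + s *\<^sub>R (b - a) \<in> frontier K" "b \<notin> K \<Longrightarrow> s < 1"
proof (cases "b \<in> K")
  case True
  then have "b \<in> frontier K" using assms by (simp add: frontier_def)
  then show thesis using that[of 1] True by simp
next
  case False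
  have "closed_segment a b \<inter> frontier K \<noteq> {}"
  proof (rule connected_Int_frontier)
    show "closed_segment a b \<inter> K \<noteq> {}" using assms(2) interior_subset by fastforce
    show "closed_segment a b - K \<noteq> {}" using False by auto
  qed simp
  then obtain s where s: "0 \<le> s" "s \<le> 1" "(1 - s) *\<^sub>R a + s *\<^sub>R b \<in> frontier K"
    by (auto simp: in_segment)
  have eq: "(1 - s) *\<^sub>R a + s *\<^sub>R b = a + s *\<^sub>R (b - a)" by (simp add: algebra_simps)
  have "s \<noteq> 0" using s(3) assms(2) by (auto simp: frontier_def)
  moreover have "s \<noteq> 1" using s(3) False assms(1) by (auto simp: frontier_def)
  ultimately show thesis using s eq by (intro that[of s]) auto
qed

text \<open>The dichotomy on directions says that no line through \<open>p\<close> meets the boundary twice.\<close>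

lemma halfspace_if_rays:
  fixes K :: "'a::euclidean_space set"
  assumes K: "closed K" "convex K" "K \<noteq> UNIV" "p \<in> K"
    and rays: "\<And>d. (\<forall>t\<ge>0. p + t *\<^sub>R d \<in> K) \<or> (\<forall>t\<ge>0. p - t *\<^sub>R d \<in> K)"
  obtains a b where "a \<noteq> 0" "K = {x. a \<bullet> x \<ge> b}"
proof -
  obtain z where "z \<notin> K" using K(3) by blast
  \<comment> \<open>The point of \<open>K\<close> nearest to \<open>z\<close> yields a supporting
    hyperplane, which turns out to bound \<open>K\<close>.\<close>
  then obtain w where w: "w \<in> K" "\<And>y. y \<in> K \<Longrightarrow> dist z w \<le> dist z y"
    using distance_attains_inf[OF K(1)] K(4) by (metis empty_iff)
  define a where "a = w - z"
  have "a \<noteq> 0" using w(1) \<open>z \<notin> K\<close> by (auto simp: a_def)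
  have sup: "a \<bullet> w \<le> a \<bullet> y" if "y \<in> K" for y
    using any_closest_point_dot[OF K(2,1) w(1) that, of z] w(2)
    by (simp add: a_def inner_diff_left inner_diff_right inner_commute)
  \<comment> \<open>A step from \<open>w\<close> against \<open>d\<close> would cross the supporting
    hyperplane, so the dichotomy leaves \<open>d\<close> itself as a recession direction.\<close>
  have "x \<in> K" if x: "a \<bullet> w < a \<bullet> x" for x
  proof -
    define d where "d = x - w"
    have d: "a \<bullet> d > 0" using x by (simp add: d_def inner_diff_right)
    have "\<not> (\<forall>t\<ge>0. p - t *\<^sub>R d \<in> K)"
    proof
      assume *: "\<forall>t\<ge>0. p - t *\<^sub>R d \<in> K"
      have "w + 1 *\<^sub>R (- d) \<in> K"
        by (rule recession_direction[OF K(1,2) _ w(1)]) (use * in auto)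
      then show False using sup[of "w - d"] d by (simp add: inner_diff_right)
    qed
    then have "w + 1 *\<^sub>R d \<in> K"
      using rays[of d] by (intro recession_direction[OF K(1,2) _ w(1)]) auto
    then show ?thesis by (simp add: d_def)
  qed
  then have "{x. a \<bullet> x > a \<bullet> w} \<subseteq> K" by auto
  then have "closure {x. a \<bullet> x > a \<bullet> w} \<subseteq> K" by (rule closure_minimal[OF _ K(1)])
  then have "{x. a \<bullet> x \<ge> a \<bullet> w} \<subseteq> K" using closure_halfspace_gt[OF \<open>a \<noteq> 0\<close>] by simp
  then have "K = {x. a \<bullet> x \<ge> a \<bullet> w}" using sup by auto
  then show thesis using \<open>a \<noteq> 0\<close> that by blast
qed

text \<open>A connected set that meets \<open>U\<close> and leaves it meets the frontier of
  \<open>U\<close>, where \<open>q\<close> vanishes; so \<open>U\<close> is a full component of the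
  complement of the zeros.\<close>

lemma convex_quadric_frontierI:
  assumes U: "open U" "convex U" "U \<noteq> {}" "U \<noteq> UNIV" "frontier U = S"
    and q: "quadratic q" "\<And>x. x \<in> S \<Longrightarrow> q x = 0" "\<And>x. x \<in> U \<Longrightarrow> q x \<noteq> 0"
  shows "convex_quadric S"
proof -
  have "aff_dim U = int DIM('a)" using U by (simp add: aff_dim_open)
  then have "convex_surface S" unfolding convex_surface_def using U by blast
  moreover obtain s where s: "s \<in> S"
    using U frontier_eq_empty by blast
  moreover obtain x where x: "x \<in> U" using U by blast
  ultimately have "quadric_surface {x. q x = 0}"
    using quadric_surface_zeros[OF q(1)] q(2,3) by blast
  moreover have "U \<in> components (UNIV - {x. q x = 0})"
  proof -
    have "connected_component_set (UNIV - {x. q x = 0}) x = U"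
    proof
      show "U \<subseteq> connected_component_set (UNIV - {x. q x = 0}) x"
        by (rule connected_component_maximal) (use x q(3) convex_connected[OF U(2)] in auto)
      show "connected_component_set (UNIV - {x. q x = 0}) x \<subseteq> U"
      proof (rule ccontr)
        let ?C = "connected_component_set (UNIV - {x. q x = 0}) x"
        assume "\<not> ?C \<subseteq> U"
        moreover have "x \<in> ?C" using x q(3) by simp
        ultimately have "?C \<inter> frontier U \<noteq> {}"
          using x by (intro connected_Int_frontier) (blast intro: connected_connected_component)+
        then obtain y where "y \<in> ?C" "y \<in> frontier U" by blast
        moreover have "?C \<subseteq> UNIV - {x. q x = 0}" by (rule connected_component_subset)
        ultimately show False using q(2) U(5) by auto
      qed
    qed
    then show ?thesis using x q(3) by (force simp: components_def)
  qed
  moreover have "{x. q x = 0} \<noteq> {}" using s q(2) by blast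
  ultimately show ?thesis
    unfolding convex_quadric_def using U \<open>convex_surface S\<close> by blast
qed

text \<open>Zeros of \<open>q\<close> may enter the interior, as when \<open>K\<close> is a
  half-space and \<open>q\<close> vanishes on a second plane as well. If a line through an interior
  zero left \<open>K\<close> on both sides, so would its neighbours through that point; each would
  carry three zeros of \<open>q\<close>, and \<open>q\<close> would vanish identically. Hence
  \<open>K\<close> is then a half-space.\<close>

lemma frontier_in_quadric_imp_convex_quadric:
  fixes K :: "'a::euclidean_space set"
  assumes K: "closed K" "convex K" "interior K \<noteq> {}" "K \<noteq> UNIV"
    and q: "quadratic q" "\<And>x. x \<in> frontier K \<Longrightarrow> q x = 0" "q y \<noteq> 0"
  shows "convex_quadric (frontier K)"
proof (cases "\<exists>p\<in>interior K. q p = 0")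
  case False
  show ?thesis
  proof (rule convex_quadric_frontierI[OF _ _ K(3) _ _ q(1,2)])
    show "frontier (interior K) = frontier K"
      using K convex_closure_interior[OF K(2,3)] by (simp add: frontier_def)
    show "interior K \<noteq> UNIV" using K(4) interior_subset by blast
  qed (use False K convex_interior in auto)
next
  case True
  then obtain p where p: "p \<in> interior K" "q p = 0" by blast
  have pK: "p \<in> K" using p interior_subset by blast
  have "(\<forall>t\<ge>0. p + t *\<^sub>R d \<in> K) \<or> (\<forall>t\<ge>0. p - t *\<^sub>R d \<in> K)" for d
  proof (rule ccontr)
    assume "\<not> ?thesis"
    then obtain s t where st: "s \<ge> 0" "t \<ge> 0" "p + s *\<^sub>R d \<notin> K" "p - t *\<^sub>R d \<notin> K" by blast
    then have st0: "s > 0" "t > 0" using pK by (auto simp: order_le_less)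
    have "open ((\<lambda>d. p + s *\<^sub>R d) -` (-K) \<inter> (\<lambda>d. p - t *\<^sub>R d) -` (-K))"
      using K(1) by (intro open_Int open_vimage continuous_intros) auto
    moreover have "d \<in> (\<lambda>d. p + s *\<^sub>R d) -` (-K) \<inter> (\<lambda>d. p - t *\<^sub>R d) -` (-K)"
      using st by auto
    ultimately obtain e where e: "e > 0"
      "ball d e \<subseteq> (\<lambda>d. p + s *\<^sub>R d) -` (-K) \<inter> (\<lambda>d. p - t *\<^sub>R d) -` (-K)"
      using open_contains_ball by blast
    have "q (p + h) = 0" for h
    proof (rule quadratic_vanishes_on_subspace[OF q(1) subspace_UNIV UNIV_I e(1) p(2) _ UNIV_I])
      fix d' assume "norm (d' - d) < e"
      then have d': "p + s *\<^sub>R d' \<notin> K" "p - t *\<^sub>R d' \<notin> K"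
        using e(2) by (auto simp: dist_norm norm_minus_commute subset_iff)
      obtain r1 where r1: "0 < r1" "p + r1 *\<^sub>R ((p + s *\<^sub>R d') - p) \<in> frontier K"
        using frontier_on_segment[OF K(1) p(1), of "p + s *\<^sub>R d'"] d' interior_subset by blast
      obtain r2 where r2: "0 < r2" "p + r2 *\<^sub>R ((p - t *\<^sub>R d') - p) \<in> frontier K"
        using frontier_on_segment[OF K(1) p(1), of "p - t *\<^sub>R d'"] d' interior_subset by blast
      have "q (p + (r1 * s) *\<^sub>R d') = 0" "q (p + (- (r2 * t)) *\<^sub>R d') = 0"
        using q(2)[OF r1(2)] q(2)[OF r2(2)] by simp_all
      then show "\<exists>t1 t2. t1 > 0 \<and> t2 < 0 \<and> q (p + t1 *\<^sub>R d') = 0 \<and> q (p + t2 *\<^sub>R d') = 0"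
        using r1(1) r2(1) st0 by (intro exI[of _ "r1 * s"] exI[of _ "- (r2 * t)"]) auto
    qed
    from this[of "y - p"] show False using q(3) by simp
  qed
  then obtain a b where ab: "a \<noteq> 0" "K = {x. a \<bullet> x \<ge> b}"
    using halfspace_if_rays[OF K(1,2,4) pK] by blast
  have fr: "frontier K = {x. a \<bullet> x = b}"
    using ab frontier_halfspace_ge by auto
  show ?thesis
  proof (rule convex_quadric_frontierI)
    show "frontier {x. a \<bullet> x > b} = frontier K"
      using fr ab by (simp add: frontier_halfspace_gt)
    have "a \<bullet> (((b + 1) / (a \<bullet> a)) *\<^sub>R a) = b + 1" using ab(1) by simp
    then show "{x. a \<bullet> x > b} \<noteq> {}" by (metis (mono_tags, lifting) empty_iff less_add_one mem_Collect_eq)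
    show "{x. a \<bullet> x > b} \<noteq> UNIV" using ab K(4) by (auto simp: set_eq_iff intro: less_imp_le)
    \<comment> \<open>For a half-space \<open>q\<close> is discarded in favour of the affine
      equation of the boundary.\<close>
    show "quadratic (\<lambda>x. x \<bullet> a - b)" by (intro quadratic_diff quadratic_inner quadratic_const)
  qed (auto simp: open_halfspace_gt convex_halfspace_gt fr inner_commute[of _ a])
qed

section \<open>Quadrics in hyperplanes\<close>

lemma continuous_on_quadratic:
  assumes "quadratic q"
  shows "continuous_on S q"
proof -
  obtain a b c where "\<And>x. q x = (\<Sum>i\<in>Basis. \<Sum>k\<in>Basis. a i k * (x \<bullet> i) * (x \<bullet> k))
                + 2 * (\<Sum>i\<in>Basis. b i * (x \<bullet> i)) + c"
    using quadratic_coordinates[OF assms] by blast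
  then have "q = (\<lambda>x. (\<Sum>i\<in>Basis. \<Sum>k\<in>Basis. a i k * (x \<bullet> i) * (x \<bullet> k))
                + 2 * (\<Sum>i\<in>Basis. b i * (x \<bullet> i)) + c)" by blast
  then show ?thesis by (simp add: continuous_intros)
qed

lemma exists_orthogonal_unit:
  fixes a b :: "'a::euclidean_space"
  assumes "DIM('a) \<ge> 3"
  obtains d where "norm d = 1" "d \<bullet> a = 0" "d \<bullet> b = 0"
proof -
  have "dim {a, b} \<le> card {a, b}" by (rule dim_le_card') simp
  also have "\<dots> \<le> 2" by (simp add: card_insert_if)
  finally have "dim {a, b} < DIM('a)" using assms by linarith
  then obtain x where x: "x \<noteq> 0" "\<And>y. y \<in> span {a, b} \<Longrightarrow> orthogonal x y"
    using orthogonal_to_subspace_exists by blast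
  have "x \<bullet> a = 0" "x \<bullet> b = 0" using x(2) by (auto simp: orthogonal_def span_base)
  then show thesis using x(1) by (intro that[of "x /\<^sub>R norm x"]) auto
qed

text \<open>The equation in frame coordinates makes sense on the whole space, where functions coming
  from different planes can be compared.\<close>

lemma quadric_surface_in_zeros:
  assumes "quadric_surface_in H Q"
  obtains q where "quadratic q" "Q = {x \<in> H. q x = 0}"
proof -
  obtain p B a b c where Q: "Q = {x \<in> H. (\<Sum>i\<in>B. \<Sum>k\<in>B. a i k * ((x - p) \<bullet> i) * ((x - p) \<bullet> k))
                    + 2 * (\<Sum>i\<in>B. b i * ((x - p) \<bullet> i)) + c = 0}"
    using assms unfolding quadric_surface_in_def by blast
  let ?q = "\<lambda>x. (\<Sum>i\<in>B. \<Sum>k\<in>B. a i k * ((x \<bullet> i) * (x \<bullet> k))) + 2 * (\<Sum>i\<in>B. b i * (x \<bullet> i)) + c"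
  have "quadratic ?q"
    by (intro quadratic_add quadratic_sum quadratic_cmult quadratic_mult_inner quadratic_inner quadratic_const)
  then have "quadratic (\<lambda>x. ?q (id x + (- p)))"
    by (rule quadratic_compose_affine) (rule linear_id)
  then show thesis using Q by (intro that) (auto simp: mult.assoc)
qed

text \<open>A point of \<open>closure U\<close> with \<open>q\<close> nonzero has a convex
  neighbourhood in \<open>H\<close> that avoids \<open>Q\<close> and meets \<open>U\<close>, hence
  lies in the component \<open>U\<close>. So \<open>U\<close> is relatively open and
  \<open>q\<close> vanishes on the rest of its closure.\<close>

lemma convex_quadric_in_quadratic:
  fixes H :: "'a::euclidean_space set"
  assumes "convex_quadric_in H S" "closed H" "convex H"
  obtains q U where "quadratic q" "convex U" "U \<noteq> {}" "U \<subset> H" "openin (top_of_set H) U"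
    "S = closure U - U" "\<And>x. x \<in> S \<Longrightarrow> q x = 0" "\<And>x. x \<in> U \<Longrightarrow> q x \<noteq> 0"
proof -
  obtain Q U where QU: "quadric_surface_in H Q" "Q \<noteq> {}" "U \<in> components (H - Q)" "convex U"
    "S = (top_of_set H) frontier_of U"
    using assms(1) unfolding convex_quadric_in_def by blast
  obtain q where q: "quadratic q" "Q = {x \<in> H. q x = 0}"
    using quadric_surface_in_zeros[OF QU(1)] by blast
  have UH: "U \<subseteq> H - Q" and Une: "U \<noteq> {}"
    using QU(3) in_components_subset in_components_nonempty by blast+
  have nbhd: "\<exists>e>0. ball x e \<inter> H \<subseteq> U" if x: "x \<in> H" "q x \<noteq> 0" "x \<in> closure U" for x
  proof -
    have "open {x. q x \<noteq> 0}"
      using continuous_on_quadratic[OF q(1), of UNIV] by (intro open_Collect_neq) auto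
    then obtain e where e: "e > 0" "ball x e \<subseteq> {x. q x \<noteq> 0}"
      using x(2) open_contains_ball by blast
    have "ball x e \<inter> H \<subseteq> U"
    proof (rule components_maximal[OF QU(3)])
      show "connected (ball x e \<inter> H)"
        using assms(3) by (intro convex_connected convex_Int) auto
      show "ball x e \<inter> H \<subseteq> H - Q" using e q(2) by auto
      obtain y where "y \<in> U" "dist y x < e" using x(3) e(1) closure_approachable by blast
      then show "U \<inter> (ball x e \<inter> H) \<noteq> {}" using UH by (auto simp: dist_commute)
    qed
    then show ?thesis using e(1) by blast
  qed
  have op: "openin (top_of_set H) U"
    unfolding openin_contains_ball
    using nbhd UH closure_subset[of U] q(2) by auto
  have Ssub: "S = closure U - U"
  proof -
    have "(top_of_set H) closure_of U = closure U"
    proof -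
      have "H \<inter> U = U" "H \<inter> closure U = closure U"
        using UH assms(2) closure_minimal[of U H] by blast+
      then show ?thesis by (simp add: closure_of_subtopology)
    qed
    moreover have "(top_of_set H) interior_of U = U"
      using op by (simp add: interior_of_eq)
    ultimately show ?thesis by (simp add: QU(5) frontier_of_def)
  qed
  have SH: "closure U \<subseteq> H" using UH assms(2) by (intro closure_minimal) auto
  have "q x = 0" if xS: "x \<in> S" for x
  proof (rule ccontr)
    assume "q x \<noteq> 0"
    then obtain e where "e > 0" "ball x e \<inter> H \<subseteq> U" using nbhd[of x] xS Ssub SH by blast
    then show False using xS Ssub SH by (meson DiffE IntI centre_in_ball in_mono)
  qed
  moreover have "U \<subset> H" using UH QU(2) q(2) by blast
  moreover have "q x \<noteq> 0" if "x \<in> U" for x using that UH q(2) by blast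
  ultimately show thesis using that[OF q(1) QU(4) Une _ op Ssub] by blast
qed

text \<open>This excludes planes missing the interior of a line-free \<open>K\<close>: there the
  convex section itself would be the relative boundary \<open>Z\<close>. A line through
  \<open>c0\<close> leaving \<open>closure U\<close> on both sides would put \<open>c0\<close>
  between two points of \<open>Z\<close>. So each direction or its opposite is a recession
  direction, and by continuity some direction is one in both senses.\<close>

lemma line_in_convex_relative_boundary:
  fixes u :: "'a::euclidean_space" and U :: "'a set" and c :: real
  defines "H \<equiv> {x. x \<bullet> u = c}"
  assumes dim: "DIM('a) \<ge> 3"
    and U: "convex U" "U \<noteq> {}" "U \<subset> H" "openin (top_of_set H) U"
    and Z: "Z = closure U - U" "convex Z"
  obtains z d where "d \<noteq> 0" "\<And>t. z + t *\<^sub>R d \<in> Z"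
proof -
  have H: "affine H" "closed H"
    using affine_hyperplane[of u c] closed_hyperplane[of u c] by (simp_all add: H_def inner_commute)
  have clU: "closure U \<subseteq> H" using U(3) H(2) by (intro closure_minimal) auto
  have aff: "affine hull U \<subseteq> H" using U(3) H(1) by (intro hull_minimal) auto
  have rel: "rel_interior U = U"
    unfolding rel_interior_eq
    using U(4) aff hull_subset[of U affine] by (meson openin_subset_trans)
  have seg: "open_segment a b \<subseteq> U" if "a \<in> U" "b \<in> closure U" for a b
    using rel_interior_closure_convex_segment[OF U(1)] that rel by blast
  obtain c0 where c0: "c0 \<in> U" using U(2) by blast
  have c0': "c0 \<in> closure U" "c0 \<bullet> u = c" using c0 closure_subset U(3) by (auto simp: H_def)
  have cross: "\<exists>s. 0 < s \<and> s < 1 \<and> c0 + s *\<^sub>R (y - c0) \<in> Z" if y: "y \<in> H" "y \<notin> closure U" for y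
  proof (rule ccontr)
    assume no: "\<not> ?thesis"
    let ?T = "closed_segment c0 y"
    have TH: "?T \<subseteq> H"
      using y(1) c0 U(3) H(1) by (intro closed_segment_subset affine_imp_convex) auto
    have eq: "?T \<inter> closure U = ?T \<inter> U"
    proof (intro equalityI subsetI)
      fix x assume x: "x \<in> ?T \<inter> closure U"
      then obtain s where s: "0 \<le> s" "s \<le> 1" "x = c0 + s *\<^sub>R (y - c0)"
        by (auto simp: in_segment algebra_simps)
      have "s \<noteq> 1" using s x y(2) by auto
      then have "s = 0 \<or> x \<notin> Z" using no s by force
      then show "x \<in> ?T \<inter> U" using x Z(1) s c0 by auto
    qed (use closure_subset in auto)
    have "openin (top_of_set ?T) (?T \<inter> U)"
      using U(4) TH by (metis openin_subtopology_Int subtopology_subtopology inf.absorb_iff2 inf_commute)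
    moreover have "closedin (top_of_set ?T) (?T \<inter> U)"
      unfolding eq[symmetric] by (simp add: closedin_closed_Int)
    ultimately have "?T \<inter> U = {} \<or> ?T \<inter> U = ?T"
      using connected_clopen[of ?T] by (meson connected_segment)
    moreover have "c0 \<in> ?T \<inter> U" using c0 by simp
    moreover have "y \<notin> U" "y \<in> ?T" using y(2) closure_subset by auto
    ultimately show False by blast
  qed
  obtain z where z: "z \<in> Z"
  proof -
    obtain y where y: "y \<in> H" "y \<notin> U" using U(3) by blast
    show thesis
      using cross[OF y(1)] y(2) Z(1) that by (cases "y \<in> closure U") auto
  qed
  define P where "P = {d. \<forall>t\<ge>0. c0 + t *\<^sub>R d \<in> closure U}"
  have "closed P"
  proof -
    have "P = (\<Inter>t\<in>{0..}. (\<lambda>d. c0 + t *\<^sub>R d) -` closure U)" by (auto simp: P_def)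
    also have "closed \<dots>"
      by (intro closed_INT ballI closed_vimage continuous_intros) auto
    finally show ?thesis .
  qed
  have dich: "d \<in> P \<or> - d \<in> P" if d: "d \<bullet> u = 0" for d
  proof (rule ccontr)
    assume "\<not> ?thesis"
    then obtain s t where st: "s \<ge> 0" "t \<ge> 0" "c0 + s *\<^sub>R d \<notin> closure U" "c0 + t *\<^sub>R (-d) \<notin> closure U"
      unfolding P_def by blast
    have "c0 + s *\<^sub>R d \<in> H" "c0 + t *\<^sub>R (-d) \<in> H"
      using c0'(2) d by (auto simp: H_def inner_add_left inner_diff_left)
    then obtain s' t' where s': "0 < s'" "c0 + s' *\<^sub>R (s *\<^sub>R d) \<in> Z"
      and t': "0 < t'" "c0 + t' *\<^sub>R (t *\<^sub>R (- d)) \<in> Z"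
      using cross[of "c0 + s *\<^sub>R d"] cross[of "c0 + t *\<^sub>R (-d)"] st by auto
    have st0: "s > 0" "t > 0" using st c0'(1) by (auto simp: order_le_less)
    \<comment> \<open>Parameters of points of \<open>Z\<close> on opposite sides of
      \<open>c0\<close>; the weights below recover \<open>c0\<close> from these points.\<close>
    define p where "p = s' * s" define r where "r = t' * t"
    have pr: "p > 0" "r > 0" using s' t' st0 by (auto simp: p_def r_def)
    then have one: "r / (p + r) + p / (p + r) = 1"
      by (simp add: add_divide_distrib[symmetric] add.commute)
    have "(r / (p + r)) *\<^sub>R (c0 + p *\<^sub>R d) + (p / (p + r)) *\<^sub>R (c0 - r *\<^sub>R d) \<in> Z"
    proof (rule convexD[OF Z(2)])
      show "r / (p + r) + p / (p + r) = 1" by (rule one)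
    qed (use s' t' pr in \<open>auto simp: p_def r_def\<close>)
    moreover have "(r / (p + r)) *\<^sub>R (c0 + p *\<^sub>R d) + (p / (p + r)) *\<^sub>R (c0 - r *\<^sub>R d)
        = (r / (p + r) + p / (p + r)) *\<^sub>R c0 + (r / (p + r) * p - p / (p + r) * r) *\<^sub>R d"
      by (simp add: algebra_simps)
    ultimately have "c0 \<in> Z" unfolding one by (simp add: mult.commute)
    then show False using Z(1) c0 by blast
  qed
  define d0 where "d0 = z - c0"
  have z': "z \<in> closure U" "z \<notin> U" using z Z(1) by auto
  have d0: "d0 \<bullet> u = 0" "d0 \<noteq> 0"
    using z' clU c0'(2) c0 by (auto simp: d0_def H_def inner_diff_left)
  \<comment> \<open>Otherwise \<open>z\<close> would be the midpoint of \<open>c0\<close> and a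
    point of \<open>closure U\<close>, hence in \<open>U\<close>.\<close>
  have "d0 \<notin> P"
  proof
    assume "d0 \<in> P"
    then have "c0 + 2 *\<^sub>R d0 \<in> closure U" unfolding P_def by (metis (mono_tags, lifting) mem_Collect_eq zero_le_numeral)
    then have "open_segment c0 (c0 + 2 *\<^sub>R d0) \<subseteq> U" using seg c0 by blast
    moreover have "z \<in> open_segment c0 (c0 + 2 *\<^sub>R d0)"
      unfolding in_segment using d0(2) by (intro conjI exI[of _ "1/2"]) (auto simp: d0_def algebra_simps simp flip: scaleR_add_left)
    ultimately show False using z' by blast
  qed
  then have mP: "- d0 \<in> P" using dich d0 by blast
  obtain e where e: "norm e = 1" "e \<bullet> u = 0" "e \<bullet> d0 = 0"
    using exists_orthogonal_unit[OF dim] by blast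
  \<comment> \<open>A half-turn from \<open>d0\<close> to \<open>- d0\<close> inside the plane. The
    conditions \<open>g \<theta> \<in> P\<close> and \<open>- g \<theta> \<in> P\<close> are closed,
    nonempty and exhaust the real line, so they overlap.\<close>
  define g where "g = (\<lambda>\<theta>. cos \<theta> *\<^sub>R d0 + sin \<theta> *\<^sub>R e)"
  have gu: "g \<theta> \<bullet> u = 0" for \<theta> using d0 e by (simp add: g_def inner_add_left)
  have g0: "g \<theta> \<noteq> 0" for \<theta>
  proof
    assume "g \<theta> = 0"
    moreover have "g \<theta> \<bullet> e = sin \<theta>" "g \<theta> \<bullet> d0 = cos \<theta> * (d0 \<bullet> d0)"
      using e by (simp_all add: g_def inner_add_left inner_commute[of d0 e] dot_square_norm)
    ultimately have "sin \<theta> = 0" "cos \<theta> = 0" using d0(2) by auto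
    then show False using sin_cos_squared_add[of \<theta>] by simp
  qed
  have cg: "continuous_on UNIV g" unfolding g_def by (intro continuous_intros)
  have "\<exists>\<theta>. g \<theta> \<in> P \<and> - g \<theta> \<in> P"
  proof (rule ccontr)
    assume no: "\<not> ?thesis"
    have "closed (g -` P)" "closed ((\<lambda>\<theta>. - g \<theta>) -` P)"
      using cg \<open>closed P\<close> by (auto intro!: closed_vimage continuous_intros)
    moreover have "UNIV \<subseteq> g -` P \<union> (\<lambda>\<theta>. - g \<theta>) -` P" using dich gu by auto
    moreover have "g -` P \<inter> (\<lambda>\<theta>. - g \<theta>) -` P = {}" using no by auto
    moreover have "pi \<in> g -` P" "0 \<in> (\<lambda>\<theta>. - g \<theta>) -` P" using mP by (auto simp: g_def)
    ultimately show False
      using connected_closedD[OF connected_UNIV, of "g -` P" "(\<lambda>\<theta>. - g \<theta>) -` P"] by auto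
  qed
  then obtain \<theta> where th: "g \<theta> \<in> P" "- g \<theta> \<in> P" by blast
  have rec: "z + t *\<^sub>R g \<theta> \<in> closure U" for t
  proof (cases "t \<ge> 0")
    case True
    show ?thesis
      by (rule recession_direction[OF closed_closure convex_closure[OF U(1)] _ z'(1) True, of c0])
        (use th in \<open>auto simp: P_def\<close>)
  next
    case False
    have "z + (-t) *\<^sub>R (- g \<theta>) \<in> closure U"
      by (rule recession_direction[OF closed_closure convex_closure[OF U(1)] _ z'(1), of c0])
        (use th False in \<open>auto simp: P_def\<close>)
    then show ?thesis by simp
  qed
  have "z + t *\<^sub>R g \<theta> \<notin> U" for t
  proof
    assume t: "z + t *\<^sub>R g \<theta> \<in> U"
    then have "t \<noteq> 0" using z' by auto
    have "open_segment (z + t *\<^sub>R g \<theta>) (z + (-t) *\<^sub>R g \<theta>) \<subseteq> U" using seg[OF t rec] .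
    moreover have "z \<in> open_segment (z + t *\<^sub>R g \<theta>) (z + (-t) *\<^sub>R g \<theta>)"
    proof -
      have "t *\<^sub>R g \<theta> \<noteq> (-t) *\<^sub>R g \<theta>" using \<open>t \<noteq> 0\<close> g0[of \<theta>] by (metis add_diff_cancel_left' real_vector.scale_right_imp_eq neg_equal_zero)
      then show ?thesis unfolding in_segment
        by (intro conjI exI[of _ "1/2"]) (auto simp: algebra_simps simp flip: scaleR_add_left)
    qed
    ultimately show False using z' by blast
  qed
  then show thesis using that[OF g0] rec Z(1) by blast
qed

section \<open>Families of planes cutting a line-free convex set\<close>

text \<open>The line-free case. \<open>D\<close> lives on all nonzero normals so that normals can be
  moved along segments. Of each convex quadric \<open>sect\<close> retains a quadratic function that
  vanishes on the boundary of the section but not on the whole plane.\<close>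

locale plane_sections =
  fixes K :: "'a::euclidean_space set" and D :: "'a \<Rightarrow> real"
  assumes dim: "DIM('a) \<ge> 3"
    and closed: "closed K"
    and conv: "convex K"
    and no_line: "\<And>x d. d \<noteq> 0 \<Longrightarrow> \<exists>t. x + t *\<^sub>R d \<notin> K"
    and cont: "continuous_on (- {0}) D"
    and meets: "\<And>u. u \<noteq> 0 \<Longrightarrow> \<exists>p\<in>interior K. p \<bullet> u = D u"
    and sect: "\<And>u. u \<noteq> 0 \<Longrightarrow> \<exists>q. quadratic q \<and> (\<forall>x\<in>frontier K. x \<bullet> u = D u \<longrightarrow> q x = 0) \<and>
      (\<exists>x. x \<bullet> u = D u \<and> q x \<noteq> 0)"
begin

text \<open>The barrier cone of \<open>K\<close>: the normals at which the support function is
  finite.\<close>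

definition barrier :: "'a set" where
  "barrier = {u. \<exists>b. \<forall>x\<in>K. x \<bullet> u \<le> b}"

text \<open>The set \<open>W\<close> consists of the normals \<open>u \<noteq> 0\<close> for which all caps \<open>x \<bullet> u \<ge> t\<close> of \<open>K\<close>
  are bounded.\<close>

definition W :: "'a set" where
  "W = interior barrier - {0}"

lemma frontier_K: "frontier K = K - interior K"
  using closed by (simp add: frontier_def)

lemma frontier_in_K: "x \<in> frontier K \<Longrightarrow> x \<in> K"
  by (simp add: frontier_K)

lemma interior_in_K: "x \<in> interior K \<Longrightarrow> x \<in> K"
  using interior_subset by blast

lemma interior_ne: "interior K \<noteq> {}"
  using meets[of "SOME i. i \<in> Basis"] nonzero_Basis SOME_Basis by fastforce

lemma closure_interior_K: "closure (interior K) = K"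
  using convex_closure_interior[OF conv interior_ne] closed by simp

lemma barrier_scale: "u \<in> barrier \<Longrightarrow> t \<ge> 0 \<Longrightarrow> t *\<^sub>R u \<in> barrier"
  unfolding barrier_def by (auto intro: mult_left_mono)

lemma convex_barrier: "convex barrier"
proof (rule convexI)
  fix u v :: 'a and s t :: real
  assume *: "u \<in> barrier" "v \<in> barrier" "0 \<le> s" "0 \<le> t" "s + t = 1"
  then obtain b c where "\<forall>x\<in>K. x \<bullet> u \<le> b" "\<forall>x\<in>K. x \<bullet> v \<le> c" unfolding barrier_def by blast
  then have "\<forall>x\<in>K. x \<bullet> (s *\<^sub>R u + t *\<^sub>R v) \<le> s * b + t * c"
    using * by (auto simp: inner_add_right intro!: add_mono mult_left_mono)
  then show "s *\<^sub>R u + t *\<^sub>R v \<in> barrier" unfolding barrier_def by blast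
qed

lemma convex_interior_barrier: "convex (interior barrier)"
  by (rule convex_interior[OF convex_barrier])

text \<open>The polar of the barrier cone is the recession cone: a functional separating the point
  from \<open>K\<close> is, up to sign, an element of \<open>barrier\<close>.\<close>

lemma recession_if_polar:
  assumes "\<And>w. w \<in> barrier \<Longrightarrow> w \<bullet> r \<le> 0" "x \<in> K" "t \<ge> 0"
  shows "x + t *\<^sub>R r \<in> K"
proof (rule ccontr)
  assume "x + t *\<^sub>R r \<notin> K"
  then obtain a b where ab: "a \<bullet> (x + t *\<^sub>R r) < b" "\<And>y. y \<in> K \<Longrightarrow> b < a \<bullet> y"
    using separating_hyperplane_closed_point[OF conv closed] by metis
  have "\<forall>y\<in>K. y \<bullet> (- a) \<le> - b" using ab(2) by (simp add: inner_commute less_imp_le)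
  then have "(- a) \<bullet> r \<le> 0" using assms(1) unfolding barrier_def by blast
  then have "a \<bullet> x \<le> a \<bullet> (x + t *\<^sub>R r)" using assms(3) by (simp add: inner_add_right)
  then show False using ab(1) ab(2)[OF assms(2)] by linarith
qed

text \<open>A convex set without interior lies in a hyperplane, here one through 0. Its normal and
  the opposite vector are both polar to \<open>barrier\<close>, so \<open>K\<close> would contain a
  line.\<close>

lemma interior_barrier_ne: "interior barrier \<noteq> {}"
proof
  assume "interior barrier = {}"
  then obtain r b where r: "r \<noteq> 0" "barrier \<subseteq> {x. r \<bullet> x = b}"
    using empty_interior_subset_hyperplane[OF convex_barrier] by blast
  have "0 \<in> barrier" by (auto simp: barrier_def)
  then have b: "b = 0" using r(2) by auto
  obtain x where x: "x \<in> K" using interior_ne interior_in_K by blast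
  have "x + t *\<^sub>R r \<in> K" for t
  proof (cases "t \<ge> 0")
    case True
    then show ?thesis using r(2) b x by (intro recession_if_polar) (auto simp: inner_commute)
  next
    case False
    have "x + (- t) *\<^sub>R (- r) \<in> K"
      using r(2) b x False by (intro recession_if_polar) (auto simp: inner_commute)
    then show ?thesis by simp
  qed
  then show False using no_line[OF r(1)] by blast
qed

lemma open_W: "open W"
  unfolding W_def by (intro open_delete open_interior)

lemma W_ne: "W \<noteq> {}"
proof
  assume "W = {}"
  then have "interior barrier = {0}" using interior_barrier_ne unfolding W_def by blast
  then show False using open_interior[of barrier] not_open_singleton[of "0::'a"] by simp
qed

lemma connected_W: "connected W"
  unfolding W_def using dim
  by (intro connected_open_delete open_interior convex_connected convex_interior_barrier) auto

lemma W_nz: "u \<in> W \<Longrightarrow> u \<noteq> 0" and W_interior: "u \<in> W \<Longrightarrow> u \<in> interior barrier"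
  by (auto simp: W_def)

text \<open>The normals \<open>u + e *\<^sub>R i\<close> and \<open>u - e *\<^sub>R i\<close> bound
  \<open>K\<close> from above; at heights at least \<open>t\<close> over \<open>u\<close> this
  bounds the coordinate along \<open>i\<close> from both sides.\<close>

lemma bounded_slab:
  assumes "u \<in> interior barrier"
  shows "bounded {x \<in> K. t \<le> x \<bullet> u}"
proof -
  obtain e where e: "e > 0" "cball u e \<subseteq> barrier"
    using assms mem_interior_cball by blast
  have "\<exists>C. \<forall>x\<in>K. t \<le> x \<bullet> u \<longrightarrow> \<bar>x \<bullet> i\<bar> \<le> C" if i: "i \<in> Basis" for i
  proof -
    have "u + e *\<^sub>R i \<in> barrier" "u - e *\<^sub>R i \<in> barrier"
      using e i by (auto simp: dist_norm subset_iff)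
    then obtain b c where bc: "\<forall>x\<in>K. x \<bullet> (u + e *\<^sub>R i) \<le> b" "\<forall>x\<in>K. x \<bullet> (u - e *\<^sub>R i) \<le> c"
      unfolding barrier_def by blast
    have "\<bar>x \<bullet> i\<bar> \<le> (max b c - t) / e" if "x \<in> K" "t \<le> x \<bullet> u" for x
    proof -
      have "x \<bullet> u + e * (x \<bullet> i) \<le> b" "x \<bullet> u - e * (x \<bullet> i) \<le> c"
        using bc that by (auto simp: inner_add_right inner_diff_right)
      then have "e * \<bar>x \<bullet> i\<bar> \<le> max b c - t" using that(2) by (auto simp: abs_if)
      then show ?thesis using e(1) by (simp add: field_simps)
    qed
    then show ?thesis by blast
  qed
  then obtain C where C: "\<And>i x. i \<in> Basis \<Longrightarrow> x \<in> K \<Longrightarrow> t \<le> x \<bullet> u \<Longrightarrow> \<bar>x \<bullet> i\<bar> \<le> C i"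
    by metis
  have "norm x \<le> (\<Sum>i\<in>Basis. C i)" if "x \<in> K" "t \<le> x \<bullet> u" for x
    using norm_le_l1[of x] C that by (meson order_trans sum_mono)
  then show ?thesis unfolding bounded_iff by blast
qed

section \<open>Chords of bounded sections\<close>

lemma line_leaves:
  assumes "u \<in> interior barrier" "d \<bullet> u = 0" "d \<noteq> 0"
  obtains t where "t > 0" "z + t *\<^sub>R d \<notin> K"
proof -
  obtain M where M: "\<And>x. x \<in> K \<Longrightarrow> z \<bullet> u \<le> x \<bullet> u \<Longrightarrow> norm x \<le> M"
    using bounded_slab[OF assms(1), of "z \<bullet> u"] unfolding bounded_iff by auto
  define t where "t = (\<bar>M\<bar> + norm z + 1) / norm d"
  have "t > 0" using assms(3) by (simp add: t_def add_nonneg_pos)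
  have "norm (t *\<^sub>R d) = \<bar>M\<bar> + norm z + 1"
    using assms(3) by (simp add: t_def add_nonneg_nonneg)
  then have "norm (z + t *\<^sub>R d) > M" using norm_triangle_ineq2[of "t *\<^sub>R d" "- z"] by (simp add: add.commute)
  moreover have "z \<bullet> u \<le> (z + t *\<^sub>R d) \<bullet> u" using assms(2) by (simp add: inner_add_left)
  ultimately have "z + t *\<^sub>R d \<notin> K" using M by fastforce
  then show thesis using that \<open>t > 0\<close> by blast
qed

lemma line_meets_frontier:
  assumes "z \<in> interior K" "z + t *\<^sub>R d \<notin> K" "t > 0"
  obtains s where "0 < s" "s < t" "z + s *\<^sub>R d \<in> frontier K"
proof -
  obtain s where s: "0 < s" "s < 1" "z + s *\<^sub>R ((z + t *\<^sub>R d) - z) \<in> frontier K"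
    using frontier_on_segment[OF closed assms(1), of "z + t *\<^sub>R d"] assms(2) interior_in_K by metis
  then show thesis using assms(3) by (intro that[of "s * t"]) auto
qed

lemma line_frontier_points:
  assumes "u \<in> interior barrier" "d \<bullet> u = 0" "d \<noteq> 0" "z \<in> interior K"
  obtains t1 t2 where "t1 > 0" "t2 < 0" "z + t1 *\<^sub>R d \<in> frontier K" "z + t2 *\<^sub>R d \<in> frontier K"
proof -
  obtain t where "t > 0" "z + t *\<^sub>R d \<notin> K" using line_leaves[OF assms(1-3)] by blast
  then obtain t1 where t1: "t1 > 0" "z + t1 *\<^sub>R d \<in> frontier K"
    using line_meets_frontier[OF assms(4)] by blast
  obtain t where "t > 0" "z + t *\<^sub>R (- d) \<notin> K"
    using line_leaves[OF assms(1), of "- d"] assms(2,3) by auto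
  then obtain t2 where t2: "t2 > 0" "z + t2 *\<^sub>R (- d) \<in> frontier K"
    using line_meets_frontier[OF assms(4)] by blast
  show thesis using that[of t1 "- t2"] t1 t2 by auto
qed

lemma exit_parameter:
  assumes "z \<in> interior K" "t > 0" "z + t *\<^sub>R (x - z) \<in> frontier K"
  shows "x \<in> interior K \<Longrightarrow> t > 1" and "x \<notin> K \<Longrightarrow> t < 1"
proof -
  show "t > 1" if x: "x \<in> interior K"
  proof (rule ccontr)
    assume "\<not> t > 1"
    then have "z + t *\<^sub>R (x - z) \<in> interior K"
    proof (cases "t = 1")
      case True
      then show ?thesis using x by simp
    next
      case False
      then show ?thesis using \<open>\<not> t > 1\<close> assms x interior_in_K
        by (intro interior_segment[OF conv]) auto
    qed
    then show False using assms(3) by (simp add: frontier_K)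
  qed
  show "t < 1" if x: "x \<notin> K"
  proof (rule ccontr)
    assume "\<not> t < 1"
    let ?y = "z + t *\<^sub>R (x - z)"
    have "(1 - 1 / t) *\<^sub>R z + (1 / t) *\<^sub>R ?y \<in> K"
      using \<open>\<not> t < 1\<close> assms interior_in_K frontier_in_K by (intro convexD_alt[OF conv]) auto
    moreover have "(1 - 1 / t) *\<^sub>R z + (1 / t) *\<^sub>R ?y = x" using assms(2) by (simp add: algebra_simps)
    ultimately show False using x by simp
  qed
qed

text \<open>The sign condition leaves, for \<open>u \<in> W\<close>, only a positive factor free on
  the plane of \<open>u\<close>. Off that plane \<open>q\<close> is unrestricted.\<close>

definition section_form :: "'a \<Rightarrow> ('a \<Rightarrow> real) \<Rightarrow> bool" where
  "section_form u q \<longleftrightarrow> quadratic q \<and> (\<forall>x\<in>frontier K. x \<bullet> u = D u \<longrightarrow> q x = 0) \<and>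
    (\<forall>x\<in>interior K. x \<bullet> u = D u \<longrightarrow> q x < 0) \<and> (\<forall>x. x \<notin> K \<longrightarrow> x \<bullet> u = D u \<longrightarrow> q x > 0)"

lemma section_formD:
  assumes "section_form u q"
  shows "quadratic q" "x \<in> frontier K \<Longrightarrow> x \<bullet> u = D u \<Longrightarrow> q x = 0"
    "x \<in> interior K \<Longrightarrow> x \<bullet> u = D u \<Longrightarrow> q x < 0" "x \<notin> K \<Longrightarrow> x \<bullet> u = D u \<Longrightarrow> q x > 0"
  using assms unfolding section_form_def by auto

lemma section_form_cmult: "section_form u q \<Longrightarrow> k > 0 \<Longrightarrow> section_form u (\<lambda>x. k * q x)"
  unfolding section_form_def by (auto intro: quadratic_cmult simp: mult_less_0_iff zero_less_mult_iff)

text \<open>On the line from an interior point \<open>z\<close> through \<open>x\<close>,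
  \<open>q x\<close> is \<open>q z\<close> times \<open>(1 - 1 / t1) * (1 - 1 / t2)\<close>, whose
  sign tells whether \<open>x\<close> comes before or after the exit from \<open>K\<close>. Since
  \<open>q\<close> is nonzero somewhere on the plane, \<open>q z\<close> is nonzero and can be
  normalised.\<close>

lemma section_form_exists:
  assumes "u \<in> W"
  obtains q where "section_form u q"
proof -
  obtain q where q: "quadratic q" "\<And>x. x \<in> frontier K \<Longrightarrow> x \<bullet> u = D u \<Longrightarrow> q x = 0"
    and qn: "\<exists>x. x \<bullet> u = D u \<and> q x \<noteq> 0"
    using sect[OF W_nz[OF assms]] by blast
  obtain y where y: "y \<bullet> u = D u" "q y \<noteq> 0" using qn by blast
  obtain z where z: "z \<in> interior K" "z \<bullet> u = D u" using meets[OF W_nz[OF assms]] by blast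
  have val: "\<exists>f. q x = q z * f \<and> (x \<in> interior K \<longrightarrow> f > 0) \<and> (x \<notin> K \<longrightarrow> f < 0)"
    if x: "x \<bullet> u = D u" for x
  proof (cases "x = z")
    case True
    then show ?thesis using z interior_in_K by (intro exI[of _ 1]) auto
  next
    case False
    have d: "(x - z) \<bullet> u = 0" "x - z \<noteq> 0" using x z False by (auto simp: inner_diff_left)
    obtain t1 t2 where t: "t1 > 0" "t2 < 0" "z + t1 *\<^sub>R (x - z) \<in> frontier K" "z + t2 *\<^sub>R (x - z) \<in> frontier K"
      using line_frontier_points[OF W_interior[OF assms] d z(1)] by blast
    have "(z + s *\<^sub>R (x - z)) \<bullet> u = D u" for s using d z by (simp add: inner_add_left)
    then have "q (z + t1 *\<^sub>R (x - z)) = 0" "q (z + t2 *\<^sub>R (x - z)) = 0" using t q(2) by auto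
    from quadratic_two_roots[OF q(1) this, of 1] t
    have "q x = q z * ((1 - 1 / t1) * (1 - 1 / t2))" by simp
    moreover have "1 - 1 / t2 > 0" using t(2) by (simp add: field_simps)
    moreover have "1 - 1 / t1 > 0" if "x \<in> interior K"
      using exit_parameter(1)[OF z(1) t(1,3) that] by (simp add: field_simps)
    moreover have "1 - 1 / t1 < 0" if "x \<notin> K"
      using exit_parameter(2)[OF z(1) t(1,3) that] t(1) by (simp add: field_simps)
    ultimately show ?thesis
      by (intro exI[of _ "(1 - 1 / t1) * (1 - 1 / t2)"]) (auto simp: mult_neg_pos)
  qed
  have qz: "q z \<noteq> 0" using val[OF y(1)] y(2) by auto
  define p where "p = (\<lambda>x. (- inverse (q z)) * q x)"
  have "\<exists>f. p x = - f \<and> (x \<in> interior K \<longrightarrow> f > 0) \<and> (x \<notin> K \<longrightarrow> f < 0)" if "x \<bullet> u = D u" for x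
    using val[OF that] qz by (auto simp: p_def field_simps)
  moreover have "quadratic p" unfolding p_def by (rule quadratic_cmult[OF q(1)])
  ultimately have "section_form u p"
    unfolding section_form_def using q(2) by (fastforce simp: p_def)
  then show thesis using that by blast
qed

text \<open>The line from \<open>z\<close> through \<open>x\<close> lies in both planes, and both
  forms vanish at its two boundary points, so they equal their values at \<open>z\<close> times one
  common factor.\<close>

lemma section_forms_proportional:
  assumes u: "u \<in> W" "section_form u q" "section_form u' q'"
    and z: "z \<in> interior K" "z \<bullet> u = D u" "z \<bullet> u' = D u'"
    and x: "x \<bullet> u = D u" "x \<bullet> u' = D u'"
  shows "q x * q' z = q' x * q z"
proof (cases "x = z")
  case False
  have d: "(x - z) \<bullet> u = 0" "(x - z) \<bullet> u' = 0" "x - z \<noteq> 0" using x z False by (auto simp: inner_diff_left)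
  obtain t1 t2 where t: "t1 > 0" "t2 < 0" "z + t1 *\<^sub>R (x - z) \<in> frontier K" "z + t2 *\<^sub>R (x - z) \<in> frontier K"
    using line_frontier_points[OF W_interior[OF u(1)] d(1,3) z(1)] by blast
  have pl: "(z + s *\<^sub>R (x - z)) \<bullet> u = D u" "(z + s *\<^sub>R (x - z)) \<bullet> u' = D u'" for s
    using d z by (simp_all add: inner_add_left)
  have "q x = q z * (1 - 1 / t1) * (1 - 1 / t2)"
    using quadratic_two_roots[OF section_formD(1)[OF u(2)], of z t1 "x - z" t2 1]
      section_formD(2)[OF u(2)] t pl by simp
  moreover have "q' x = q' z * (1 - 1 / t1) * (1 - 1 / t2)"
    using quadratic_two_roots[OF section_formD(1)[OF u(3)], of z t1 "x - z" t2 1]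
      section_formD(2)[OF u(3)] t pl by simp
  ultimately show ?thesis by simp
qed (simp add: mult.commute)

section \<open>Outer normals and first-order comparison of section forms\<close>

lemma frontier_normal:
  assumes "x \<in> frontier K"
  obtains v where "norm v = 1" "\<And>y. y \<in> K \<Longrightarrow> y \<bullet> v \<le> x \<bullet> v"
proof -
  have "x \<in> closure K" using assms frontier_in_K closed by auto
  moreover have "x \<notin> rel_interior K"
    using assms rel_interior_nonempty_interior[OF interior_ne] by (simp add: frontier_K)
  ultimately obtain a where a: "a \<noteq> 0" "\<And>y. y \<in> closure K \<Longrightarrow> a \<bullet> x \<le> a \<bullet> y"
    using supporting_hyperplane_relative_frontier[OF conv] by metis
  have "y \<bullet> (- (a /\<^sub>R norm a)) \<le> x \<bullet> (- (a /\<^sub>R norm a))" if "y \<in> K" for y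
    using a(2)[of y] that closed a(1) by (simp add: inner_commute divide_right_mono)
  then show thesis using a(1) by (intro that[of "- (a /\<^sub>R norm a)"]) auto
qed

lemma normal_in_barrier: "(\<And>y. y \<in> K \<Longrightarrow> y \<bullet> v \<le> m) \<Longrightarrow> v \<in> barrier"
  unfolding barrier_def by blast

lemma interior_strict:
  assumes "p \<in> interior K" "v \<noteq> 0" "\<And>y. y \<in> K \<Longrightarrow> y \<bullet> v \<le> m"
  shows "p \<bullet> v < m"
proof -
  obtain e where e: "e > 0" "cball p e \<subseteq> K" using assms(1) mem_interior_cball by blast
  have "p + (e / norm v) *\<^sub>R v \<in> cball p e" using e(1) assms(2) by (simp add: dist_norm)
  then have "(p + (e / norm v) *\<^sub>R v) \<bullet> v \<le> m" using e(2) assms(3) by blast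
  moreover have "(e / norm v) * (v \<bullet> v) > 0" using e(1) assms(2) by simp
  ultimately show ?thesis by (simp add: inner_add_left)
qed

text \<open>The plane of \<open>v\<close> meets the interior of \<open>K\<close>, which lies
  strictly below the supporting plane at \<open>x\<close>.\<close>

lemma normal_above:
  assumes "v \<noteq> 0" "\<And>y. y \<in> K \<Longrightarrow> y \<bullet> v \<le> x \<bullet> v"
  shows "D v < x \<bullet> v"
  using meets[OF assms(1)] interior_strict[OF _ assms] by metis

text \<open>Half of \<open>q (c + d) - q (c - d)\<close> is the derivative of the quadratic function \<open>q\<close> at \<open>c\<close>
  in direction \<open>d\<close>.\<close>

lemma section_form_derivative:
  assumes u: "u \<in> W" "section_form u q"
    and c: "c \<in> frontier K" "c \<bullet> u = D u"
    and v: "\<And>y. y \<in> K \<Longrightarrow> y \<bullet> v \<le> c \<bullet> v" "v \<noteq> 0"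
  obtains k where "k > 0" "\<And>d. d \<bullet> u = 0 \<Longrightarrow> (q (c + d) - q (c - d)) / 2 = k * (v \<bullet> d)"
proof -
  obtain B L where B: "bilinear B" and L: "linear L" and BL: "\<And>w. q (c + w) = q c + L w + B w w"
    using quadratic_expand[OF section_formD(1)[OF u(2)]] by metis
  have qc: "q c = 0" using section_formD(2)[OF u(2) c] .
  have der: "(q (c + d) - q (c - d)) / 2 = L d" for d
    using BL[of d] BL[of "- d"] L B by (simp add: linear_neg bilinear_lneg bilinear_rneg)
  have line: "q (c + t *\<^sub>R d) = t * L d + t\<^sup>2 * B d d" for t d
    using BL L B qc by (simp add: linear_cmul bilinear_lmul bilinear_rmul power2_eq_square)
  have inK: "c + t *\<^sub>R d \<in> K" if "d \<bullet> u = 0" "q (c + t *\<^sub>R d) < 0" for t d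
    using section_formD(4)[OF u(2), of "c + t *\<^sub>R d"] that c(2) by (force simp: inner_add_left)
  have neg: "v \<bullet> d < 0" if d: "d \<bullet> u = 0" "L d < 0" for d
  proof -
    define A where "A = \<bar>B d d\<bar> + 1"
    \<comment> \<open>At this parameter the quadratic term cancels at most half of the negative
      linear term, so \<open>q\<close> is still negative.\<close>
    define t where "t = - L d / (2 * A)"
    have A: "A > 0" "B d d \<le> A" by (auto simp: A_def)
    have t: "t > 0" using d A by (simp add: t_def divide_neg_pos)
    have "t * B d d \<le> t * A" using t A by (intro mult_left_mono) auto
    also have "\<dots> = - L d / 2" using A by (simp add: t_def)
    finally have "t * (L d + t * B d d) < 0" using t d by (intro mult_pos_neg) auto
    then have q: "q (c + t *\<^sub>R d) < 0" by (simp add: line power2_eq_square algebra_simps)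
    have "(c + t *\<^sub>R d) \<bullet> u = D u" using d c by (simp add: inner_add_left)
    then have "c + t *\<^sub>R d \<in> interior K"
      using inK[OF d(1) q] q section_formD(2)[OF u(2)] frontier_K by fastforce
    from interior_strict[OF this v(2) v(1)] show ?thesis
      using t by (simp add: inner_add_left inner_commute[of v d] mult_less_0_iff)
  qed
  obtain z where z: "z \<in> interior K" "z \<bullet> u = D u" using meets[OF W_nz[OF u(1)]] by blast
  define d0 where "d0 = z - c"
  have d0: "d0 \<bullet> u = 0" "v \<bullet> d0 < 0"
    using z c interior_strict[OF z(1) v(2) v(1)] by (auto simp: d0_def inner_diff_left inner_diff_right inner_commute)
  \<comment> \<open>If the linear part vanished along \<open>d0\<close>, \<open>q\<close> would be
    equally negative at the reflection \<open>c - d0\<close> of \<open>z\<close>, which lies beyond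
    the supporting plane at \<open>c\<close>.\<close>
  have "L d0 < 0"
  proof (rule ccontr)
    assume "\<not> L d0 < 0"
    moreover have "\<not> L d0 > 0"
      using neg[of "- d0"] d0 L by (auto simp: linear_neg)
    ultimately have L0: "L d0 = 0" by simp
    have "q (c + 1 *\<^sub>R d0) < 0" using section_formD(3)[OF u(2) z] by (simp add: d0_def)
    then have "q (c + (-1) *\<^sub>R d0) < 0" unfolding line L0 by simp
    then have "c + (-1) *\<^sub>R d0 \<in> K" by (rule inK[OF d0(1)])
    from v(1)[OF this] d0(2) show False by (simp add: inner_diff_left inner_commute[of v d0])
  qed
  define k where "k = L d0 / (v \<bullet> d0)"
  have "k > 0" using \<open>L d0 < 0\<close> d0(2) by (simp add: k_def divide_neg_neg)
  moreover have "L d = k * (v \<bullet> d)" if d: "d \<bullet> u = 0" for d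
  proof -
    \<comment> \<open>Subtracting the right multiple of \<open>d0\<close> makes \<open>d'\<close>
      orthogonal to \<open>v\<close>; then neither \<open>d'\<close> nor its opposite can have
      negative derivative.\<close>
    define d' where "d' = d - ((v \<bullet> d) / (v \<bullet> d0)) *\<^sub>R d0"
    have d': "d' \<bullet> u = 0" "v \<bullet> d' = 0" using d d0 by (auto simp: d'_def inner_diff_left inner_diff_right)
    have "L d' = 0" using neg[of d'] neg[of "- d'"] d' L by (force simp: linear_neg)
    then show ?thesis
      using L by (simp add: d'_def k_def linear_diff linear_cmul)
  qed
  ultimately show thesis using der that by metis
qed

definition crossing :: "'a \<Rightarrow> 'a \<Rightarrow> bool" where
  "crossing u u' \<longleftrightarrow> (\<exists>z\<in>interior K. z \<bullet> u = D u \<and> z \<bullet> u' = D u')"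

text \<open>On the last common part the forms agree up to a factor \<open>m\<close>, to be found at
  the common point \<open>c\<close>. If \<open>q1 c\<close> is nonzero, its value gives
  \<open>m = 1\<close>. If \<open>c\<close> is on the boundary, the derivative of each form at
  \<open>c\<close> within its plane is a multiple of the outer normal \<open>v\<close>, and the
  agreements along the first two pairs equate the three multiples.\<close>

lemma section_forms_consistent:
  assumes W: "u1 \<in> W" "u2 \<in> W" "u3 \<in> W"
    and q: "section_form u1 q1" "section_form u2 q2" "section_form u3 q3"
    and cr: "crossing u1 u2" "crossing u1 u3" "crossing u2 u3"
    and c: "c \<bullet> u1 = D u1" "c \<bullet> u2 = D u2" "c \<bullet> u3 = D u3"
    and eq12: "\<And>x. x \<bullet> u1 = D u1 \<Longrightarrow> x \<bullet> u2 = D u2 \<Longrightarrow> q2 x = q1 x"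
    and eq13: "\<And>x. x \<bullet> u1 = D u1 \<Longrightarrow> x \<bullet> u3 = D u3 \<Longrightarrow> q3 x = q1 x"
    and x: "x \<bullet> u2 = D u2" "x \<bullet> u3 = D u3"
  shows "q3 x = q2 x"
proof -
  obtain z where z: "z \<in> interior K" "z \<bullet> u2 = D u2" "z \<bullet> u3 = D u3"
    using cr(3) unfolding crossing_def by blast
  define m where "m = q3 z / q2 z"
  have q2z: "q2 z < 0" using section_formD(3)[OF q(2) z(1,2)] .
  have ratio: "q3 y = m * q2 y" if "y \<bullet> u2 = D u2" "y \<bullet> u3 = D u3" for y
    using section_forms_proportional[OF W(2) q(2,3) z that] q2z by (simp add: m_def field_simps)
  have "m = 1"
  proof (cases "c \<in> frontier K")
    case False
    then have "q1 c \<noteq> 0" using section_formD(3,4)[OF q(1)] c(1) frontier_K by (metis DiffI less_irrefl)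
    then show ?thesis using ratio[OF c(2,3)] eq12[OF c(1,2)] eq13[OF c(1,3)] by simp
  next
    case True
    obtain v where v: "norm v = 1" "\<And>y. y \<in> K \<Longrightarrow> y \<bullet> v \<le> c \<bullet> v" using frontier_normal[OF True] by blast
    have v0: "v \<noteq> 0" using v(1) by auto
    obtain k1 where k1: "\<And>d. d \<bullet> u1 = 0 \<Longrightarrow> (q1 (c + d) - q1 (c - d)) / 2 = k1 * (v \<bullet> d)"
      using section_form_derivative[OF W(1) q(1) True c(1) v(2) v0] by metis
    obtain k2 where k2: "k2 > 0" "\<And>d. d \<bullet> u2 = 0 \<Longrightarrow> (q2 (c + d) - q2 (c - d)) / 2 = k2 * (v \<bullet> d)"
      using section_form_derivative[OF W(2) q(2) True c(2) v(2) v0] by metis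
    obtain k3 where k3: "\<And>d. d \<bullet> u3 = 0 \<Longrightarrow> (q3 (c + d) - q3 (c - d)) / 2 = k3 * (v \<bullet> d)"
      using section_form_derivative[OF W(3) q(3) True c(3) v(2) v0] by metis
    \<comment> \<open>An interior point common to two planes gives a direction from \<open>c\<close>
      on which \<open>v\<close> is negative.\<close>
    have dir: "\<exists>d. d \<bullet> u = 0 \<and> d \<bullet> u' = 0 \<and> v \<bullet> d \<noteq> 0"
      if "crossing u u'" "c \<bullet> u = D u" "c \<bullet> u' = D u'" for u u'
    proof -
      obtain z where "z \<in> interior K" "z \<bullet> u = D u" "z \<bullet> u' = D u'"
        using \<open>crossing u u'\<close> unfolding crossing_def by blast
      then show ?thesis using interior_strict[OF _ v0 v(2), of z] that(2,3)
        by (intro exI[of _ "z - c"]) (auto simp: inner_diff_left inner_diff_right inner_commute)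
    qed
    obtain d where "d \<bullet> u1 = 0" "d \<bullet> u2 = 0" "v \<bullet> d \<noteq> 0" using dir[OF cr(1) c(1,2)] by blast
    then have "k1 = k2"
      using k1[of d] k2(2)[of d] eq12[of "c + d"] eq12[of "c - d"] c by (simp add: inner_add_left inner_diff_left)
    obtain d where "d \<bullet> u1 = 0" "d \<bullet> u3 = 0" "v \<bullet> d \<noteq> 0" using dir[OF cr(2) c(1,3)] by blast
    then have "k1 = k3"
      using k1[of d] k3[of d] eq13[of "c + d"] eq13[of "c - d"] c by (simp add: inner_add_left inner_diff_left)
    obtain d where d: "d \<bullet> u2 = 0" "d \<bullet> u3 = 0" "v \<bullet> d \<noteq> 0" using dir[OF cr(3) c(2,3)] by blast
    then have "(q3 (c + d) - q3 (c - d)) / 2 = m * ((q2 (c + d) - q2 (c - d)) / 2)"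
      using ratio[of "c + d"] ratio[of "c - d"] c by (simp add: inner_add_left inner_diff_left algebra_simps)
    then have "k3 * (v \<bullet> d) = m * (k2 * (v \<bullet> d))" using k3[OF d(2)] k2(2)[OF d(1)] by simp
    then show ?thesis using d(3) \<open>k1 = k2\<close> \<open>k1 = k3\<close> k2(1) by simp
  qed
  then show ?thesis using ratio[OF x] by simp
qed

end

section \<open>Gluing quadratic functions along three planes\<close>

lemma dual_vector:
  fixes u :: "'a::euclidean_space"
  assumes "u \<notin> span S"
  obtains e where "e \<bullet> u = 1" "\<And>y. y \<in> S \<Longrightarrow> e \<bullet> y = 0"
proof -
  obtain y z where yz: "y \<in> span S" "\<And>w. w \<in> span S \<Longrightarrow> orthogonal z w" "u = y + z"
    using orthogonal_subspace_decomp_exists by blast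
  have "z \<noteq> 0" using yz assms by auto
  have "z \<bullet> y = 0" using yz(1,2) by (simp add: orthogonal_def)
  then have "(z /\<^sub>R (z \<bullet> z)) \<bullet> u = 1" using \<open>z \<noteq> 0\<close> by (simp add: yz(3) inner_add_right)
  moreover have "(z /\<^sub>R (z \<bullet> z)) \<bullet> y = 0" if "y \<in> S" for y
    using yz(2)[of y] that by (simp add: orthogonal_def span_base)
  ultimately show thesis using that by blast
qed

text \<open>Linear independence of a triple rather than of the set of its entries, which would lose
  repetitions.\<close>

definition indep3 :: "'a::euclidean_space \<Rightarrow> 'a \<Rightarrow> 'a \<Rightarrow> bool" where
  "indep3 a b c \<longleftrightarrow> a \<notin> span {b, c} \<and> b \<notin> span {a, c} \<and> c \<notin> span {a, b}"

lemma indep3I: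
  assumes "a \<notin> span {b}" "b \<notin> span {a}" "c \<notin> span {a, b}"
  shows "indep3 a b c"
  unfolding indep3_def using assms in_span_insert[of a c "{b}"] in_span_insert[of b c "{a}"]
  by (auto simp: insert_commute)

lemma indep3_perm: "indep3 a b c \<Longrightarrow> indep3 b a c" "indep3 a b c \<Longrightarrow> indep3 a c b"
  unfolding indep3_def by (simp_all add: insert_commute)

lemma indep3_dual:
  assumes "indep3 a b c"
  obtains e where "e \<bullet> a = 1" "e \<bullet> b = 0" "e \<bullet> c = 0"
  using assms dual_vector[of a "{b, c}"] unfolding indep3_def by (metis insertCI)

text \<open>Vanishing on the first two hyperplanes of the plane leaves \<open>R\<close> as
  \<open>k\<close> times the product of their affine equations. The third contains a point off the
  first two, so \<open>k = 0\<close>.\<close>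

lemma quadratic_vanishes_on_plane:
  fixes R :: "'a::euclidean_space \<Rightarrow> real"
  assumes R: "quadratic R"
    and ind: "indep3 u u1 u2" "indep3 u u1 u3" "indep3 u u2 u3"
    and van: "\<And>x. x \<bullet> u = c \<Longrightarrow> x \<bullet> u1 = c1 \<Longrightarrow> R x = 0"
      "\<And>x. x \<bullet> u = c \<Longrightarrow> x \<bullet> u2 = c2 \<Longrightarrow> R x = 0"
      "\<And>x. x \<bullet> u = c \<Longrightarrow> x \<bullet> u3 = c3 \<Longrightarrow> R x = 0"
    and x: "x \<bullet> u = c"
  shows "R x = 0"
proof -
  obtain e1 where e1: "e1 \<bullet> u1 = 1" "e1 \<bullet> u = 0" "e1 \<bullet> u2 = 0"
    using indep3_dual[OF indep3_perm(1)[OF ind(1)]] by blast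
  obtain e2 where e2: "e2 \<bullet> u2 = 1" "e2 \<bullet> u = 0" "e2 \<bullet> u1 = 0"
    using indep3_dual[OF indep3_perm(1)[OF indep3_perm(2)[OF ind(1)]]] by blast
  obtain B l c' where B: "bilinear B" and l: "linear l" and Bl: "\<And>x. R x = B x x + l x + c'"
    using R unfolding quadratic_def by blast
  define k where "k = B e1 e2 + B e2 e1"
  have form: "R y = k * (y \<bullet> u1 - c1) * (y \<bullet> u2 - c2)" if y: "y \<bullet> u = c" for y
  proof -
    define s t where "s = y \<bullet> u1 - c1" and "t = y \<bullet> u2 - c2"
    define w where "w = y - s *\<^sub>R e1 - t *\<^sub>R e2"
    have yw: "y = w + s *\<^sub>R e1 + t *\<^sub>R e2" by (simp add: w_def)
    have w: "w \<bullet> u = c" "w \<bullet> u1 = c1" "w \<bullet> u2 = c2"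
      using y e1 e2 by (simp_all add: w_def s_def t_def inner_diff_left)
    have "R w = 0" "R (w + s *\<^sub>R e1) = 0" "R (w + t *\<^sub>R e2) = 0"
      using w e1 e2 by (auto intro: van simp: inner_add_left)
    moreover have "R y = R (w + s *\<^sub>R e1) + R (w + t *\<^sub>R e2) - R w + s * t * k"
      \<comment> \<open>The mixed second difference of \<open>R\<close> along \<open>e1\<close> and
        \<open>e2\<close>; only the bilinear part contributes to it.\<close>
      unfolding yw Bl k_def
      by (simp add: bilinear_ladd[OF B] bilinear_radd[OF B] bilinear_lmul[OF B] bilinear_rmul[OF B]
          linear_add[OF l] linear_cmul[OF l] algebra_simps)
    ultimately show ?thesis by (simp add: s_def t_def)
  qed
  obtain a where a: "a \<bullet> u1 = 1" "a \<bullet> u = 0" "a \<bullet> u3 = 0"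
    using indep3_dual[OF indep3_perm(1)[OF ind(2)]] by blast
  obtain b where b: "b \<bullet> u2 = 1" "b \<bullet> u = 0" "b \<bullet> u3 = 0"
    using indep3_dual[OF indep3_perm(1)[OF ind(3)]] by blast
  obtain g where g: "g \<bullet> u3 = 1" "g \<bullet> u = 0" "g \<bullet> u1 = 0"
    using indep3_dual[OF indep3_perm(1)[OF indep3_perm(2)[OF ind(2)]]] by blast
  \<comment> \<open>A point of the third hyperplane is moved off the first along \<open>a\<close>
    and off the second along \<open>b\<close>; at least one of the step lengths 1 and 2 does not
    lead back to the first.\<close>
  define y0 where "y0 = x - (x \<bullet> u3 - c3) *\<^sub>R g"
  have y0: "y0 \<bullet> u = c" "y0 \<bullet> u3 = c3" using x g by (simp_all add: y0_def inner_diff_left)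
  define y1 where "y1 = (if y0 \<bullet> u1 - c1 = 0 then y0 + a else y0)"
  have y1: "y1 \<bullet> u = c" "y1 \<bullet> u3 = c3" "y1 \<bullet> u1 - c1 \<noteq> 0"
    using y0 a by (auto simp: y1_def inner_add_left)
  obtain y where y: "y \<bullet> u = c" "y \<bullet> u3 = c3" "y \<bullet> u1 - c1 \<noteq> 0" "y \<bullet> u2 - c2 \<noteq> 0"
  proof (cases "y1 \<bullet> u2 - c2 = 0")
    case False
    then show thesis using that y1 by blast
  next
    case True
    obtain t :: real where t: "t \<noteq> 0" "y1 \<bullet> u1 - c1 + t * (b \<bullet> u1) \<noteq> 0"
    proof (cases "y1 \<bullet> u1 - c1 + 1 * (b \<bullet> u1) = 0")
      case True
      then have "y1 \<bullet> u1 - c1 + 2 * (b \<bullet> u1) \<noteq> 0" using y1(3) by auto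
      then show thesis using that[of 2] by simp
    qed (use that[of 1] in simp)
    have "y1 \<bullet> u1 + t * (b \<bullet> u1) - c1 \<noteq> 0" using t(2) by (simp add: algebra_simps)
    then show thesis
      using y1 b t(1) True by (intro that[of "y1 + t *\<^sub>R b"]) (auto simp: inner_add_left)
  qed
  have "k = 0" using form[OF y(1)] van(3)[OF y(1,2)] y(3,4) by simp
  then show ?thesis using form[OF x] by simp
qed

text \<open>If \<open>e \<bullet> u = 1\<close>, the inner map is the projection along
  \<open>e\<close> onto the plane \<open>x \<bullet> u = c\<close>.\<close>

lemma quadratic_slide:
  assumes "quadratic q"
  shows "quadratic (\<lambda>x. q (x - (x \<bullet> u - c) *\<^sub>R e))"
proof -
  have "linear (\<lambda>x. x - (x \<bullet> u) *\<^sub>R e)"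
    by (intro linearI) (auto simp: algebra_simps)
  from quadratic_compose_affine[OF assms this, of "c *\<^sub>R e"] show ?thesis
    by (simp add: algebra_simps)
qed

text \<open>Inclusion-exclusion over the slides of \<open>x\<close> onto three planes along dual directions glues
  three quadratic functions that agree on the pairwise intersections.\<close>

lemma glue_three_quadratics:
  fixes q1 :: "'a::euclidean_space \<Rightarrow> real"
  assumes q: "quadratic q1" "quadratic q2" "quadratic q3"
    and ind: "indep3 u1 u2 u3"
    and eq: "\<And>x. x \<bullet> u1 = c1 \<Longrightarrow> x \<bullet> u2 = c2 \<Longrightarrow> q2 x = q1 x"
      "\<And>x. x \<bullet> u1 = c1 \<Longrightarrow> x \<bullet> u3 = c3 \<Longrightarrow> q3 x = q1 x"
      "\<And>x. x \<bullet> u2 = c2 \<Longrightarrow> x \<bullet> u3 = c3 \<Longrightarrow> q3 x = q2 x"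
  obtains Q where "quadratic Q" "\<And>x. x \<bullet> u1 = c1 \<Longrightarrow> Q x = q1 x"
    "\<And>x. x \<bullet> u2 = c2 \<Longrightarrow> Q x = q2 x" "\<And>x. x \<bullet> u3 = c3 \<Longrightarrow> Q x = q3 x"
proof -
  obtain e1 where e1: "e1 \<bullet> u1 = 1" "e1 \<bullet> u2 = 0" "e1 \<bullet> u3 = 0"
    using indep3_dual[OF ind] by blast
  obtain e2 where e2: "e2 \<bullet> u2 = 1" "e2 \<bullet> u1 = 0" "e2 \<bullet> u3 = 0"
    using indep3_dual[OF indep3_perm(1)[OF ind]] by blast
  obtain e3 where e3: "e3 \<bullet> u3 = 1" "e3 \<bullet> u1 = 0" "e3 \<bullet> u2 = 0"
    using indep3_dual[OF indep3_perm(1)[OF indep3_perm(2)[OF ind]]] by blast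
  define p1 p2 p3 where "p1 = (\<lambda>x. x - (x \<bullet> u1 - c1) *\<^sub>R e1)"
    and "p2 = (\<lambda>x. x - (x \<bullet> u2 - c2) *\<^sub>R e2)" and "p3 = (\<lambda>x. x - (x \<bullet> u3 - c3) *\<^sub>R e3)"
  have slide: "quadratic (\<lambda>x. q (p1 x))" "quadratic (\<lambda>x. q (p2 x))" "quadratic (\<lambda>x. q (p3 x))"
    if "quadratic q" for q
    unfolding p1_def p2_def p3_def using that by (auto intro: quadratic_slide)
  have p1: "p1 x \<bullet> u1 = c1" "p1 x \<bullet> u2 = x \<bullet> u2" "p1 x \<bullet> u3 = x \<bullet> u3"
    and p2: "p2 x \<bullet> u2 = c2" "p2 x \<bullet> u1 = x \<bullet> u1" "p2 x \<bullet> u3 = x \<bullet> u3"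
    and p3: "p3 x \<bullet> u3 = c3" "p3 x \<bullet> u1 = x \<bullet> u1" "p3 x \<bullet> u2 = x \<bullet> u2" for x
    using e1 e2 e3 by (simp_all add: p1_def p2_def p3_def inner_diff_left)
  have id: "x \<bullet> u1 = c1 \<Longrightarrow> p1 x = x" "x \<bullet> u2 = c2 \<Longrightarrow> p2 x = x" "x \<bullet> u3 = c3 \<Longrightarrow> p3 x = x" for x
    by (simp_all add: p1_def p2_def p3_def)
  define Q where "Q = (\<lambda>x. q1 (p1 x) + q2 (p2 x) + q3 (p3 x) - q1 (p1 (p2 x)) - q1 (p1 (p3 x))
      - q2 (p2 (p3 x)) + q1 (p1 (p2 (p3 x))))"
  have "quadratic Q"
    unfolding Q_def using q
    by (intro quadratic_add quadratic_diff slide(1) slide(2)[of "\<lambda>x. q1 (p1 x)"]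
        slide(3)[of "\<lambda>x. q1 (p1 x)"] slide(3)[of "\<lambda>x. q2 (p2 x)"]
        slide(3)[of "\<lambda>x. q1 (p1 (p2 x))"] slide(2)[OF q(2)] slide(3)[OF q(3)])
  moreover have "Q x = q1 x" if x: "x \<bullet> u1 = c1" for x
    using x eq(1)[of "p2 x"] eq(2)[of "p3 x"] eq(1)[of "p2 (p3 x)"]
    by (simp add: Q_def id p1 p2 p3)
  moreover have "Q x = q2 x" if x: "x \<bullet> u2 = c2" for x
    using x eq(1)[of "p1 x"] eq(3)[of "p3 x"]
    by (simp add: Q_def id p1 p2 p3)
  moreover have "Q x = q3 x" if x: "x \<bullet> u3 = c3" for x
    using x eq(2)[of "p1 x"] eq(3)[of "p2 x"]
    by (simp add: Q_def id p1 p2 p3)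
  ultimately show thesis using that by blast
qed

context plane_sections
begin

lemma section_form_cong:
  assumes "section_form u q" "quadratic Q" "\<And>x. x \<bullet> u = D u \<Longrightarrow> Q x = q x"
  shows "section_form u Q"
  using assms unfolding section_form_def by auto

lemma crossing_sym: "crossing u u' \<Longrightarrow> crossing u' u"
  unfolding crossing_def by blast

lemma section_form_rescale:
  assumes "u \<in> W" "section_form u q" "u' \<in> W" "crossing u u'"
  obtains q' where "section_form u' q'" "\<And>x. x \<bullet> u = D u \<Longrightarrow> x \<bullet> u' = D u' \<Longrightarrow> q' x = q x"
proof -
  obtain p where p: "section_form u' p" using section_form_exists[OF assms(3)] by blast
  obtain z where z: "z \<in> interior K" "z \<bullet> u = D u" "z \<bullet> u' = D u'"
    using assms(4) unfolding crossing_def by blast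
  have neg: "q z < 0" "p z < 0" using section_formD(3)[OF assms(2)] section_formD(3)[OF p] z by auto
  have "section_form u' (\<lambda>x. (q z / p z) * p x)"
    by (rule section_form_cmult[OF p]) (use neg in \<open>simp add: divide_neg_neg\<close>)
  moreover have "(q z / p z) * p x = q x" if "x \<bullet> u = D u" "x \<bullet> u' = D u'" for x
    using section_forms_proportional[OF assms(1,2) p z that] neg by (simp add: field_simps)
  ultimately show thesis using that by blast
qed

lemma common_point:
  assumes "indep3 u1 u2 u3"
  obtains c where "c \<bullet> u1 = D u1" "c \<bullet> u2 = D u2" "c \<bullet> u3 = D u3"
proof -
  obtain e1 where e1: "e1 \<bullet> u1 = 1" "e1 \<bullet> u2 = 0" "e1 \<bullet> u3 = 0"
    using indep3_dual[OF assms] by blast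
  obtain e2 where e2: "e2 \<bullet> u2 = 1" "e2 \<bullet> u1 = 0" "e2 \<bullet> u3 = 0"
    using indep3_dual[OF indep3_perm(1)[OF assms]] by blast
  obtain e3 where e3: "e3 \<bullet> u3 = 1" "e3 \<bullet> u1 = 0" "e3 \<bullet> u2 = 0"
    using indep3_dual[OF indep3_perm(1)[OF indep3_perm(2)[OF assms]]] by blast
  show thesis
    by (rule that[of "D u1 *\<^sub>R e1 + D u2 *\<^sub>R e2 + D u3 *\<^sub>R e3"])
      (use e1 e2 e3 in \<open>simp_all add: inner_add_left\<close>)
qed

lemma quadric_through_three_sections:
  assumes W: "u1 \<in> W" "u2 \<in> W" "u3 \<in> W" and ind: "indep3 u1 u2 u3"
    and cr: "crossing u1 u2" "crossing u1 u3" "crossing u2 u3"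
  obtains Q where "section_form u1 Q" "section_form u2 Q" "section_form u3 Q"
proof -
  obtain q1 where q1: "section_form u1 q1" using section_form_exists[OF W(1)] by blast
  obtain q2 where q2: "section_form u2 q2" "\<And>x. x \<bullet> u1 = D u1 \<Longrightarrow> x \<bullet> u2 = D u2 \<Longrightarrow> q2 x = q1 x"
    using section_form_rescale[OF W(1) q1 W(2) cr(1)] by blast
  obtain q3 where q3: "section_form u3 q3" "\<And>x. x \<bullet> u1 = D u1 \<Longrightarrow> x \<bullet> u3 = D u3 \<Longrightarrow> q3 x = q1 x"
    using section_form_rescale[OF W(1) q1 W(3) cr(2)] by blast
  obtain c where c: "c \<bullet> u1 = D u1" "c \<bullet> u2 = D u2" "c \<bullet> u3 = D u3"
    using common_point[OF ind] by blast
  have q23: "q3 x = q2 x" if "x \<bullet> u2 = D u2" "x \<bullet> u3 = D u3" for x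
    using section_forms_consistent[OF W q1 q2(1) q3(1) cr c q2(2) q3(2) that] by blast
  obtain Q where "quadratic Q" "\<And>x. x \<bullet> u1 = D u1 \<Longrightarrow> Q x = q1 x"
    "\<And>x. x \<bullet> u2 = D u2 \<Longrightarrow> Q x = q2 x" "\<And>x. x \<bullet> u3 = D u3 \<Longrightarrow> Q x = q3 x"
    using glue_three_quadratics[OF section_formD(1)[OF q1] section_formD(1)[OF q2(1)]
      section_formD(1)[OF q3(1)] ind q2(2) q3(2) q23] by blast
  then show thesis using that section_form_cong q1 q2(1) q3(1) by metis
qed

text \<open>Once the form of \<open>u\<close> is scaled to agree with \<open>Q\<close> on the plane
  of \<open>u1\<close>, consistency makes it agree on those of \<open>u2\<close> and
  \<open>u3\<close>. Their difference then vanishes on three hyperplanes of the plane of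
  \<open>u\<close>.\<close>

lemma section_form_extends:
  assumes W: "u1 \<in> W" "u2 \<in> W" "u3 \<in> W" "u \<in> W"
    and Q: "section_form u1 Q" "section_form u2 Q" "section_form u3 Q"
    and cr: "crossing u1 u2" "crossing u1 u3" "crossing u1 u" "crossing u2 u" "crossing u3 u"
    and ind: "indep3 u u1 u2" "indep3 u u1 u3" "indep3 u u2 u3"
  shows "section_form u Q"
proof -
  obtain q where q: "section_form u q" "\<And>x. x \<bullet> u1 = D u1 \<Longrightarrow> x \<bullet> u = D u \<Longrightarrow> q x = Q x"
    using section_form_rescale[OF W(1) Q(1) W(4) cr(3)] by blast
  obtain c where c: "c \<bullet> u = D u" "c \<bullet> u1 = D u1" "c \<bullet> u2 = D u2"
    using common_point[OF ind(1)] by blast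
  obtain c' where c': "c' \<bullet> u = D u" "c' \<bullet> u1 = D u1" "c' \<bullet> u3 = D u3"
    using common_point[OF ind(2)] by blast
  have q2: "q x = Q x" if "x \<bullet> u2 = D u2" "x \<bullet> u = D u" for x
    by (rule section_forms_consistent[OF W(1,2,4) Q(1,2) q(1) cr(1,3,4) c(2,3,1) _ q(2) that]) auto
  have q3: "q x = Q x" if "x \<bullet> u3 = D u3" "x \<bullet> u = D u" for x
    by (rule section_forms_consistent[OF W(1,3,4) Q(1,3) q(1) cr(2,3,5) c'(2,3,1) _ q(2) that]) auto
  have "q x - Q x = 0" if "x \<bullet> u = D u" for x
    by (rule quadratic_vanishes_on_plane[OF quadratic_diff[OF section_formD(1)[OF q(1)] section_formD(1)[OF Q(1)]]
          ind, of "D u" "D u1" "D u2" "D u3"]) (use q(2) q2 q3 that in auto)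
  then show ?thesis
    using section_form_cong[OF q(1) section_formD(1)[OF Q(1)]] by simp
qed

end

section \<open>A quadric through an open set of sections\<close>

text \<open>Proper subspaces have empty interior; this supplies normals and directions in general
  position.\<close>

lemma open_minus_subspaces:
  fixes O1 :: "'a::euclidean_space set"
  assumes "finite T" "open O1" "O1 \<noteq> {}" "\<And>S. S \<in> T \<Longrightarrow> subspace S \<and> dim S < DIM('a)"
  shows "open (O1 - \<Union>T) \<and> O1 - \<Union>T \<noteq> {}"
  using assms
proof (induction T rule: finite_induct)
  case (insert S T)
  then have IH: "open (O1 - \<Union>T)" "O1 - \<Union>T \<noteq> {}" and S: "subspace S" "dim S < DIM('a)" by auto
  have eq: "O1 - \<Union>(insert S T) = (O1 - \<Union>T) - S" by auto
  have "\<not> O1 - \<Union>T \<subseteq> S"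
    using IH empty_interior_lowdim[OF S(2)] interior_maximal[OF _ IH(1), of S] by blast
  then show ?case unfolding eq using IH(1) closed_subspace[OF S(1)] by blast
qed auto

lemma notin_span_singleton_sym:
  fixes u v :: "'a::euclidean_space"
  assumes "u \<notin> span {v}" "v \<noteq> 0"
  shows "v \<notin> span {u}"
proof
  assume "v \<in> span {u}"
  then obtain k where "v = k *\<^sub>R u" by (auto simp: span_singleton)
  then have "u = (1 / k) *\<^sub>R v" using assms(2) by auto
  then show False using assms(1) by (auto simp: span_singleton)
qed

context plane_sections
begin

lemma dim_pair: "dim (span {a, b :: 'a}) < DIM('a)"
proof -
  have "dim {a, b} \<le> card {a, b}" by (rule dim_le_card') simp
  also have "\<dots> \<le> 2" by (simp add: card_insert_if)
  finally show ?thesis using dim by simp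
qed

section \<open>Continuity in the normal, planes through a given point and stability of
  crossing\<close>

lemma isCont_D: "u \<noteq> 0 \<Longrightarrow> isCont D u"
  using cont continuous_on_eq_continuous_at[of "- {0}" D] by auto

lemma above_near:
  assumes "u \<noteq> 0" "D u < x \<bullet> u"
  shows "\<forall>\<^sub>F w in nhds u. D w < x \<bullet> w"
proof -
  have "isCont (\<lambda>w. x \<bullet> w - D w) u" by (intro continuous_intros isCont_D assms(1))
  then have "((\<lambda>w. x \<bullet> w - D w) \<longlongrightarrow> x \<bullet> u - D u) (nhds u)"
    using continuous_at_imp_continuous_at_within tendsto_nhds_iff by (simp add: isCont_def tendsto_nhds_iff)
  then have "\<forall>\<^sub>F w in nhds u. 0 < x \<bullet> w - D w" by (rule order_tendstoD) (use assms in simp)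
  then show ?thesis by (simp add: algebra_simps)
qed

lemma below_near:
  assumes "u \<noteq> 0" "x \<bullet> u < D u"
  shows "\<forall>\<^sub>F w in nhds u. x \<bullet> w < D w"
proof -
  have "isCont (\<lambda>w. D w - x \<bullet> w) u" by (intro continuous_intros isCont_D assms(1))
  then have "((\<lambda>w. D w - x \<bullet> w) \<longlongrightarrow> D u - x \<bullet> u) (nhds u)"
    by (simp add: isCont_def tendsto_nhds_iff)
  then have "\<forall>\<^sub>F w in nhds u. 0 < D w - x \<bullet> w" by (rule order_tendstoD) (use assms in simp)
  then show ?thesis by (simp add: algebra_simps)
qed

text \<open>The intermediate value theorem for \<open>D w - x \<bullet> w\<close> along the segment
  of normals, which must avoid 0 because \<open>D\<close> is controlled only off 0.\<close>

lemma plane_between: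
  assumes "0 \<notin> closed_segment u v" "D u < x \<bullet> u" "x \<bullet> v < D v"
  obtains t where "0 < t" "t < 1" "x \<bullet> ((1 - t) *\<^sub>R u + t *\<^sub>R v) = D ((1 - t) *\<^sub>R u + t *\<^sub>R v)"
proof -
  let ?w = "\<lambda>t. (1 - t) *\<^sub>R u + t *\<^sub>R v"
  let ?f = "\<lambda>t. D (?w t) - x \<bullet> ?w t"
  have "?w t \<noteq> 0" if "t \<in> {0..1}" for t
    using assms(1) that by (metis atLeastAtMost_iff in_segment(1))
  then have "continuous_on {0..1} (\<lambda>t. D (?w t))"
    by (intro continuous_on_compose2[OF cont] continuous_intros) auto
  then have "continuous_on {0..1} ?f" by (intro continuous_intros)
  then obtain t where t: "0 \<le> t" "t \<le> 1" "?f t = 0"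
    using IVT'[of ?f 0 0 1] assms by auto
  then have "t \<noteq> 0" "t \<noteq> 1" using assms by auto
  then show thesis using t by (intro that[of t]) auto
qed

text \<open>The segments \<open>a b\<close> and \<open>c d\<close> meet the plane of
  \<open>u'\<close> at points on different sides of, or on, the plane of \<open>u\<close>; the
  segment joining these points finds the crossing. The strict inequalities survive small changes of
  both normals.\<close>

lemma crossing_if_four_signs:
  assumes "u \<noteq> 0" "u' \<noteq> 0" "{a, b, c, d} \<subseteq> interior K"
    and "D u < a \<bullet> u" "D u' < a \<bullet> u'" "D u < b \<bullet> u" "b \<bullet> u' < D u'"
    and "c \<bullet> u < D u" "D u' < c \<bullet> u'" "d \<bullet> u < D u" "d \<bullet> u' < D u'"
  shows "crossing u u'"
proof -
  have conv': "convex (interior K)" by (rule convex_interior[OF conv])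
  have mix: "\<exists>t\<in>{0..1}. ((1 - t) *\<^sub>R x + t *\<^sub>R y) \<bullet> w = D w"
    if xy: "D w \<le> x \<bullet> w" "y \<bullet> w \<le> D w" for x y w :: 'a
  proof -
    have "continuous_on {0..1} (\<lambda>t. - (((1 - t) *\<^sub>R x + t *\<^sub>R y) \<bullet> w))" by (intro continuous_intros)
    then obtain t where "0 \<le> t" "t \<le> 1" "- (((1 - t) *\<^sub>R x + t *\<^sub>R y) \<bullet> w) = - D w"
      using IVT'[of "\<lambda>t. - (((1 - t) *\<^sub>R x + t *\<^sub>R y) \<bullet> w)" 0 "- D w" 1] xy by auto
    then show ?thesis by (intro bexI[of _ t]) auto
  qed
  obtain s where s: "s \<in> {0..1}" "((1 - s) *\<^sub>R a + s *\<^sub>R b) \<bullet> u' = D u'"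
    using mix[of u' a b] assms by force
  obtain t where t: "t \<in> {0..1}" "((1 - t) *\<^sub>R c + t *\<^sub>R d) \<bullet> u' = D u'"
    using mix[of u' c d] assms by force
  define x y where "x = (1 - s) *\<^sub>R a + s *\<^sub>R b" and "y = (1 - t) *\<^sub>R c + t *\<^sub>R d"
  have "convex {z. D u \<le> z \<bullet> u}" "convex {z. z \<bullet> u \<le> D u}"
    using convex_halfspace_ge[of "D u" u] convex_halfspace_le[of u "D u"]
    by (simp_all add: inner_commute)
  then have "D u \<le> x \<bullet> u" "y \<bullet> u \<le> D u"
    using convexD_alt[of "{z. D u \<le> z \<bullet> u}" a b s] convexD_alt[of "{z. z \<bullet> u \<le> D u}" c d t] s t assms
    by (auto simp: x_def y_def)
  then obtain r where r: "r \<in> {0..1}" "((1 - r) *\<^sub>R x + r *\<^sub>R y) \<bullet> u = D u"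
    using mix by blast
  have "x \<in> interior K" "y \<in> interior K"
    unfolding x_def y_def using s t assms(3) by (auto intro!: convexD_alt[OF conv'])
  then have "(1 - r) *\<^sub>R x + r *\<^sub>R y \<in> interior K" using r by (auto intro!: convexD_alt[OF conv'])
  moreover have "((1 - r) *\<^sub>R x + r *\<^sub>R y) \<bullet> u' = D u'"
  proof -
    have "x \<bullet> u' = D u'" "y \<bullet> u' = D u'" using s(2) t(2) by (simp_all only: x_def y_def)
    then show ?thesis by (simp add: inner_add_left algebra_simps)
  qed
  ultimately show ?thesis unfolding crossing_def using r(2) by blast
qed

text \<open>With \<open>e\<close> and \<open>e'\<close> dual to the two normals, the points p
  \<plusminus> h e \<plusminus> h e' realise all four sign patterns; \<open>h\<close> keeps them in
  a ball inside \<open>K\<close>.\<close>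

lemma crossing_near:
  assumes "p \<in> interior K" "p \<bullet> u = D u" "p \<bullet> u' = D u'" "u \<notin> span {u'}" "u' \<noteq> 0"
  obtains r where "r > 0" "\<And>w w'. w \<in> ball u r \<Longrightarrow> w' \<in> ball u' r \<Longrightarrow> crossing w w'"
proof -
  have nz: "u \<noteq> 0" using assms(4) span_zero by metis
  obtain e where e: "e \<bullet> u = 1" "e \<bullet> u' = 0" using dual_vector[OF assms(4)] by (metis singletonI)
  obtain e' where e': "e' \<bullet> u' = 1" "e' \<bullet> u = 0"
    using dual_vector[OF notin_span_singleton_sym[OF assms(4,5)]] by (metis singletonI)
  obtain k where k: "k > 0" "cball p k \<subseteq> interior K"
    using assms(1) open_contains_cball[of "interior K"] by auto
  define h where "h = k / (norm e + norm e' + 1)"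
  have h: "h > 0" using k(1) by (simp add: h_def add_nonneg_pos)
  have "h * (norm e + norm e') \<le> h * (norm e + norm e' + 1)" using h by (intro mult_left_mono) auto
  also have "\<dots> = k" by (simp add: h_def add_nonneg_pos less_imp_neq[THEN not_sym])
  finally have hk: "h * norm e + h * norm e' \<le> k" by (simp add: algebra_simps)
  have inn: "p + (s * h) *\<^sub>R e + (t * h) *\<^sub>R e' \<in> interior K" if "\<bar>s\<bar> = 1" "\<bar>t\<bar> = 1" for s t
  proof -
    have "norm ((s * h) *\<^sub>R e + (t * h) *\<^sub>R e') \<le> h * norm e + h * norm e'"
      using norm_triangle_ineq[of "(s * h) *\<^sub>R e" "(t * h) *\<^sub>R e'"] that h by (simp add: abs_mult)
    moreover have "dist p (p + v) = norm v" for v by (simp add: dist_norm)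
    ultimately have "dist p (p + ((s * h) *\<^sub>R e + (t * h) *\<^sub>R e')) \<le> k" using hk by simp
    then have "p + ((s * h) *\<^sub>R e + (t * h) *\<^sub>R e') \<in> interior K" using k(2) by (meson mem_cball subsetD)
    then show ?thesis by (simp add: add.assoc)
  qed
  define P where "P = (\<lambda>s t. p + (s * h) *\<^sub>R e + (t * h) *\<^sub>R e')"
  have PK: "P 1 1 \<in> interior K" "P 1 (-1) \<in> interior K" "P (-1) 1 \<in> interior K" "P (-1) (-1) \<in> interior K"
    unfolding P_def by (rule inn; simp)+
  have val: "P s t \<bullet> u = D u + s * h" "P s t \<bullet> u' = D u' + t * h" for s t
    using e e' assms by (simp_all add: P_def inner_add_left)
  have "\<forall>\<^sub>F w in nhds u. D w < P 1 1 \<bullet> w \<and> D w < P 1 (-1) \<bullet> w \<and> P (-1) 1 \<bullet> w < D w \<and> P (-1) (-1) \<bullet> w < D w"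
    using val h nz by (intro eventually_conj above_near below_near) auto
  then obtain r1 where r1: "r1 > 0" "\<And>w. dist w u < r1 \<Longrightarrow>
      D w < P 1 1 \<bullet> w \<and> D w < P 1 (-1) \<bullet> w \<and> P (-1) 1 \<bullet> w < D w \<and> P (-1) (-1) \<bullet> w < D w"
    unfolding eventually_nhds_metric by blast
  have "\<forall>\<^sub>F w in nhds u'. D w < P 1 1 \<bullet> w \<and> D w < P (-1) 1 \<bullet> w \<and> P 1 (-1) \<bullet> w < D w \<and> P (-1) (-1) \<bullet> w < D w"
    using val h assms(5) by (intro eventually_conj above_near below_near) auto
  then obtain r2 where r2: "r2 > 0" "\<And>w. dist w u' < r2 \<Longrightarrow>
      D w < P 1 1 \<bullet> w \<and> D w < P (-1) 1 \<bullet> w \<and> P 1 (-1) \<bullet> w < D w \<and> P (-1) (-1) \<bullet> w < D w"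
    unfolding eventually_nhds_metric by blast
  define r where "r = min (min r1 r2) (min (norm u) (norm u'))"
  have "r > 0" using r1(1) r2(1) nz assms(5) by (simp add: r_def)
  moreover have "crossing w w'" if w: "w \<in> ball u r" "w' \<in> ball u' r" for w w'
  proof -
    have "w \<noteq> 0" "w' \<noteq> 0" using w by (auto simp: r_def)
    moreover have "dist w u < r1" "dist w' u' < r2" using w by (auto simp: r_def dist_commute)
    ultimately show ?thesis
      using crossing_if_four_signs[of w w' "P 1 1" "P 1 (-1)" "P (-1) 1" "P (-1) (-1)"] PK r1(2) r2(2) by auto
  qed
  ultimately show thesis using that by blast
qed

text \<open>An interior point on the plane of \<open>u\<close> is pushed off it along a dual vector.
  If it lies on both planes, \<open>e - e'\<close> raises it over one and lowers it under the
  other.\<close>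

lemma separated_point:
  assumes "u \<notin> span {u'}" "u' \<noteq> 0"
  obtains p where "p \<in> interior K" "D u < p \<bullet> u" "p \<bullet> u' < D u'"
  | p where "p \<in> interior K" "D u' < p \<bullet> u'" "p \<bullet> u < D u"
proof -
  have nz: "u \<noteq> 0" using assms(1) span_zero by metis
  obtain e where e: "e \<bullet> u = 1" "e \<bullet> u' = 0" using dual_vector[OF assms(1)] by (metis singletonI)
  obtain e' where e': "e' \<bullet> u' = 1" "e' \<bullet> u = 0"
    using dual_vector[OF notin_span_singleton_sym[OF assms]] by (metis singletonI)
  obtain p where p: "p \<in> interior K" "p \<bullet> u = D u" using meets[OF nz] by blast
  obtain k where k: "k > 0" "cball p k \<subseteq> interior K"
    using p(1) open_contains_cball[of "interior K"] by auto
  have move: "p + (k / (norm w + 1)) *\<^sub>R w \<in> interior K" for w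
  proof -
    have "k * (norm w / (norm w + 1)) \<le> k * 1"
      using k(1) by (intro mult_left_mono) (auto simp: pos_divide_le_eq add_nonneg_pos)
    then have "(k / (norm w + 1)) * norm w \<le> k" by simp
    then have "p + (k / (norm w + 1)) *\<^sub>R w \<in> cball p k" using k(1) by (simp add: dist_norm)
    then show ?thesis using k(2) by blast
  qed
  have pos: "k / (norm w + 1) > 0" for w :: 'a using k(1) by (simp add: add_nonneg_pos)
  consider "p \<bullet> u' < D u'" | "p \<bullet> u' > D u'" | "p \<bullet> u' = D u'" by linarith
  then show thesis
  proof cases
    case 1
    show thesis by (rule that(1)[OF move[of e]]) (use 1 p e pos[of e] in \<open>auto simp: inner_add_left\<close>)
  next
    case 2
    show thesis by (rule that(2)[OF move[of "- e"]]) (use 2 p e pos[of "- e"] in \<open>auto simp: inner_diff_left\<close>)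
  next
    case 3
    show thesis
      by (rule that(1)[OF move[of "e - e'"]])
        (use 3 p e e' pos[of "e - e'"] in \<open>auto simp: inner_add_left inner_diff_left\<close>)
  qed
qed

lemma projected_direction_tendsto:
  fixes d0 ua :: 'a
  assumes "d0 \<noteq> 0" "ua \<bullet> d0 = 0"
  shows "((\<lambda>d. ua - ((ua \<bullet> d) / (d \<bullet> d)) *\<^sub>R d) \<longlongrightarrow> ua) (nhds d0)"
proof -
  have "isCont (\<lambda>d. ua - ((ua \<bullet> d) / (d \<bullet> d)) *\<^sub>R d) d0"
    using assms(1) by (intro continuous_intros) auto
  then show ?thesis using assms(2) by (simp add: isCont_def tendsto_nhds_iff)
qed

text \<open>The normal is sought in the complement of a vector \<open>d\<close> close to
  \<open>d0\<close>, where the projections of \<open>ua\<close> and \<open>ub\<close> still lie on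
  either side. If \<open>d\<close> is not orthogonal to any \<open>v \<in> T\<close>, no nonzero
  vector of the complement is a multiple of such a \<open>v\<close>.\<close>

lemma plane_through_point_avoiding:
  assumes C: "open C" "convex C" "0 \<notin> C" "ua \<in> C" "ub \<in> C"
    and p: "D ua < p \<bullet> ua" "p \<bullet> ub < D ub"
    and T: "finite T" "0 \<notin> T"
  obtains u where "u \<in> C" "p \<bullet> u = D u" "\<And>v. v \<in> T \<Longrightarrow> u \<notin> span {v}"
proof -
  obtain d0 where d0: "norm d0 = 1" "d0 \<bullet> ua = 0" "d0 \<bullet> ub = 0"
    using exists_orthogonal_unit[OF dim] by blast
  let ?pr = "\<lambda>w d. w - ((w \<bullet> d) / (d \<bullet> d)) *\<^sub>R d"
  have d0nz: "d0 \<noteq> 0" using d0(1) by auto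
  have lim: "(?pr ua \<longlongrightarrow> ua) (nhds d0)" "(?pr ub \<longlongrightarrow> ub) (nhds d0)"
    using d0 by (simp_all add: projected_direction_tendsto[OF d0nz] inner_commute[of _ d0])
  have nz: "ua \<noteq> 0" "ub \<noteq> 0" using C by auto
  have "\<forall>\<^sub>F d in nhds d0. D (?pr ua d) < p \<bullet> ?pr ua d"
    using eventually_compose_filterlim[OF above_near[OF nz(1) p(1)] lim(1)] .
  moreover have "\<forall>\<^sub>F d in nhds d0. p \<bullet> ?pr ub d < D (?pr ub d)"
    using eventually_compose_filterlim[OF below_near[OF nz(2) p(2)] lim(2)] .
  moreover have "\<forall>\<^sub>F d in nhds d0. ?pr ua d \<in> C" "\<forall>\<^sub>F d in nhds d0. ?pr ub d \<in> C"
    using topological_tendstoD[OF lim(1) C(1,4)] topological_tendstoD[OF lim(2) C(1,5)] .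
  moreover have "\<forall>\<^sub>F d in nhds d0. d \<noteq> 0"
    using d0nz by (rule t1_space_nhds)
  ultimately have "\<forall>\<^sub>F d in nhds d0. D (?pr ua d) < p \<bullet> ?pr ua d \<and> p \<bullet> ?pr ub d < D (?pr ub d)
      \<and> ?pr ua d \<in> C \<and> ?pr ub d \<in> C \<and> d \<noteq> 0"
    by eventually_elim auto
  then obtain O1 where O1: "open O1" "d0 \<in> O1" "\<And>d. d \<in> O1 \<Longrightarrow> D (?pr ua d) < p \<bullet> ?pr ua d
      \<and> p \<bullet> ?pr ub d < D (?pr ub d) \<and> ?pr ua d \<in> C \<and> ?pr ub d \<in> C \<and> d \<noteq> 0"
    unfolding eventually_nhds by blast
  have "subspace S \<and> dim S < DIM('a)" if S: "S \<in> (\<lambda>v. {d. v \<bullet> d = 0}) ` T" for S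
  proof -
    obtain v where v: "v \<in> T" "S = {d. v \<bullet> d = 0}" using S by blast
    then have "v \<noteq> 0" using T(2) by blast
    then show ?thesis using v(2) dim by (simp add: subspace_hyperplane dim_hyperplane)
  qed
  moreover have "O1 \<noteq> {}" using O1(2) by blast
  ultimately have "O1 - \<Union>((\<lambda>v. {d. v \<bullet> d = 0}) ` T) \<noteq> {}"
    using open_minus_subspaces[OF finite_imageI[OF T(1)] O1(1)] by blast
  then obtain d where d: "d \<in> O1" "\<And>v. v \<in> T \<Longrightarrow> v \<bullet> d \<noteq> 0" by blast
  have seg: "closed_segment (?pr ua d) (?pr ub d) \<subseteq> C"
    using O1(3)[OF d(1)] C(2) by (intro closed_segment_subset) auto
  then have "0 \<notin> closed_segment (?pr ua d) (?pr ub d)" using C(3) by blast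
  then obtain t where t: "0 < t" "t < 1"
    "p \<bullet> ((1 - t) *\<^sub>R ?pr ua d + t *\<^sub>R ?pr ub d) = D ((1 - t) *\<^sub>R ?pr ua d + t *\<^sub>R ?pr ub d)"
    using plane_between[of "?pr ua d" "?pr ub d" p] O1(3)[OF d(1)] by metis
  define u where "u = (1 - t) *\<^sub>R ?pr ua d + t *\<^sub>R ?pr ub d"
  have "u \<in> closed_segment (?pr ua d) (?pr ub d)"
    unfolding in_segment u_def using t(1,2) by (intro exI[of _ t]) auto
  then have uC: "u \<in> C" using seg by blast
  have "d \<noteq> 0" using O1(3)[OF d(1)] by blast
  then have "?pr ua d \<bullet> d = 0" "?pr ub d \<bullet> d = 0" by (simp_all add: inner_diff_left)
  then have "u \<bullet> d = 0" by (simp add: u_def inner_add_left)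
  moreover have "u \<noteq> 0" using uC C(3) by blast
  ultimately have "u \<notin> span {v}" if "v \<in> T" for v
    using d(2)[OF that] by (auto simp: span_singleton)
  then show thesis using uC t(3) that unfolding u_def by blast
qed

lemma separated_pair:
  assumes "open U" "w \<in> U" "w \<noteq> 0"
  obtains ua ub p r where "r > 0" "ball w r \<subseteq> U" "0 \<notin> ball w r" "ua \<in> ball w r" "ub \<in> ball w r"
    "p \<in> interior K" "D ua < p \<bullet> ua" "p \<bullet> ub < D ub"
proof -
  obtain r0 where r0: "r0 > 0" "ball w r0 \<subseteq> U" using assms open_contains_ball by blast
  define r where "r = min r0 (norm w)"
  have r: "r > 0" "ball w r \<subseteq> U" "0 \<notin> ball w r"
    using r0 assms(3) by (auto simp: r_def)
  have "dim (span {w}) < DIM('a)" using dim_pair[of w w] by simp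
  then have "ball w r - \<Union>{span {w}} \<noteq> {}"
    using open_minus_subspaces[of "{span {w}}" "ball w r"] r(1) by auto
  then obtain w' where w': "w' \<in> ball w r" "w' \<notin> span {w}" by blast
  have c: "w \<in> ball w r" using r(1) by simp
  show thesis
    using separated_point[OF w'(2) assms(3)] that[OF r w'(1) c] that[OF r c w'(1)] by blast
qed

text \<open>Planes with pairwise nonparallel normals through one interior point \<open>p\<close>
  cross pairwise, and continue to do so after small changes. This freedom lets \<open>u3\<close>
  move to \<open>v3\<close>, independent of \<open>u1\<close> and \<open>u2\<close>, and
  \<open>u4\<close> to every nearby normal outside three spans.\<close>

lemma quadric_on_open_set_of_sections:
  obtains Q U where "open U" "U \<noteq> {}" "U \<subseteq> W" "\<And>u. u \<in> U \<Longrightarrow> section_form u Q"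
proof -
  obtain w where w: "w \<in> W" using W_ne by blast
  obtain ua ub p r0 where *: "r0 > 0" "ball w r0 \<subseteq> W" "0 \<notin> ball w r0" "ua \<in> ball w r0" "ub \<in> ball w r0"
    and p: "p \<in> interior K" "D ua < p \<bullet> ua" "p \<bullet> ub < D ub"
    by (rule separated_pair[OF open_W w W_nz[OF w]]) (rule that)
  have av: "\<exists>u\<in>ball w r0. p \<bullet> u = D u \<and> (\<forall>v\<in>T. u \<notin> span {v})" if "finite T" "0 \<notin> T" for T
    by (rule plane_through_point_avoiding[OF open_ball convex_ball *(3-5) p(2,3) that]) blast
  obtain u1 where u1: "u1 \<in> ball w r0" "p \<bullet> u1 = D u1"
    using av[of "{}"] by auto
  have n1: "u1 \<noteq> 0" using u1 * by blast
  obtain u2 where u2: "u2 \<in> ball w r0" "p \<bullet> u2 = D u2" "u2 \<notin> span {u1}"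
    using av[of "{u1}"] n1 by auto
  have n2: "u2 \<noteq> 0" using u2 * by blast
  obtain u3 where u3: "u3 \<in> ball w r0" "p \<bullet> u3 = D u3" "u3 \<notin> span {u1}" "u3 \<notin> span {u2}"
    using av[of "{u1, u2}"] n1 n2 by auto
  have n3: "u3 \<noteq> 0" using u3 * by blast
  obtain u4 where u4: "u4 \<in> ball w r0" "p \<bullet> u4 = D u4" "u4 \<notin> span {u1}" "u4 \<notin> span {u2}" "u4 \<notin> span {u3}"
    using av[of "{u1, u2, u3}"] n1 n2 n3 by auto
  obtain r31 where r31: "r31 > 0" "\<And>v v'. v \<in> ball u3 r31 \<Longrightarrow> v' \<in> ball u1 r31 \<Longrightarrow> crossing v v'"
    using crossing_near[OF p(1) u3(2) u1(2) u3(3) n1] by blast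
  obtain r32 where r32: "r32 > 0" "\<And>v v'. v \<in> ball u3 r32 \<Longrightarrow> v' \<in> ball u2 r32 \<Longrightarrow> crossing v v'"
    using crossing_near[OF p(1) u3(2) u2(2) u3(4) n2] by blast
  obtain r41 where r41: "r41 > 0" "\<And>v v'. v \<in> ball u4 r41 \<Longrightarrow> v' \<in> ball u1 r41 \<Longrightarrow> crossing v v'"
    using crossing_near[OF p(1) u4(2) u1(2) u4(3) n1] by blast
  obtain r42 where r42: "r42 > 0" "\<And>v v'. v \<in> ball u4 r42 \<Longrightarrow> v' \<in> ball u2 r42 \<Longrightarrow> crossing v v'"
    using crossing_near[OF p(1) u4(2) u2(2) u4(4) n2] by blast
  obtain r43 where r43: "r43 > 0" "\<And>v v'. v \<in> ball u4 r43 \<Longrightarrow> v' \<in> ball u3 r43 \<Longrightarrow> crossing v v'"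
    using crossing_near[OF p(1) u4(2) u3(2) u4(5) n3] by blast
  obtain k3 where k3: "k3 > 0" "ball u3 k3 \<subseteq> ball w r0" using u3(1) open_contains_ball[of "ball w r0"] by blast
  obtain k4 where k4: "k4 > 0" "ball u4 k4 \<subseteq> ball w r0" using u4(1) open_contains_ball[of "ball w r0"] by blast
  define r where "r = Min {r31, r32, r41, r42, r43, k3, k4}"
  have r: "r > 0" "r \<le> r31" "r \<le> r32" "r \<le> r41" "r \<le> r42" "r \<le> r43" "r \<le> k3" "r \<le> k4"
    using r31(1) r32(1) r41(1) r42(1) r43(1) k3(1) k4(1) by (simp_all add: r_def min_le_iff_disj)
  have "ball u3 r - \<Union>{span {u1, u2}} \<noteq> {}"
    using open_minus_subspaces[of "{span {u1, u2}}" "ball u3 r"] r(1) dim_pair by auto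
  then obtain v3 where v3: "v3 \<in> ball u3 r" "v3 \<notin> span {u1, u2}" by blast
  define U where "U = ball u4 r - \<Union>{span {u1, u2}, span {u1, v3}, span {u2, v3}}"
  have sp: "S \<in> {span {u1, u2}, span {u1, v3}, span {u2, v3}} \<Longrightarrow> subspace S \<and> dim S < DIM('a)" for S
    using dim_pair by auto
  have "open U \<and> U \<noteq> {}"
    unfolding U_def by (rule open_minus_subspaces[OF _ open_ball _ sp]) (use r(1) in auto)
  then have U: "open U" "U \<noteq> {}" by auto
  have W: "u1 \<in> W" "u2 \<in> W" "v3 \<in> W" "ball u4 r \<subseteq> W"
  proof -
    show "u1 \<in> W" "u2 \<in> W" using u1(1) u2(1) *(2) by blast+
    show "v3 \<in> W" using v3(1) subset_ball[OF r(7), of u3] k3(2) *(2) by blast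
    show "ball u4 r \<subseteq> W" using subset_ball[OF r(8), of u4] k4(2) *(2) by blast
  qed
  have ind: "indep3 u1 u2 v3"
    using indep3I[OF notin_span_singleton_sym[OF u2(3) n1] u2(3) v3(2)] .
  have v3r: "v3 \<in> ball u3 r31" "v3 \<in> ball u3 r32" "v3 \<in> ball u3 r43"
    using v3(1) r by auto
  have cr: "crossing u1 u2" "crossing u1 v3" "crossing u2 v3"
  proof -
    show "crossing u1 u2" using p(1) u1(2) u2(2) unfolding crossing_def by blast
    show "crossing u1 v3" using r31(2)[OF v3r(1)] r31(1) by (intro crossing_sym[of v3]) auto
    show "crossing u2 v3" using r32(2)[OF v3r(2)] r32(1) by (intro crossing_sym[of v3]) auto
  qed
  obtain Q where Q: "section_form u1 Q" "section_form u2 Q" "section_form v3 Q"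
    using quadric_through_three_sections[OF W(1-3) ind cr] by blast
  have "section_form u Q" if u: "u \<in> U" for u
  proof -
    have ub: "u \<in> ball u4 r" "u \<notin> span {u1, u2}" "u \<notin> span {u1, v3}" "u \<notin> span {u2, v3}"
      using u by (auto simp: U_def)
    have sub: "span {v3} \<subseteq> span {u2, v3}" "span {v3} \<subseteq> span {u1, v3}" "span {u1} \<subseteq> span {u1, u2}"
      "span {u1} \<subseteq> span {u1, v3}" "span {u2} \<subseteq> span {u2, v3}" "span {u1} \<subseteq> span {u1, v3}"
      by (rule span_mono; simp)+
    have np: "u1 \<notin> span {v3}" "u2 \<notin> span {v3}" "v3 \<notin> span {u1}" "v3 \<notin> span {u2}"
      using ind sub span_mono[of "{u2}" "{u1, u2}"] unfolding indep3_def by auto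
    have "indep3 u1 u2 u" "indep3 u1 v3 u" "indep3 u2 v3 u"
      using indep3I[OF notin_span_singleton_sym[OF u2(3) n1] u2(3) ub(2)]
        indep3I[OF np(1,3) ub(3)] indep3I[OF np(2,4) ub(4)] by blast+
    then have "indep3 u u1 u2" "indep3 u u1 v3" "indep3 u u2 v3"
      by (meson indep3_perm)+
    moreover have "crossing u1 u" "crossing u2 u" "crossing v3 u"
    proof -
      have ur: "u \<in> ball u4 r41" "u \<in> ball u4 r42" "u \<in> ball u4 r43" using ub(1) r by auto
      show "crossing u1 u" using r41(2)[OF ur(1)] r41(1) by (intro crossing_sym[of u]) auto
      show "crossing u2 u" using r42(2)[OF ur(2)] r42(1) by (intro crossing_sym[of u]) auto
      show "crossing v3 u" using r43(2)[OF ur(3) v3r(3)] by (rule crossing_sym)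
    qed
    ultimately show ?thesis
      using section_form_extends[OF W(1-3) _ Q cr(1,2)] ub(1) W(4) by blast
  qed
  moreover have "U \<subseteq> W" using W(4) by (auto simp: U_def)
  ultimately show thesis using that U by blast
qed

text \<open>The interior, relative to the boundary of \<open>K\<close>, of the set of boundary
  points on \<open>Q = 0\<close>. Short chords near such a point end on
  \<open>Q = 0\<close>.\<close>

definition zero_near :: "('a \<Rightarrow> real) \<Rightarrow> 'a set" where
  "zero_near Q = {x \<in> frontier K. \<exists>e>0. \<forall>y\<in>frontier K \<inter> ball x e. Q y = 0}"

text \<open>The point \<open>y\<close> excludes a face on which \<open>u\<close> is minimal, so the
  level through \<open>x\<close> meets the interior of \<open>K\<close>.\<close>

definition beyond :: "'a \<Rightarrow> 'a set" where
  "beyond u = {x \<in> frontier K. x \<bullet> u < D u \<and> (\<exists>y\<in>interior K. y \<bullet> u < x \<bullet> u)}"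

lemma lower_interior_point:
  assumes "p \<in> interior K" "u \<noteq> 0"
  shows "\<exists>y\<in>interior K. y \<bullet> u < p \<bullet> u"
proof -
  obtain k where k: "k > 0" "cball p k \<subseteq> interior K"
    using assms(1) open_contains_cball[of "interior K"] by auto
  have "p - (k / norm u) *\<^sub>R u \<in> cball p k" using k(1) assms(2) by (simp add: dist_norm)
  moreover have "(p - (k / norm u) *\<^sub>R u) \<bullet> u < p \<bullet> u" using k(1) assms(2) by (simp add: inner_diff_left)
  ultimately show ?thesis using k(2) by blast
qed

text \<open>The boundary point \<open>x\<close> is reached from \<open>p\<close> orthogonally to
  \<open>ua\<close> and \<open>ub\<close>, so it inherits the strict inequalities of
  \<open>p\<close>, as do its neighbours. Each neighbour then lies on a plane with normal between
  \<open>ua\<close> and \<open>ub\<close>, where \<open>Q\<close> is a section form.\<close>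

lemma quadric_start:
  obtains Q u x where "quadratic Q" "\<exists>y. Q y \<noteq> 0" "u \<in> W" "x \<in> beyond u" "x \<in> zero_near Q"
proof -
  obtain Q U where U: "open U" "U \<noteq> {}" "U \<subseteq> W" and Q: "\<And>u. u \<in> U \<Longrightarrow> section_form u Q"
    by (rule quadric_on_open_set_of_sections) (rule that)
  obtain w where w: "w \<in> U" using U(2) by blast
  have wnz: "w \<noteq> 0" using w U(3) W_nz by blast
  obtain ua ub p r where *: "r > 0" "ball w r \<subseteq> U" "0 \<notin> ball w r" "ua \<in> ball w r" "ub \<in> ball w r"
    and p: "p \<in> interior K" "D ua < p \<bullet> ua" "p \<bullet> ub < D ub"
    by (rule separated_pair[OF U(1) w wnz]) (rule that)
  have inW: "ua \<in> W" "ub \<in> W" using * U(3) by blast+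
  obtain d where d: "norm d = 1" "d \<bullet> ua = 0" "d \<bullet> ub = 0"
    using exists_orthogonal_unit[OF dim] by blast
  have dnz: "d \<noteq> 0" using d(1) by auto
  obtain t where t: "p + t *\<^sub>R d \<in> frontier K"
    by (rule line_frontier_points[OF W_interior[OF inW(1)] d(2) dnz p(1)]) (rule that)
  define x where "x = p + t *\<^sub>R d"
  have x: "x \<bullet> ua = p \<bullet> ua" "x \<bullet> ub = p \<bullet> ub" using d by (simp_all add: x_def inner_add_left)
  have "open ({y. D ua < y \<bullet> ua} \<inter> {y. y \<bullet> ub < D ub})"
    using open_halfspace_gt[of "D ua" ua] open_halfspace_lt[of ub "D ub"] by (simp add: inner_commute open_Int)
  moreover have "x \<in> {y. D ua < y \<bullet> ua} \<inter> {y. y \<bullet> ub < D ub}" using x p by simp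
  ultimately obtain e where e: "e > 0" "ball x e \<subseteq> {y. D ua < y \<bullet> ua} \<inter> {y. y \<bullet> ub < D ub}"
    using open_contains_ball by blast
  have "Q y = 0" if y: "y \<in> frontier K \<inter> ball x e" for y
  proof -
    have seg: "closed_segment ua ub \<subseteq> ball w r" using *(4,5) by (intro closed_segment_subset convex_ball)
    have "0 \<notin> closed_segment ua ub" "D ua < y \<bullet> ua" "y \<bullet> ub < D ub" using seg *(3) e(2) y by blast+
    then obtain s where s: "0 < s" "s < 1" "y \<bullet> ((1 - s) *\<^sub>R ua + s *\<^sub>R ub) = D ((1 - s) *\<^sub>R ua + s *\<^sub>R ub)"
      by (rule plane_between)
    have "(1 - s) *\<^sub>R ua + s *\<^sub>R ub \<in> closed_segment ua ub"
      unfolding in_segment using s(1,2) by (intro exI[of _ s]) auto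
    then have "(1 - s) *\<^sub>R ua + s *\<^sub>R ub \<in> U" using seg *(2) by blast
    then show ?thesis using section_formD(2)[OF Q _ s(3)] y by blast
  qed
  then have "x \<in> zero_near Q" using t e(1) unfolding zero_near_def x_def by blast
  moreover have "x \<in> beyond ub"
    using t x p lower_interior_point[OF p(1), of ub] W_nz[OF inW(2)] by (auto simp: beyond_def x_def)
  moreover have "quadratic Q" using section_formD(1)[OF Q[OF w]] .
  moreover have "\<exists>y. Q y \<noteq> 0"
    using meets[OF wnz] section_formD(3)[OF Q[OF w]] by (metis less_irrefl)
  ultimately show thesis using that inW(2) by blast
qed


section \<open>Propagation along the boundary\<close>

text \<open>Since \<open>x\<close> is not interior, one of two opposite small steps along
  \<open>d\<close> ends at a noninterior point. Joining it to an interior point near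
  \<open>x\<close> gives a boundary point, distinct from \<open>x\<close> because of its component
  along \<open>d\<close>.\<close>

lemma frontier_point_nearby:
  assumes "x \<in> frontier K" "w \<in> interior K" "w \<bullet> u = x \<bullet> u" "e > 0"
  obtains y where "y \<in> frontier K" "y \<bullet> u = x \<bullet> u" "y \<noteq> x" "dist y x < e"
proof -
  obtain d where d: "norm d = 1" "d \<bullet> u = 0" "d \<bullet> (w - x) = 0"
    using exists_orthogonal_unit[OF dim] by blast
  have xK: "x \<in> K" "x \<notin> interior K" using assms(1) by (auto simp: frontier_K)
  define s where "s = e / 2"
  have s: "s > 0" "s < e" using assms(4) by (auto simp: s_def)
  have "\<exists>\<sigma>. \<bar>\<sigma>\<bar> = s \<and> x + \<sigma> *\<^sub>R d \<notin> interior K"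
  proof (rule ccontr)
    assume "\<not> ?thesis"
    then have "\<bar>\<sigma>\<bar> = s \<Longrightarrow> x + \<sigma> *\<^sub>R d \<in> interior K" for \<sigma> by blast
    from this[of s] this[of "- s"]
    have "x + s *\<^sub>R d \<in> interior K" "x + (-s) *\<^sub>R d \<in> interior K" using s(1) by simp_all
    then have "(1 - 1/2) *\<^sub>R (x + s *\<^sub>R d) + (1/2) *\<^sub>R (x + (-s) *\<^sub>R d) \<in> interior K"
      by (intro convexD_alt[OF convex_interior[OF conv]]) auto
    moreover have "(1 - 1/2) *\<^sub>R (x + s *\<^sub>R d) + (1/2) *\<^sub>R (x + (-s) *\<^sub>R d) = x"
      by (simp add: algebra_simps flip: scaleR_add_left)
    ultimately show False using xK by simp
  qed
  then obtain \<sigma> where \<sigma>: "\<bar>\<sigma>\<bar> = s" "x + \<sigma> *\<^sub>R d \<notin> interior K" by blast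
  \<comment> \<open>The step towards \<open>w\<close> has to be shorter than
    \<open>e\<close>.\<close>
  define h where "h = min 1 (e / (2 * (norm (w - x) + 1)))"
  have h: "h > 0" "h \<le> 1" using assms(4) by (auto simp: h_def add_nonneg_pos)
  have hw: "norm (h *\<^sub>R (w - x)) < e"
  proof -
    have "h * norm (w - x) \<le> (e / (2 * (norm (w - x) + 1))) * norm (w - x)"
      by (intro mult_right_mono) (auto simp: h_def)
    also have "\<dots> = (e / 2) * (norm (w - x) / (norm (w - x) + 1))" by simp
    also have "\<dots> \<le> (e / 2) * 1"
      using assms(4) by (intro mult_left_mono) (auto simp: pos_divide_le_eq add_nonneg_pos)
    also have "\<dots> < e" using assms(4) by simp
    finally show ?thesis using h by simp
  qed
  have "w + (1 - h) *\<^sub>R (x - w) \<in> interior K"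
    using h by (intro interior_segment[OF conv assms(2) xK(1)]) auto
  then have a: "x + h *\<^sub>R (w - x) \<in> interior K" by (simp add: algebra_simps)
  obtain r where r: "0 < r" "r \<le> 1"
    "(x + h *\<^sub>R (w - x)) + r *\<^sub>R ((x + \<sigma> *\<^sub>R d) - (x + h *\<^sub>R (w - x))) \<in> frontier K" (is "?y \<in> _")
    using frontier_on_segment[OF closed a \<sigma>(2)] by blast
  have y: "?y = x + ((1 - r) *\<^sub>R (h *\<^sub>R (w - x)) + r *\<^sub>R (\<sigma> *\<^sub>R d))"
    by (simp add: algebra_simps)
  have "?y \<bullet> u = x \<bullet> u" unfolding y using d(2) assms(3) by (simp add: inner_add_left inner_diff_left)
  moreover have "?y \<noteq> x"
  proof
    assume "?y = x"
    then have "d \<bullet> ((1 - r) *\<^sub>R (h *\<^sub>R (w - x)) + r *\<^sub>R (\<sigma> *\<^sub>R d)) = 0" unfolding y by simp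
    then have "r * \<sigma> * (d \<bullet> d) = 0" using d(3) by (simp add: inner_add_right)
    then show False using r(1) \<sigma>(1) s(1) d(1) by (auto simp: dot_square_norm)
  qed
  moreover have "dist ?y x < e"
  proof -
    have "norm ((1 - r) *\<^sub>R a + r *\<^sub>R b) \<le> (1 - r) * norm a + r * norm b" for a b :: 'a
      using norm_triangle_ineq[of "(1 - r) *\<^sub>R a" "r *\<^sub>R b"] r(1,2) by simp
    then have "norm ((1 - r) *\<^sub>R (h *\<^sub>R (w - x)) + r *\<^sub>R (\<sigma> *\<^sub>R d))
        \<le> (1 - r) * norm (h *\<^sub>R (w - x)) + r * norm (\<sigma> *\<^sub>R d)" .
    also have "\<dots> < e"
    proof (rule convex_bound_lt)
      show "norm (\<sigma> *\<^sub>R d) < e" using \<sigma>(1) s(2) d(1) by simp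
    qed (use hw r in auto)
    finally show ?thesis unfolding y by (simp add: dist_norm)
  qed
  ultimately show thesis using that[OF r(3)] by blast
qed

text \<open>If \<open>q z\<close> were 0, the chords would force \<open>q\<close> to vanish on the
  whole plane. The combination \<open>q z * Q x - Q z * q x\<close> vanishes at \<open>z\<close> and
  at all chord ends, hence on the plane. An open set of directions suffices.\<close>

lemma chord_principle:
  assumes Q: "quadratic Q" and q: "quadratic q" "y0 \<bullet> u = D u" "q y0 \<noteq> 0"
    and z: "z \<bullet> u = D u" and d0: "d0 \<bullet> u = 0" "e > 0"
    and chords: "\<And>d. d \<bullet> u = 0 \<Longrightarrow> norm (d - d0) < e \<Longrightarrow> \<exists>t1 t2. t1 > 0 \<and> t2 < 0 \<and>
      q (z + t1 *\<^sub>R d) = 0 \<and> q (z + t2 *\<^sub>R d) = 0 \<and> Q (z + t1 *\<^sub>R d) = 0 \<and> Q (z + t2 *\<^sub>R d) = 0"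
    and x: "x \<bullet> u = D u" "q x = 0"
  shows "Q x = 0"
proof -
  let ?S = "{d. u \<bullet> d = 0}"
  have S: "subspace ?S" "d0 \<in> ?S" "x - z \<in> ?S" "y0 - z \<in> ?S"
    using d0 x z q(2)
    by (simp_all add: subspace_hyperplane inner_diff_right inner_commute[of u d0] inner_commute[of u x]
        inner_commute[of u z] inner_commute[of u y0])
  have "q z \<noteq> 0"
  proof
    assume qz: "q z = 0"
    have "q (z + (y0 - z)) = 0"
      by (rule quadratic_vanishes_on_subspace[OF q(1) S(1,2) d0(2) qz _ S(4)])
        (use chords in \<open>simp add: inner_commute[of u], blast\<close>)
    then show False using q(3) by simp
  qed
  define R where "R = (\<lambda>x. q z * Q x - Q z * q x)"
  have R: "quadratic R" unfolding R_def by (intro quadratic_diff quadratic_cmult Q q(1))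
  have "R (z + (x - z)) = 0"
  proof (rule quadratic_vanishes_on_subspace[OF R S(1,2) d0(2) _ _ S(3)])
    show "R z = 0" by (simp add: R_def)
    fix d assume "d \<in> ?S" "norm (d - d0) < e"
    then obtain t1 t2 where "t1 > 0" "t2 < 0" "q (z + t1 *\<^sub>R d) = 0" "q (z + t2 *\<^sub>R d) = 0"
        "Q (z + t1 *\<^sub>R d) = 0" "Q (z + t2 *\<^sub>R d) = 0"
      using chords[of d] by (auto simp: inner_commute)
    then show "\<exists>t1 t2. t1 > 0 \<and> t2 < 0 \<and> R (z + t1 *\<^sub>R d) = 0 \<and> R (z + t2 *\<^sub>R d) = 0"
      by (intro exI[of _ t1] exI[of _ t2]) (simp add: R_def)
  qed
  then show ?thesis using x(2) \<open>q z \<noteq> 0\<close> by (simp add: R_def)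
qed

text \<open>The sections by planes with normals in \<open>W\<close> are bounded, so they contain no segments in
  their boundary: a quadratic form of the section would vanish on the whole line.\<close>

lemma section_determined:
  assumes Q: "quadratic Q" and u: "u \<in> W" and m: "m \<in> zero_near Q" "m \<bullet> u = D u"
    and y: "y \<in> frontier K" "y \<bullet> u = D u"
  shows "Q y = 0"
proof -
  obtain q where q: "section_form u q" by (rule section_form_exists[OF u])
  obtain e where e: "e > 0" "\<And>y. y \<in> frontier K \<Longrightarrow> dist m y < e \<Longrightarrow> Q y = 0"
    using m(1) unfolding zero_near_def by auto
  have mfr: "m \<in> frontier K" using m(1) by (auto simp: zero_near_def)
  obtain w where w: "w \<in> interior K" "w \<bullet> u = D u" using meets[OF W_nz[OF u]] by blast
  \<comment> \<open>With \<open>d0\<close> shorter than \<open>e / 4\<close>, the midpoint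
    \<open>z\<close> and the ends of chords close in direction to \<open>d0\<close> stay within
    \<open>e\<close> of \<open>m\<close>.\<close>
  have "w \<bullet> u = m \<bullet> u" "e / 4 > 0" using w m e by auto
  then obtain m' where m': "m' \<in> frontier K" "m' \<bullet> u = m \<bullet> u" "m' \<noteq> m" "dist m' m < e / 4"
    by (rule frontier_point_nearby[OF mfr w(1)])
  define d0 where "d0 = m' - m"
  define z where "z = m + (1/2) *\<^sub>R d0"
  have d0: "d0 \<bullet> u = 0" "d0 \<noteq> 0" "norm d0 < e / 4"
    using m' by (auto simp: d0_def inner_diff_left dist_norm)
  have z: "z \<bullet> u = D u" using d0 m by (simp add: z_def inner_add_left)
  have mK: "m \<in> K" "m' \<in> K" using mfr m'(1) frontier_in_K by auto
  have "(1 - 1/2) *\<^sub>R m + (1/2) *\<^sub>R m' \<in> K" using mK by (intro convexD_alt[OF conv]) auto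
  moreover have "(1 - 1/2) *\<^sub>R m + (1/2) *\<^sub>R m' = z"
    unfolding z_def d0_def by (simp only: scaleR_left_diff_distrib scaleR_one scaleR_right_diff_distrib) simp
  ultimately have "z \<in> K" by simp
  have zi: "z \<in> interior K"
  proof (rule ccontr)
    assume "z \<notin> interior K"
    then have "z \<in> frontier K" using \<open>z \<in> K\<close> by (simp add: frontier_K)
    then have "q m = 0" "q (m + (1/2) *\<^sub>R d0) = 0" "q (m + 1 *\<^sub>R d0) = 0"
      using section_formD(2)[OF q] mfr m'(1,2) m(2) z by (auto simp: z_def d0_def)
    then have zero: "q (m + t *\<^sub>R d0) = 0" for t
      using quadratic_two_roots[OF section_formD(1)[OF q], of m "1/2" d0 1 t] by simp
    obtain t where "m + t *\<^sub>R d0 \<notin> K"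
      by (rule line_leaves[OF W_interior[OF u] d0(1,2)])
    then have "q (m + t *\<^sub>R d0) > 0"
      using section_formD(4)[OF q] d0(1) m(2) by (simp add: inner_add_left)
    then show False using zero by simp
  qed
  have out: "z + d0 \<notin> K" "z - d0 \<notin> K"
  proof -
    show "z + d0 \<notin> K"
    proof
      assume "z + d0 \<in> K"
      then have "z + (1/2) *\<^sub>R ((z + d0) - z) \<in> interior K" by (intro interior_segment[OF conv zi]) auto
      moreover have "z + (1/2) *\<^sub>R ((z + d0) - z) = m'" by (simp add: z_def d0_def algebra_simps flip: scaleR_add_left)
      ultimately show False using m'(1) by (simp add: frontier_K)
    qed
    show "z - d0 \<notin> K"
    proof
      assume "z - d0 \<in> K"
      then have "z + (1/2) *\<^sub>R ((z - d0) - z) \<in> interior K" by (intro interior_segment[OF conv zi]) auto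
      moreover have "z + (1/2) *\<^sub>R ((z - d0) - z) = m" by (simp add: z_def)
      ultimately show False using mfr by (simp add: frontier_K)
    qed
  qed
  have "open ((\<lambda>d. z + d) -` (- K) \<inter> (\<lambda>d. z - d) -` (- K))"
    using closed by (intro open_Int open_vimage continuous_intros) auto
  moreover have "d0 \<in> (\<lambda>d. z + d) -` (- K) \<inter> (\<lambda>d. z - d) -` (- K)" using out by simp
  ultimately obtain k where k: "k > 0" "ball d0 k \<subseteq> (\<lambda>d. z + d) -` (- K) \<inter> (\<lambda>d. z - d) -` (- K)"
    using open_contains_ball by blast
  \<comment> \<open>The bound \<open>k\<close> makes both ends of the perturbed chord leave
    \<open>K\<close>; the bound \<open>e / 4\<close> keeps its ends near \<open>m\<close>.\<close>
  have small: "min k (e / 4) > 0" using k(1) e(1) by simp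
  show ?thesis
  proof (rule chord_principle[OF Q section_formD(1)[OF q] w(2) _ z d0(1) small _ y(2)])
    show "q w \<noteq> 0" using section_formD(3)[OF q w] by simp
    show "q y = 0" using section_formD(2)[OF q y] .
    fix d assume d: "d \<bullet> u = 0" "norm (d - d0) < min k (e / 4)"
    then have "d \<in> ball d0 k" by (simp add: dist_norm norm_minus_commute)
    then have dK: "z + 1 *\<^sub>R d \<notin> K" "z + 1 *\<^sub>R (- d) \<notin> K" using k(2) by auto
    have nd: "norm d < e / 2" using norm_triangle_ineq[of "d - d0" d0] d(2) d0(3) by simp
    have near: "dist m (z + t *\<^sub>R d') < e" if "\<bar>t\<bar> < 1" "norm d' = norm d" for t d'
    proof -
      have "dist m (m + v) = norm v" for v by (simp add: dist_norm)
      then have "dist m (z + t *\<^sub>R d') = norm ((1/2) *\<^sub>R d0 + t *\<^sub>R d')"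
        by (simp add: z_def add.assoc)
      also have "\<dots> \<le> norm d0 / 2 + \<bar>t\<bar> * norm d'"
        using norm_triangle_ineq[of "(1/2) *\<^sub>R d0" "t *\<^sub>R d'"] by simp
      also have "\<bar>t\<bar> * norm d' \<le> norm d"
        using that by (simp add: mult_left_le_one_le)
      finally show ?thesis using nd d0(3) e(1) by linarith
    qed
    obtain t1 where t1: "0 < t1" "t1 < 1" "z + t1 *\<^sub>R d \<in> frontier K"
      by (rule line_meets_frontier[OF zi dK(1)]) (auto intro: that)
    obtain t2 where t2: "0 < t2" "t2 < 1" "z + t2 *\<^sub>R (- d) \<in> frontier K"
      by (rule line_meets_frontier[OF zi dK(2)]) (auto intro: that)
    have pl: "(z + t *\<^sub>R d) \<bullet> u = D u" for t using d(1) z by (simp add: inner_add_left)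
    show "\<exists>t1 t2. t1 > 0 \<and> t2 < 0 \<and> q (z + t1 *\<^sub>R d) = 0 \<and> q (z + t2 *\<^sub>R d) = 0 \<and>
        Q (z + t1 *\<^sub>R d) = 0 \<and> Q (z + t2 *\<^sub>R d) = 0"
    proof (rule exI[of _ t1], rule exI[of _ "- t2"], intro conjI)
      have f2: "z + (- t2) *\<^sub>R d \<in> frontier K" using t2(3) by simp
      show "q (z + t1 *\<^sub>R d) = 0" by (rule section_formD(2)[OF q t1(3) pl])
      show "q (z + (- t2) *\<^sub>R d) = 0" by (rule section_formD(2)[OF q f2 pl])
      show "Q (z + t1 *\<^sub>R d) = 0" using e(2)[OF t1(3)] near[of t1 d] t1 by simp
      show "Q (z + (- t2) *\<^sub>R d) = 0" using e(2)[OF f2] near[of "- t2" d] t2 by simp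
    qed (use t1 t2 in auto)
  qed
qed

text \<open>A convex combination \<open>v\<close> of outer normals at \<open>y\<close> and \<open>m\<close> is orthogonal to \<open>y - m\<close>, and so
  is a small perturbation of \<open>u0\<close>. Since \<open>y\<close> lies above the plane of \<open>v\<close> and below the plane of
  \<open>u0\<close>, some normal in between gives a plane through both points.\<close>

lemma local_linking:
  assumes u0: "u0 \<in> W" and x: "x \<in> beyond u0"
  obtains e where "e > 0" "\<And>y m. y \<in> frontier K \<Longrightarrow> m \<in> frontier K \<Longrightarrow> dist x y < e \<Longrightarrow> dist x m < e
    \<Longrightarrow> y \<noteq> m \<Longrightarrow> \<bar>(y - m) \<bullet> u0\<bar> \<le> e * norm (y - m) \<Longrightarrow> \<exists>u\<in>W. y \<bullet> u = D u \<and> m \<bullet> u = D u"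
proof (rule ccontr)
  note linked = that
  assume no: "\<not> thesis"
  define bad where "bad = (\<lambda>e y m. y \<in> frontier K \<and> m \<in> frontier K \<and> dist x y < e \<and> dist x m < e \<and> y \<noteq> m \<and>
      \<bar>(y - m) \<bullet> u0\<bar> \<le> e * norm (y - m) \<and> \<not> (\<exists>u\<in>W. y \<bullet> u = D u \<and> m \<bullet> u = D u))"
  have "\<exists>y m. bad e y m" if e: "e > 0" for e
  proof (rule ccontr)
    assume "\<nexists>y m. bad e y m"
    then have thesis unfolding bad_def by (intro linked[OF e]) blast
    then show False using no by blast
  qed
  then have "\<forall>k. \<exists>y m. bad (inverse (real (Suc k))) y m" by simp
  then obtain y m where bad: "\<And>k. bad (inverse (real (Suc k))) (y k) (m k)" by metis
  have ym: "y k \<in> frontier K" "m k \<in> frontier K" "y k \<noteq> m k"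
    and no_link: "\<not> (\<exists>u\<in>W. y k \<bullet> u = D u \<and> m k \<bullet> u = D u)" for k
    using bad[of k] by (auto simp: bad_def)
  have ymd: "dist x (y k) < inverse (real (Suc k))" "dist x (m k) < inverse (real (Suc k))"
    "\<bar>(y k - m k) \<bullet> u0\<bar> \<le> inverse (real (Suc k)) * norm (y k - m k)" for k
    using bad[of k] by (auto simp: bad_def)
  have yx: "y \<longlonglongrightarrow> x" and mx: "m \<longlonglongrightarrow> x"
    using ymd(1,2) LIMSEQ_inverse_real_of_nat
    by (auto intro!: metric_LIMSEQ_I dest!: metric_LIMSEQ_D simp: dist_commute)
      (meson order_less_trans)+
  define d where "d = (\<lambda>k. (y k - m k) /\<^sub>R norm (y k - m k))"
  have nd: "norm (d k) = 1" and ydm: "y k - m k = norm (y k - m k) *\<^sub>R d k" for k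
    using ym(3)[of k] by (auto simp: d_def)
  have du: "\<bar>d k \<bullet> u0\<bar> \<le> inverse (real (Suc k))" for k
  proof -
    have "d k \<bullet> u0 = ((y k - m k) \<bullet> u0) / norm (y k - m k)"
      by (simp add: d_def divide_inverse mult.commute)
    then show ?thesis using ymd(3)[of k] ym(3)[of k] by (simp add: pos_divide_le_eq)
  qed
  have "\<exists>v. norm v = 1 \<and> (\<forall>z\<in>K. z \<bullet> v \<le> y k \<bullet> v)" for k
    by (rule frontier_normal[OF ym(1)[of k]]) blast
  then obtain vy where vy: "\<And>k. norm (vy k) = 1" "\<And>k z. z \<in> K \<Longrightarrow> z \<bullet> vy k \<le> y k \<bullet> vy k"
    by metis
  have "\<exists>v. norm v = 1 \<and> (\<forall>z\<in>K. z \<bullet> v \<le> m k \<bullet> v)" for k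
    by (rule frontier_normal[OF ym(2)[of k]]) blast
  then obtain vm where vm: "\<And>k. norm (vm k) = 1" "\<And>k z. z \<in> K \<Longrightarrow> z \<bullet> vm k \<le> m k \<bullet> vm k"
    by metis
  \<comment> \<open>The normal at \<open>y k\<close> is nonnegative and the normal at
    \<open>m k\<close> nonpositive on \<open>y k - m k\<close>, so some combination is orthogonal to
    it.\<close>
  have "\<exists>s. 0 \<le> s \<and> s \<le> 1 \<and> ((1 - s) *\<^sub>R vy k + s *\<^sub>R vm k) \<bullet> d k = 0" for k
  proof -
    have "(y k - m k) \<bullet> vy k \<ge> 0" "(y k - m k) \<bullet> vm k \<le> 0"
      using vy(2)[of "m k" k] vm(2)[of "y k" k] ym frontier_in_K by (auto simp: inner_diff_left)
    then have "vy k \<bullet> d k \<ge> 0" "vm k \<bullet> d k \<le> 0"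
      unfolding d_def by (auto simp: inner_commute zero_le_mult_iff mult_le_0_iff)
    moreover have "continuous_on {0..1} (\<lambda>s. - (((1 - s) *\<^sub>R vy k + s *\<^sub>R vm k) \<bullet> d k))"
      by (intro continuous_intros)
    ultimately obtain s where "0 \<le> s" "s \<le> 1" "- (((1 - s) *\<^sub>R vy k + s *\<^sub>R vm k) \<bullet> d k) = 0"
      using IVT'[of "\<lambda>s. - (((1 - s) *\<^sub>R vy k + s *\<^sub>R vm k) \<bullet> d k)" 0 0 1] by auto
    then show ?thesis by auto
  qed
  then obtain s where s: "\<And>k. 0 \<le> s k" "\<And>k. s k \<le> 1"
    "\<And>k. ((1 - s k) *\<^sub>R vy k + s k *\<^sub>R vm k) \<bullet> d k = 0" by metis
  define v where "v = (\<lambda>k. (1 - s k) *\<^sub>R vy k + s k *\<^sub>R vm k)"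
  have vd: "v k \<bullet> d k = 0" for k using s(3) by (simp add: v_def)
  have vball: "v k \<in> cball 0 1" for k
    unfolding v_def using vy(1) vm(1) s by (intro convexD_alt convex_cball) auto
  have vbar: "v k \<in> barrier" for k
    unfolding v_def using vy(2) vm(2) s
    by (intro convexD_alt[OF convex_barrier] normal_in_barrier[of _ "y k \<bullet> vy k"] normal_in_barrier[of _ "m k \<bullet> vm k"]) auto
  \<comment> \<open>Used twice in the limit: \<open>c = 0\<close> shows that \<open>V\<close>
    supports \<open>K\<close> at \<open>x\<close>, and the radius of a ball inside \<open>K\<close>
    as \<open>c\<close> shows that \<open>V\<close> is not 0.\<close>
  have vmax: "z \<bullet> v k + c \<le> y k \<bullet> v k + norm (m k - y k)"
    if z: "z + c *\<^sub>R vy k \<in> K" "z + c *\<^sub>R vm k \<in> K" for z c k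
  proof -
    have "z \<bullet> vy k + c \<le> y k \<bullet> vy k"
      using vy(2)[OF z(1), of k] vy(1)[of k] by (simp add: inner_add_left dot_square_norm)
    moreover have "z \<bullet> vm k + c \<le> y k \<bullet> vm k + norm (m k - y k)"
      using vm(2)[OF z(2), of k] vm(1)[of k] norm_cauchy_schwarz[of "m k - y k" "vm k"]
      by (simp add: inner_add_left inner_diff_left dot_square_norm)
    ultimately have "(1 - s k) * (z \<bullet> vy k + c) + s k * (z \<bullet> vm k + c)
        \<le> (1 - s k) * (y k \<bullet> vy k) + s k * (y k \<bullet> vm k + norm (m k - y k))"
      using s(1,2)[of k] by (intro add_mono[OF mult_left_mono mult_left_mono]) auto
    also have "\<dots> \<le> (1 - s k) * (y k \<bullet> vy k) + s k * (y k \<bullet> vm k) + norm (m k - y k)"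
      using s(1,2)[of k] by (simp add: distrib_left mult_left_le_one_le)
    finally show ?thesis by (simp add: v_def inner_add_right algebra_simps)
  qed
  obtain V r where V: "strict_mono r" "(v \<circ> r) \<longlonglongrightarrow> V"
    using compact_cball[of "0::'a" 1] vball unfolding compact_def by blast
  have lim: "(\<lambda>k. y (r k)) \<longlonglongrightarrow> x" "(\<lambda>k. m (r k)) \<longlonglongrightarrow> x" "(\<lambda>k. v (r k)) \<longlonglongrightarrow> V"
    using LIMSEQ_subseq_LIMSEQ[OF yx V(1)] LIMSEQ_subseq_LIMSEQ[OF mx V(1)] V(2) by (simp_all add: o_def)
  have rhs: "(\<lambda>k. y (r k) \<bullet> v (r k) + norm (m (r k) - y (r k))) \<longlonglongrightarrow> x \<bullet> V + norm (x - x)"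
    by (intro tendsto_intros lim)
  have lhs: "(\<lambda>k. z \<bullet> v (r k) + c) \<longlonglongrightarrow> z \<bullet> V + c" for z c
    by (intro tendsto_intros lim)
  have Vmax: "z \<bullet> V \<le> x \<bullet> V" if "z \<in> K" for z
    using LIMSEQ_le[OF lhs[of z 0] rhs] vmax[of z 0] that by simp
  have "V \<noteq> 0"
  proof
    assume "V = 0"
    obtain z where "z \<in> interior K" using interior_ne by blast
    then obtain c where c: "c > 0" "cball z c \<subseteq> K" using mem_interior_cball by blast
    then have "z + c *\<^sub>R w \<in> K" if "norm w = 1" for w
      using that by (auto simp: subset_iff dist_norm)
    then have "z \<bullet> V + c \<le> x \<bullet> V + norm (x - x)"
      by (intro LIMSEQ_le[OF lhs[of z c] rhs]) (use vmax vy(1) vm(1) in auto)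
    then show False using \<open>V = 0\<close> c by simp
  qed
  have DV: "D V < x \<bullet> V" by (rule normal_above[OF \<open>V \<noteq> 0\<close> Vmax])
  \<comment> \<open>The projection of \<open>u0\<close> onto the complement of \<open>d k\<close>;
    it tends to \<open>u0\<close> since \<open>u0 \<bullet> d k\<close> tends to 0.\<close>
  define u where "u = (\<lambda>k. u0 - (u0 \<bullet> d k) *\<^sub>R d k)"
  have ud: "u k \<bullet> d k = 0" for k using nd[of k] by (simp add: u_def inner_diff_left dot_square_norm)
  have "(\<lambda>k. u0 \<bullet> d k) \<longlonglongrightarrow> 0"
    by (rule Lim_null_comparison[OF _ LIMSEQ_inverse_real_of_nat])
      (use du in \<open>auto simp: inner_commute\<close>)
  then have "(\<lambda>k. (u0 \<bullet> d k) *\<^sub>R d k) \<longlonglongrightarrow> 0"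
    using nd by (intro tendsto_norm_zero_cancel[of "\<lambda>k. (u0 \<bullet> d k) *\<^sub>R d k"]) (simp add: tendsto_rabs_zero_iff)
  then have "u \<longlonglongrightarrow> u0 - 0" unfolding u_def by (intro tendsto_intros)
  then have ulim: "(\<lambda>k. u (r k)) \<longlonglongrightarrow> u0"
    using LIMSEQ_subseq_LIMSEQ[OF _ V(1), of u u0] by (simp add: o_def)
  have u0nz: "u0 \<noteq> 0" by (rule W_nz[OF u0])
  \<comment> \<open>The vector \<open>x - y1\<close> is positive on both \<open>V\<close> and
    \<open>u0\<close>, which keeps the segment from \<open>v k\<close> to \<open>u k\<close> away
    from 0 for late \<open>k\<close>.\<close>
  obtain y1 where y1: "y1 \<in> interior K" "y1 \<bullet> u0 < x \<bullet> u0" and xu: "x \<bullet> u0 < D u0"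
    using x unfolding beyond_def by blast
  have y1V: "y1 \<bullet> V < x \<bullet> V" by (rule interior_strict[OF y1(1) \<open>V \<noteq> 0\<close> Vmax])
  have "(\<lambda>k. y (r k) \<bullet> v (r k) - D (v (r k))) \<longlonglongrightarrow> x \<bullet> V - D V"
    by (intro tendsto_intros lim isCont_tendsto_compose[OF isCont_D[OF \<open>V \<noteq> 0\<close>]])
  then have "\<forall>\<^sub>F k in sequentially. 0 < y (r k) \<bullet> v (r k) - D (v (r k))"
    by (rule order_tendstoD) (use DV in simp)
  moreover have "(\<lambda>k. D (u (r k)) - y (r k) \<bullet> u (r k)) \<longlonglongrightarrow> D u0 - x \<bullet> u0"
    by (intro tendsto_intros lim ulim isCont_tendsto_compose[OF isCont_D[OF u0nz]])
  then have "\<forall>\<^sub>F k in sequentially. 0 < D (u (r k)) - y (r k) \<bullet> u (r k)"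
    by (rule order_tendstoD) (use xu in simp)
  moreover have "\<forall>\<^sub>F k in sequentially. u (r k) \<in> interior barrier"
    by (rule topological_tendstoD[OF ulim open_interior W_interior[OF u0]])
  moreover have "(\<lambda>k. (x - y1) \<bullet> v (r k)) \<longlonglongrightarrow> (x - y1) \<bullet> V" by (intro tendsto_intros lim)
  then have "\<forall>\<^sub>F k in sequentially. 0 < (x - y1) \<bullet> v (r k)"
    by (rule order_tendstoD) (use y1V in \<open>simp add: inner_diff_left\<close>)
  moreover have "(\<lambda>k. (x - y1) \<bullet> u (r k)) \<longlonglongrightarrow> (x - y1) \<bullet> u0" by (intro tendsto_intros ulim)
  then have "\<forall>\<^sub>F k in sequentially. 0 < (x - y1) \<bullet> u (r k)"
    by (rule order_tendstoD) (use y1(2) in \<open>simp add: inner_diff_left\<close>)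
  ultimately have "\<forall>\<^sub>F k in sequentially. 0 < y (r k) \<bullet> v (r k) - D (v (r k)) \<and>
      0 < D (u (r k)) - y (r k) \<bullet> u (r k) \<and> u (r k) \<in> interior barrier \<and>
      0 < (x - y1) \<bullet> v (r k) \<and> 0 < (x - y1) \<bullet> u (r k)"
    by eventually_elim blast
  then obtain k0 where "0 < y (r k0) \<bullet> v (r k0) - D (v (r k0)) \<and>
      0 < D (u (r k0)) - y (r k0) \<bullet> u (r k0) \<and> u (r k0) \<in> interior barrier \<and>
      0 < (x - y1) \<bullet> v (r k0) \<and> 0 < (x - y1) \<bullet> u (r k0)"
    using eventually_happens'[OF sequentially_bot] by blast
  then obtain k where k: "0 < y k \<bullet> v k - D (v k)" "0 < D (u k) - y k \<bullet> u k" "u k \<in> interior barrier"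
      "0 < (x - y1) \<bullet> v k" "0 < (x - y1) \<bullet> u k"
    by blast
  have pos: "(x - y1) \<bullet> ((1 - t) *\<^sub>R v k + t *\<^sub>R u k) > 0" if "0 \<le> t" "t \<le> 1" for t
  proof (cases "t = 0")
    case False
    then have "(1 - t) * ((x - y1) \<bullet> v k) \<ge> 0" "t * ((x - y1) \<bullet> u k) > 0" using that k(4,5) by auto
    then show ?thesis by (simp add: inner_add_right)
  qed (use k(4) in simp)
  have "0 \<notin> closed_segment (v k) (u k)"
  proof
    assume "0 \<in> closed_segment (v k) (u k)"
    then obtain t where "0 \<le> t" "t \<le> 1" "0 = (1 - t) *\<^sub>R v k + t *\<^sub>R u k" unfolding in_segment by blast
    then show False using pos[of t] by simp
  qed
  moreover have "D (v k) < y k \<bullet> v k" "y k \<bullet> u k < D (u k)" using k(1,2) by simp_all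
  ultimately obtain t where t: "0 < t" "t < 1"
    "y k \<bullet> ((1 - t) *\<^sub>R v k + t *\<^sub>R u k) = D ((1 - t) *\<^sub>R v k + t *\<^sub>R u k)"
    by (rule plane_between)
  define w where "w = (1 - t) *\<^sub>R v k + t *\<^sub>R u k"
  \<comment> \<open>A proper mixture of an interior point of \<open>barrier\<close> with the merely
    admissible normal \<open>v k\<close> is interior again.\<close>
  have "u k + (1 - t) *\<^sub>R (v k - u k) \<in> interior barrier"
    by (rule interior_segment[OF convex_barrier k(3) vbar]) (use t in auto)
  then have "w \<in> interior barrier" by (simp add: w_def algebra_simps)
  moreover have "w \<noteq> 0" using pos[of t] t(1,2) by (auto simp: w_def)
  ultimately have "w \<in> W" by (simp add: W_def)
  have "w \<bullet> d k = 0" using vd ud by (simp add: w_def inner_add_left)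
  then have "(y k - m k) \<bullet> w = 0" by (subst ydm) (simp add: inner_commute)
  then have "m k \<bullet> w = D w" using t(3) by (simp add: w_def[symmetric] inner_diff_left)
  then show False using no_link[of k] \<open>w \<in> W\<close> t(3) unfolding w_def by blast
qed


lemma zero_near_eq: "\<exists>G. open G \<and> zero_near Q = frontier K \<inter> G"
proof (intro exI conjI)
  let ?G = "\<Union>{ball x e |x e. e > 0 \<and> (\<forall>y\<in>frontier K \<inter> ball x e. Q y = 0)}"
  show "open ?G" by auto
  show "zero_near Q = frontier K \<inter> ?G"
  proof (intro equalityI subsetI)
    fix x assume "x \<in> zero_near Q"
    then obtain e where "x \<in> frontier K" "e > 0" "\<forall>y\<in>frontier K \<inter> ball x e. Q y = 0"
      unfolding zero_near_def by blast
    moreover from this have "x \<in> ball x e" by simp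
    ultimately show "x \<in> frontier K \<inter> ?G" by blast
  next
    fix x assume "x \<in> frontier K \<inter> ?G"
    then obtain c e where *: "x \<in> frontier K" "x \<in> ball c e" "\<forall>y\<in>frontier K \<inter> ball c e. Q y = 0" by blast
    obtain k where "k > 0" "ball x k \<subseteq> ball c e" using *(2) open_contains_ball[of "ball c e"] by blast
    then show "x \<in> zero_near Q" unfolding zero_near_def using *(1,3) by blast
  qed
qed

lemma level_interior:
  assumes "a \<in> interior K" "b \<in> interior K" "a \<bullet> u \<le> t" "t \<le> b \<bullet> u"
  obtains w where "w \<in> interior K" "w \<bullet> u = t"
proof -
  have "connected ((\<lambda>x. x \<bullet> u) ` interior K)"
    by (intro connected_continuous_image convex_connected convex_interior conv continuous_intros)
  then have "t \<in> (\<lambda>x. x \<bullet> u) ` interior K"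
    using assms by (meson connectedD_interval imageI)
  then show thesis using that by blast
qed

lemma beyond_level:
  assumes "x \<in> beyond u" "u \<noteq> 0"
  obtains w where "w \<in> interior K" "w \<bullet> u = x \<bullet> u"
proof -
  obtain y where y: "y \<in> interior K" "y \<bullet> u < x \<bullet> u" and x: "x \<bullet> u < D u"
    using assms unfolding beyond_def by blast
  obtain z where z: "z \<in> interior K" "z \<bullet> u = D u" using meets[OF assms(2)] by blast
  have "y \<bullet> u \<le> x \<bullet> u" "x \<bullet> u \<le> z \<bullet> u" using y x z by auto
  then show thesis by (rule level_interior[OF y(1) z(1)]) (rule that)
qed

text \<open>Linking requires a difference nearly orthogonal to \<open>u0\<close>, which a point
  \<open>m\<close> close to \<open>x\<close> need not satisfy with the neighbours of
  \<open>x\<close>. The detour goes through \<open>x'\<close> at the height of \<open>x\<close> but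
  at a fixed distance: \<open>m\<close> is linked to all neighbours of \<open>x'\<close>, and
  \<open>x'\<close> to all neighbours of \<open>x\<close>.\<close>

lemma zero_near_closed_beyond:
  assumes Q: "quadratic Q" and u0: "u0 \<in> W" and x: "x \<in> beyond u0" "x \<in> closure (zero_near Q)"
  shows "x \<in> zero_near Q"
proof -
  obtain e where e: "e > 0" and link: "\<And>y m. y \<in> frontier K \<Longrightarrow> m \<in> frontier K \<Longrightarrow> dist x y < e \<Longrightarrow>
    dist x m < e \<Longrightarrow> y \<noteq> m \<Longrightarrow> \<bar>(y - m) \<bullet> u0\<bar> \<le> e * norm (y - m) \<Longrightarrow> \<exists>u\<in>W. y \<bullet> u = D u \<and> m \<bullet> u = D u"
    by (rule local_linking[OF u0 x(1)]) (rule that)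
  have zero: "Q y = 0" if ym: "y \<in> frontier K" "m \<in> zero_near Q" "dist x y < e" "dist x m < e" "y \<noteq> m"
    "\<bar>(y - m) \<bullet> u0\<bar> \<le> e * norm (y - m)" for y m
  proof -
    have "m \<in> frontier K" using ym(2) by (auto simp: zero_near_def)
    then obtain u where "u \<in> W" "y \<bullet> u = D u" "m \<bullet> u = D u"
      using link[OF ym(1) _ ym(3-6)] by blast
    then show ?thesis using section_determined[OF Q _ ym(2) _ ym(1)] by blast
  qed
  have xfr: "x \<in> frontier K" using x(1) by (auto simp: beyond_def)
  obtain w where w: "w \<in> interior K" "w \<bullet> u0 = x \<bullet> u0" by (rule beyond_level[OF x(1) W_nz[OF u0]])
  obtain x' where x': "x' \<in> frontier K" "x' \<bullet> u0 = x \<bullet> u0" "x' \<noteq> x" "dist x' x < e"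
    by (rule frontier_point_nearby[OF xfr w e])
  define \<rho> where "\<rho> = dist x' x"
  have \<rho>: "\<rho> > 0" using x'(3) by (simp add: \<rho>_def)
  define N where "N = norm u0 + e"
  \<comment> \<open>Within \<open>k\<close> of \<open>x\<close> the height over \<open>u0\<close>
    varies by at most \<open>k * norm u0\<close>, while the distance to \<open>x'\<close> stays
    above \<open>\<rho> - k\<close>; this \<open>k\<close> makes the slope less than
    \<open>e\<close>.\<close>
  define k where "k = min e (e * \<rho> / (2 * N))"
  have ue: "N > 0" using e by (simp add: N_def add_nonneg_pos)
  have k: "k > 0" "k \<le> e" using e \<rho> ue by (simp_all add: k_def)
  have "k * N \<le> e * \<rho> / (2 * N) * N"
    using ue by (intro mult_right_mono) (auto simp: k_def)
  also have "\<dots> = e * \<rho> / 2" using ue by simp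
  also have "\<dots> < e * \<rho>" using e \<rho> by simp
  finally have k2: "k * norm u0 < e * (\<rho> - k)" by (simp add: N_def algebra_simps)
  have sep: "\<bar>(x' - y) \<bullet> u0\<bar> < e * norm (x' - y)" if "dist x y < k" for y
  proof -
    have "\<bar>(x' - y) \<bullet> u0\<bar> = \<bar>(x - y) \<bullet> u0\<bar>" using x'(2) by (simp add: inner_diff_left)
    also have "\<dots> \<le> norm (x - y) * norm u0" by (rule Cauchy_Schwarz_ineq2)
    also have "\<dots> \<le> k * norm u0" using that by (intro mult_right_mono) (auto simp: dist_norm)
    also have "\<dots> < e * (\<rho> - k)" by (rule k2)
    also have "\<dots> \<le> e * norm (x' - y)"
    proof -
      have "\<rho> \<le> dist x' y + dist x y" unfolding \<rho>_def by (rule dist_triangle2)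
      then show ?thesis using that e by (intro mult_left_mono) (auto simp: dist_norm)
    qed
    finally show ?thesis .
  qed
  obtain m where m: "m \<in> zero_near Q" "dist x m < k"
    using x(2) k(1) by (auto simp: closure_approachable dist_commute)
  have "x' \<in> zero_near Q"
  proof -
    have "open {y. \<bar>(y - m) \<bullet> u0\<bar> < e * norm (y - m)}"
      by (intro open_Collect_less continuous_intros)
    then have "open ({y. \<bar>(y - m) \<bullet> u0\<bar> < e * norm (y - m)} \<inter> ball x e)" by auto
    moreover have "x' \<in> {y. \<bar>(y - m) \<bullet> u0\<bar> < e * norm (y - m)} \<inter> ball x e"
      using sep[OF m(2)] x'(4) by (simp add: dist_commute)
    ultimately obtain j where j: "j > 0"
      "ball x' j \<subseteq> {y. \<bar>(y - m) \<bullet> u0\<bar> < e * norm (y - m)} \<inter> ball x e"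
      using open_contains_ball by blast
    have "Q y = 0" if y: "y \<in> frontier K \<inter> ball x' j" for y
    proof (rule zero[OF _ m(1)])
      have *: "\<bar>(y - m) \<bullet> u0\<bar> < e * norm (y - m)" "dist x y < e" using y j(2) by auto
      then show "\<bar>(y - m) \<bullet> u0\<bar> \<le> e * norm (y - m)" "dist x y < e" "y \<noteq> m" by auto
      show "dist x m < e" using m(2) k(2) by simp
    qed (use y in simp)
    then show ?thesis unfolding zero_near_def using x'(1) j(1) by blast
  qed
  moreover have "Q y = 0" if y: "y \<in> frontier K \<inter> ball x k" for y
  proof (rule zero[OF _ \<open>x' \<in> zero_near Q\<close>])
    have *: "\<bar>(x' - y) \<bullet> u0\<bar> < e * norm (x' - y)" using sep y by simp
    then show "y \<noteq> x'" by auto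
    have "(y - x') \<bullet> u0 = - ((x' - y) \<bullet> u0)" by (simp add: inner_diff_left)
    then show "\<bar>(y - x') \<bullet> u0\<bar> \<le> e * norm (y - x')" using * by (simp add: norm_minus_commute)
    show "dist x y < e" using y k(2) by simp
    show "dist x x' < e" using x'(4) by (simp add: dist_commute)
  qed (use y in simp)
  ultimately show ?thesis unfolding zero_near_def using xfr k(1) by blast
qed

text \<open>Points \<open>a\<close> inside and \<open>b\<close> outside \<open>K\<close>, symmetric
  about \<open>x\<close> at its height, stay inside and outside when both are shifted to height
  \<open>t\<close>; the boundary crosses the shifted segment.\<close>

lemma level_nearby:
  assumes "x \<in> beyond u" "u \<noteq> 0" "e > 0"
  obtains k where "k > 0"
    "\<And>t. \<bar>t - x \<bullet> u\<bar> < k \<Longrightarrow> \<exists>y\<in>frontier K. y \<bullet> u = t \<and> dist y x < e"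
proof -
  obtain w where w: "w \<in> interior K" "w \<bullet> u = x \<bullet> u" by (rule beyond_level[OF assms(1,2)])
  have xfr: "x \<in> frontier K" using assms(1) by (auto simp: beyond_def)
  define h where "h = min (1/2) (e / (2 * (norm (w - x) + 1)))"
  have h: "h > 0" using assms(3) by (auto simp: h_def add_nonneg_pos)
  have h2: "h \<le> 1/2" unfolding h_def by (rule min.cobounded1)
  have hw: "h * norm (w - x) \<le> e / 2"
  proof -
    have "h * norm (w - x) \<le> (e / (2 * (norm (w - x) + 1))) * norm (w - x)"
      by (intro mult_right_mono) (auto simp: h_def)
    also have "\<dots> = (e / 2) * (norm (w - x) / (norm (w - x) + 1))" by simp
    also have "\<dots> \<le> (e / 2) * 1"
      using assms(3) by (intro mult_left_mono) (auto simp: pos_divide_le_eq add_nonneg_pos)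
    finally show ?thesis by simp
  qed
  define a b where "a = x + h *\<^sub>R (w - x)" and "b = x - h *\<^sub>R (w - x)"
  have "w + (1 - h) *\<^sub>R (x - w) \<in> interior K"
    using h h2 frontier_in_K[OF xfr] by (intro interior_segment[OF conv w(1)]) auto
  then have a: "a \<in> interior K" by (simp add: a_def algebra_simps)
  have b: "b \<in> - K"
  proof (rule ccontr)
    assume "b \<notin> - K"
    then have "a + (1/2) *\<^sub>R (b - a) \<in> interior K"
      by (intro interior_segment[OF conv a]) auto
    moreover have "b - a = - (2 * h) *\<^sub>R (w - x)"
      by (simp add: a_def b_def algebra_simps flip: scaleR_add_left)
    then have "a + (1/2) *\<^sub>R (b - a) = x" by (simp add: a_def)
    ultimately show False using xfr by (simp add: frontier_K)
  qed
  have lev: "a \<bullet> u = x \<bullet> u" "b \<bullet> u = x \<bullet> u" using w(2) by (simp_all add: a_def b_def inner_add_left inner_diff_left)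
  obtain k1 where k1: "k1 > 0" "ball a k1 \<subseteq> interior K" using a open_contains_ball[of "interior K"] by auto
  obtain k2 where k2: "k2 > 0" "ball b k2 \<subseteq> - K" using b closed open_contains_ball[of "- K"] by auto
  define k where "k = min (min k1 k2) (e / 2) * norm u"
  have "k > 0" using k1(1) k2(1) assms(2,3) by (simp add: k_def)
  moreover have "\<exists>y\<in>frontier K. y \<bullet> u = t \<and> dist y x < e" if t: "\<bar>t - x \<bullet> u\<bar> < k" for t
  proof -
    define v where "v = ((t - x \<bullet> u) / (u \<bullet> u)) *\<^sub>R u"
    have vu: "v \<bullet> u = t - x \<bullet> u" using assms(2) by (simp add: v_def)
    have "norm v = \<bar>t - x \<bullet> u\<bar> / norm u"
      using assms(2) by (simp add: v_def abs_mult dot_square_norm power2_eq_square)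
    then have nv: "norm v < min (min k1 k2) (e / 2)"
      using t assms(2) unfolding k_def by (metis pos_divide_less_eq zero_less_norm_iff)
    have "a + v \<in> ball a k1" "b + v \<in> ball b k2" using nv by (simp_all add: dist_norm)
    then have av: "a + v \<in> interior K" "b + v \<notin> interior K" using k1(2) k2(2) interior_in_K by blast+
    obtain r where r: "0 < r" "r \<le> 1" "(a + v) + r *\<^sub>R ((b + v) - (a + v)) \<in> frontier K"
      by (rule frontier_on_segment[OF closed av]) (rule that)
    let ?y = "(a + v) + r *\<^sub>R ((b + v) - (a + v))"
    have "?y \<bullet> u = t" using lev vu by (simp add: inner_add_left inner_diff_left)
    moreover have "dist ?y x < e"
    proof -
      have "((x - c) + v) - ((x + c) + v) = (- 2) *\<^sub>R c" for c
        by (simp add: scaleR_2)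
      then have "((x + c) + v) + r *\<^sub>R (((x - c) + v) - ((x + c) + v)) - x
          = (1 - 2 * r) *\<^sub>R c + v" for c
        by (simp add: scaleR_left_diff_distrib mult.commute)
      then have eq: "?y - x = (1 - 2 * r) *\<^sub>R (h *\<^sub>R (w - x)) + v" unfolding a_def b_def .
      have "norm ((1 - 2 * r) *\<^sub>R (h *\<^sub>R (w - x))) \<le> 1 * norm (h *\<^sub>R (w - x))"
        unfolding norm_scaleR[of "1 - 2 * r"] using r(1,2) by (intro mult_right_mono) auto
      also have "\<dots> \<le> e / 2" using hw h by simp
      finally have "norm (?y - x) \<le> e / 2 + norm v"
        unfolding eq using norm_triangle_ineq[of "(1 - 2 * r) *\<^sub>R (h *\<^sub>R (w - x))" v] by linarith
      then show ?thesis using nv by (simp add: dist_norm)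
    qed
    ultimately show ?thesis using r(3) by blast
  qed
  ultimately show thesis using that by blast
qed

text \<open>The level is the relative boundary of a bounded convex set of dimension at least two; in
  dimension one it could be a pair of points.\<close>

lemma connected_level:
  assumes "u \<in> W" "w \<in> interior K" "w \<bullet> u = t"
  shows "connected {x \<in> frontier K. x \<bullet> u = t}"
proof -
  let ?L = "{x. u \<bullet> x = t}"
  have nz: "u \<noteq> 0" by (rule W_nz[OF assms(1)])
  have ne: "interior K \<inter> ?L \<noteq> {}" using assms(2,3) by (auto simp: inner_commute)
  have "bounded (K \<inter> ?L)"
    by (rule bounded_subset[OF bounded_slab[OF W_interior[OF assms(1)], of t]]) (auto simp: inner_commute)
  moreover have "aff_dim (?L \<inter> K) = aff_dim ?L"
    using ne by (intro aff_dim_convex_Int_nonempty_interior) (auto simp: convex_hyperplane)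
  then have "aff_dim (K \<inter> ?L) \<noteq> 1" using nz dim by (simp add: Int_commute)
  moreover have "convex (K \<inter> ?L)" using conv by (intro convex_Int convex_hyperplane)
  ultimately have "connected (rel_frontier (K \<inter> ?L))" using connected_sphere_gen by blast
  moreover have "rel_frontier (K \<inter> ?L) = frontier K \<inter> ?L"
    by (rule convex_affine_rel_frontier_Int[OF conv affine_hyperplane ne])
  moreover have "frontier K \<inter> ?L = {x \<in> frontier K. x \<bullet> u = t}" by (auto simp: inner_commute)
  ultimately show ?thesis by simp
qed

lemma frontier_point_on_level:
  assumes "u \<in> W" "w \<in> interior K"
  obtains x where "x \<in> frontier K" "x \<bullet> u = w \<bullet> u"
proof -
  obtain d where d: "norm d = 1" "d \<bullet> u = 0" using exists_orthogonal_unit[OF dim] by metis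
  then have "d \<noteq> 0" by auto
  then obtain t where "w + t *\<^sub>R d \<in> frontier K"
    by (rule line_frontier_points[OF W_interior[OF assms(1)] d(2) _ assms(2)]) (rule that)
  then show thesis using d(2) by (intro that[of "w + t *\<^sub>R d"]) (auto simp: inner_add_left)
qed

text \<open>On each level \<open>zero_near Q\<close> is relatively open and closed, so the connected
  level lies wholly inside or outside it. The heights of either kind form an open set, because
  nearby levels have points near a given one. As the heights form an interval, only one kind
  occurs.\<close>

lemma zero_near_beyond:
  assumes Q: "quadratic Q" and u: "u \<in> W" and x0: "x0 \<in> beyond u" "x0 \<in> zero_near Q"
  shows "beyond u \<subseteq> zero_near Q"
proof -
  let ?M = "zero_near Q"
  have nz: "u \<noteq> 0" by (rule W_nz[OF u])
  define S where "S = (\<lambda>t. {x \<in> frontier K. x \<bullet> u = t})"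
  define I where "I = {t. t < D u \<and> (\<exists>y\<in>interior K. y \<bullet> u < t)}"
  have SI: "x \<in> beyond u \<longleftrightarrow> x \<in> frontier K \<and> x \<bullet> u \<in> I" for x
    unfolding beyond_def I_def by blast
  have "I = {..<D u} \<inter> (\<Union>y\<in>interior K. {y \<bullet> u<..})" by (auto simp: I_def)
  then have openI: "open I" by (metis open_Int open_UN open_greaterThan open_lessThan)
  have "is_interval I" unfolding is_interval_1 I_def by force
  then have connI: "connected I" by (simp add: is_interval_connected_1)
  have lvl: "\<exists>w\<in>interior K. w \<bullet> u = t" if tI: "t \<in> I" for t
  proof -
    obtain y where y: "y \<in> interior K" "y \<bullet> u \<le> t" using tI by (force simp: I_def)
    obtain z where z: "z \<in> interior K" "t \<le> z \<bullet> u" using meets[OF nz] tI by (force simp: I_def)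
    show ?thesis by (rule level_interior[OF y(1) z(1) y(2) z(2)]) blast
  qed
  obtain G where G: "open G" "?M = frontier K \<inter> G" using zero_near_eq by blast
  have dich: "S t \<subseteq> ?M \<or> S t \<inter> ?M = {}" if t: "t \<in> I" for t
  proof -
    obtain w where w: "w \<in> interior K" "w \<bullet> u = t" using lvl[OF t] by blast
    have conn: "connected (S t)" unfolding S_def by (rule connected_level[OF u w])
    have "S t \<inter> ?M = S t \<inter> G" using G(2) by (auto simp: S_def)
    then have "openin (top_of_set (S t)) (S t \<inter> ?M)" using G(1) by (simp add: openin_open_Int)
    moreover have "S t \<inter> ?M = S t \<inter> closure ?M"
      using zero_near_closed_beyond[OF Q u] closure_subset[of ?M] SI t by (auto simp: S_def)
    then have "closedin (top_of_set (S t)) (S t \<inter> ?M)" by (simp add: closedin_closed_Int)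
    ultimately have "S t \<inter> ?M = {} \<or> S t \<inter> ?M = S t"
      using conn unfolding connected_clopen by blast
    then show ?thesis by blast
  qed
  define J where "J = {t \<in> I. S t \<inter> ?M \<noteq> {}}"
  have near: "\<exists>T. open T \<and> t \<in> T \<and> T \<subseteq> I \<and> (\<forall>t'\<in>T. \<exists>y\<in>S t'. dist y x < e)"
    if t: "t \<in> I" "x \<in> S t" "e > 0" for t x and e :: real
  proof -
    have x: "x \<in> beyond u" "x \<bullet> u = t" using t SI by (auto simp: S_def)
    obtain k where k: "k > 0" "\<And>t'. \<bar>t' - x \<bullet> u\<bar> < k \<Longrightarrow> \<exists>y\<in>frontier K. y \<bullet> u = t' \<and> dist y x < e"
      by (rule level_nearby[OF x(1) nz t(3)]) (rule that)
    have "\<exists>y\<in>S t'. dist y x < e" if "t' \<in> ball t k" for t'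
      using k(2)[of t'] that x(2) by (auto simp: S_def dist_real_def abs_minus_commute)
    then show ?thesis using openI k(1) t(1) by (intro exI[of _ "I \<inter> ball t k"]) auto
  qed
  have "open J"
  proof (subst open_subopen, intro ballI)
    fix t assume "t \<in> J"
    then obtain x where x: "t \<in> I" "x \<in> S t" "x \<in> G" using G(2) by (auto simp: J_def)
    obtain e where e: "e > 0" "ball x e \<subseteq> G" using G(1) x(3) open_contains_ball by blast
    obtain T where T: "open T" "t \<in> T" "T \<subseteq> I" "\<And>t'. t' \<in> T \<Longrightarrow> \<exists>y\<in>S t'. dist y x < e"
      using near[OF x(1,2) e(1)] by blast
    have "T \<subseteq> J"
    proof
      fix t' assume t': "t' \<in> T"
      then obtain y where "y \<in> S t'" "dist y x < e" using T(4) by blast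
      then have "y \<in> S t' \<inter> ?M" using e(2) G(2) by (auto simp: S_def dist_commute)
      then show "t' \<in> J" using t' T(3) by (auto simp: J_def)
    qed
    then show "\<exists>T. open T \<and> t \<in> T \<and> T \<subseteq> J" using T by blast
  qed
  moreover have "open (I - J)"
  proof (subst open_subopen, intro ballI)
    fix t assume t: "t \<in> I - J"
    then obtain w where w: "w \<in> interior K" "w \<bullet> u = t" using lvl by blast
    obtain x where x: "x \<in> S t" by (rule frontier_point_on_level[OF u w(1)]) (auto simp: S_def w(2))
    then have "x \<notin> ?M" "x \<in> beyond u" using t SI by (auto simp: J_def S_def)
    then have "x \<notin> closure ?M" using zero_near_closed_beyond[OF Q u] by blast
    then obtain e where e: "e > 0" "\<And>y. dist y x < e \<Longrightarrow> y \<notin> ?M"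
      by (auto simp: closure_approachable)
    obtain T where T: "open T" "t \<in> T" "T \<subseteq> I" "\<And>t'. t' \<in> T \<Longrightarrow> \<exists>y\<in>S t'. dist y x < e"
      using near[of t x e] t x e(1) by blast
    have "T \<subseteq> I - J"
    proof
      fix t' assume t': "t' \<in> T"
      then obtain y where "y \<in> S t'" "y \<notin> ?M" using T(4) e(2) by blast
      then show "t' \<in> I - J" using t' T(3) dich[of t'] by (auto simp: J_def)
    qed
    then show "\<exists>T. open T \<and> t \<in> T \<and> T \<subseteq> I - J" using T by blast
  qed
  moreover have "x0 \<bullet> u \<in> J" using x0 SI by (auto simp: J_def S_def)
  moreover have "J \<subseteq> I" by (auto simp: J_def)
  ultimately have "I - J = {}"
    using connectedD[OF connI, of J "I - J"] by blast
  show ?thesis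
  proof
    fix x assume "x \<in> beyond u"
    then have "x \<in> S (x \<bullet> u)" "x \<bullet> u \<in> I" using SI by (auto simp: S_def)
    then show "x \<in> ?M" using \<open>I - J = {}\<close> dich[of "x \<bullet> u"] by (auto simp: J_def)
  qed
qed

text \<open>A boundary point strictly below the plane of \<open>u\<close> and above some interior
  point keeps both properties for all normals near \<open>u\<close>. The regions of nearby normals
  thus share a point, and \<open>W\<close> is connected.\<close>

lemma zero_near_all_beyond:
  assumes Q: "quadratic Q" and u1: "u1 \<in> W" and x1: "x1 \<in> beyond u1" "x1 \<in> zero_near Q"
    and u2: "u2 \<in> W"
  shows "beyond u2 \<subseteq> zero_near Q"
proof (rule connected_induction_simple[OF connected_W u1 u2, where P = "\<lambda>u. beyond u \<subseteq> zero_near Q"])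
  show "beyond u1 \<subseteq> zero_near Q" by (rule zero_near_beyond[OF Q u1 x1])
  fix u assume u: "u \<in> W"
  have nz: "u \<noteq> 0" by (rule W_nz[OF u])
  obtain p where p: "p \<in> interior K" "p \<bullet> u = D u" using meets[OF nz] by blast
  obtain q where q: "q \<in> interior K" "q \<bullet> u < p \<bullet> u" using lower_interior_point[OF p(1) nz] by blast
  obtain y where y: "y \<in> interior K" "y \<bullet> u < q \<bullet> u" using lower_interior_point[OF q(1) nz] by blast
  obtain x where x: "x \<in> frontier K" "x \<bullet> u = q \<bullet> u" by (rule frontier_point_on_level[OF u q(1)])
  have "\<forall>\<^sub>F v in nhds u. x \<bullet> v < D v" by (rule below_near[OF nz]) (use x p q in simp)
  moreover have "((\<lambda>v. x \<bullet> v - y \<bullet> v) \<longlongrightarrow> x \<bullet> u - y \<bullet> u) (nhds u)"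
    by (intro tendsto_intros) (simp_all add: filterlim_ident)
  then have "\<forall>\<^sub>F v in nhds u. 0 < x \<bullet> v - y \<bullet> v" by (rule order_tendstoD) (use x y in simp)
  ultimately have "\<forall>\<^sub>F v in nhds u. x \<bullet> v < D v \<and> 0 < x \<bullet> v - y \<bullet> v" by eventually_elim blast
  then obtain T where T: "open T" "u \<in> T" "\<And>v. v \<in> T \<Longrightarrow> x \<bullet> v < D v \<and> 0 < x \<bullet> v - y \<bullet> v"
    unfolding eventually_nhds by blast
  have xT: "x \<in> beyond v" if "v \<in> T" for v
    using T(3)[OF that] x(1) y(1) unfolding beyond_def by force
  show "\<exists>T. openin (top_of_set W) T \<and> u \<in> T \<and>
      (\<forall>v\<in>T. \<forall>w\<in>T. beyond v \<subseteq> zero_near Q \<longrightarrow> beyond w \<subseteq> zero_near Q)"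
  proof (intro exI[of _ "W \<inter> T"] conjI ballI impI)
    show "openin (top_of_set W) (W \<inter> T)" using T(1) by (simp add: openin_open_Int)
    show "u \<in> W \<inter> T" using u T(2) by simp
    fix v w assume "v \<in> W \<inter> T" "w \<in> W \<inter> T" "beyond v \<subseteq> zero_near Q"
    then show "beyond w \<subseteq> zero_near Q" using zero_near_beyond[OF Q, of w x] xT by blast
  qed
qed


section \<open>Unbounded sections\<close>

lemma interior_barrier_scale:
  assumes "t *\<^sub>R u \<in> interior barrier" "t > 0"
  shows "u \<in> interior barrier"
proof -
  obtain e where e: "e > 0" "ball (t *\<^sub>R u) e \<subseteq> barrier" using assms(1) mem_interior by blast
  have "y \<in> barrier" if "dist u y < e / t" for y
  proof -
    have "dist (t *\<^sub>R u) (t *\<^sub>R y) < e"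
      using that assms(2) by (simp add: dist_norm pos_less_divide_eq mult.commute flip: scaleR_diff_right)
    then have "t *\<^sub>R y \<in> barrier" using e(2) by auto
    then have "(1 / t) *\<^sub>R (t *\<^sub>R y) \<in> barrier" by (rule barrier_scale) (use assms(2) in simp)
    then show ?thesis using assms(2) by simp
  qed
  then show ?thesis unfolding mem_interior using e(1) assms(2) by (intro exI[of _ "e / t"]) auto
qed

text \<open>Otherwise 0, the midpoint of \<open>u\<close> and \<open>- u\<close>, would be interior.
  The condition on 0 expresses that \<open>K\<close> is unbounded.\<close>

lemma not_both_interior_barrier:
  assumes "0 \<notin> interior barrier" "u \<in> interior barrier"
  shows "- u \<notin> barrier"
proof
  assume "- u \<in> barrier"
  then have "u + (1/2) *\<^sub>R (- u - u) \<in> interior barrier"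
    by (intro interior_segment[OF convex_barrier assms(2)]) auto
  moreover have "u + (1/2) *\<^sub>R (- u - u) = 0" by (simp add: algebra_simps flip: scaleR_add_left)
  ultimately show False using assms(1) by simp
qed

lemma no_minimum:
  assumes "0 \<notin> interior barrier" "u \<in> W"
  obtains y where "y \<in> interior K" "y \<bullet> u < c"
proof (rule ccontr)
  assume "\<not> thesis"
  then have "interior K \<subseteq> {y. c \<le> u \<bullet> y}" using that by (force simp: inner_commute)
  then have "closure (interior K) \<subseteq> {y. c \<le> u \<bullet> y}" using closed_halfspace_ge by (rule closure_minimal)
  then have "\<forall>y\<in>K. y \<bullet> (- u) \<le> - c" using closure_interior_K by (auto simp: inner_commute)
  then have "- u \<in> barrier" unfolding barrier_def by blast
  then show False using not_both_interior_barrier[OF assms(1) W_interior[OF assms(2)]] by simp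
qed

lemma open_above: "open {u. u \<noteq> 0 \<and> D u < x \<bullet> u}"
proof -
  have "open ((- {0}) \<inter> (\<lambda>u. x \<bullet> u - D u) -` {0<..})"
    by (intro continuous_open_preimage continuous_intros cont)
  also have "(- {0}) \<inter> (\<lambda>u. x \<bullet> u - D u) -` {0<..} = {u. u \<noteq> 0 \<and> D u < x \<bullet> u}" by auto
  finally show ?thesis .
qed

lemma open_below: "open {u. u \<noteq> 0 \<and> x \<bullet> u < D u}"
proof -
  have "open ((- {0}) \<inter> (\<lambda>u. D u - x \<bullet> u) -` {0<..})"
    by (intro continuous_open_preimage continuous_intros cont)
  also have "(- {0}) \<inter> (\<lambda>u. D u - x \<bullet> u) -` {0<..} = {u. u \<noteq> 0 \<and> x \<bullet> u < D u}" by auto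
  finally show ?thesis .
qed

lemma connected_nonzero: "connected (UNIV - {0 :: 'a})"
  using dim by (intro connected_open_delete) auto

text \<open>Here every nonzero normal is in \<open>W\<close>. The normals whose plane lies above
  \<open>x\<close> and those at which \<open>x\<close> is not lowest form two open sets covering the
  nonzero vectors. For an outer normal \<open>v\<close> at \<open>x\<close>, \<open>- v\<close> is
  in the first and \<open>v\<close> in the second, so the sets intersect.\<close>

lemma beyond_exists_if_bounded:
  assumes "0 \<in> interior barrier" "x \<in> frontier K"
  obtains u where "u \<in> W" "x \<in> beyond u"
proof (rule ccontr)
  assume no: "\<not> thesis"
  obtain e where e: "e > 0" "cball 0 e \<subseteq> barrier" using assms(1) mem_interior_cball by blast
  have "u \<in> barrier" for u
  proof (cases "u = 0")
    case False
    have "(e / norm u) *\<^sub>R u \<in> barrier" using e False by (auto simp: subset_iff)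
    then have "(norm u / e) *\<^sub>R ((e / norm u) *\<^sub>R u) \<in> barrier" by (rule barrier_scale) (use e in simp)
    then show ?thesis using e(1) False by simp
  qed (auto simp: barrier_def intro: exI[of _ 0])
  then have "barrier = UNIV" by blast
  then have W: "W = UNIV - {0}" by (simp add: W_def)
  let ?X1 = "{u. u \<noteq> 0 \<and> x \<bullet> u < D u}"
  let ?X2 = "(UNIV - {0}) \<inter> (\<Union>y\<in>interior K. {u. y \<bullet> u < x \<bullet> u})"
  have "open {u. y \<bullet> u < x \<bullet> u}" for y by (intro open_Collect_less continuous_intros)
  then have "open (\<Union>y\<in>interior K. {u. y \<bullet> u < x \<bullet> u})" by blast
  then have "open ?X2" by (intro open_Int open_delete open_UNIV)
  moreover have "?X1 \<inter> ?X2 = {}"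
    using no that assms(2) W by (force simp: beyond_def)
  moreover have "UNIV - {0} \<subseteq> ?X1 \<union> ?X2"
  proof
    fix u :: 'a assume "u \<in> UNIV - {0}"
    then have nz: "u \<noteq> 0" by simp
    obtain p where p: "p \<in> interior K" "p \<bullet> u = D u" using meets[OF nz] by blast
    obtain y where "y \<in> interior K" "y \<bullet> u < p \<bullet> u" using lower_interior_point[OF p(1) nz] by blast
    then show "u \<in> ?X1 \<union> ?X2" using nz p(2) by (cases "y \<bullet> u < x \<bullet> u") auto
  qed
  moreover obtain v where v: "norm v = 1" "\<And>y. y \<in> K \<Longrightarrow> y \<bullet> v \<le> x \<bullet> v"
    by (rule frontier_normal[OF assms(2)]) (rule that)
  then have vnz: "v \<noteq> 0" by auto
  obtain p where p: "p \<in> interior K" using interior_ne by blast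
  have "v \<in> ?X2" using interior_strict[OF p vnz v(2)] p vnz by auto
  moreover obtain p' where p': "p' \<in> interior K" "p' \<bullet> (- v) = D (- v)" using meets[of "- v"] vnz by auto
  have "- v \<in> ?X1" using interior_strict[OF p'(1) vnz v(2)] p'(2) vnz by simp
  ultimately show False
    using connectedD[OF connected_nonzero open_below[of x], of ?X2] vnz by blast
qed

text \<open>If no such normal existed, the normals with \<open>x\<close> strictly above the plane
  together with \<open>W\<close>, and those with \<open>x\<close> strictly below together with the
  negatives of \<open>W\<close>, would disconnect the nonzero vectors; the inequalities make the two
  sets disjoint.\<close>

lemma plane_outside_W:
  assumes W0: "0 \<notin> interior barrier"
    and ge: "\<And>u. u \<in> W \<Longrightarrow> D u \<le> x \<bullet> u" "\<And>u. u \<in> W \<Longrightarrow> x \<bullet> (- u) \<le> D (- u)"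
  obtains u where "u \<noteq> 0" "x \<bullet> u = D u" "u \<notin> W" "- u \<notin> W"
proof (rule ccontr)
  assume no: "\<not> thesis"
  let ?X1 = "{u. u \<noteq> 0 \<and> D u < x \<bullet> u} \<union> W" and ?X2 = "{u. u \<noteq> 0 \<and> x \<bullet> u < D u} \<union> uminus ` W"
  have "open ?X1" "open ?X2" using open_above open_below open_W by (auto intro: open_negations)
  moreover have "W \<inter> uminus ` W = {}"
    using not_both_interior_barrier[OF W0] interior_subset[of barrier] by (auto simp: W_def)
  then have "?X1 \<inter> ?X2 = {}" using ge by force
  moreover have "UNIV - {0} \<subseteq> ?X1 \<union> ?X2"
  proof
    fix u :: 'a assume "u \<in> UNIV - {0}"
    then have nz: "u \<noteq> 0" by simp
    consider "D u < x \<bullet> u" | "x \<bullet> u < D u" | "x \<bullet> u = D u" by linarith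
    then show "u \<in> ?X1 \<union> ?X2"
    proof cases
      case 3
      then have "u \<in> W \<or> - u \<in> W" using no that nz by blast
      moreover have "u \<in> uminus ` W" if "- u \<in> W" using that by (rule image_eqI[rotated]) simp
      ultimately show ?thesis by blast
    qed (use nz in auto)
  qed
  moreover obtain w where "w \<in> W" using W_ne by blast
  then have "w \<in> ?X1" "- w \<in> ?X2" "w \<in> UNIV - {0}" "- w \<in> UNIV - {0}" using W_nz by auto
  ultimately show False using connectedD[OF connected_nonzero, of ?X1 ?X2] by blast
qed

text \<open>The line spanned by \<open>u\<close> misses the open cone \<open>W\<close> and is
  separated from it. The separating normal \<open>r\<close> is orthogonal to \<open>u\<close> and
  polar to \<open>barrier\<close>, hence a recession direction of \<open>K\<close>.\<close>

lemma recession_in_plane: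
  assumes W0: "0 \<notin> interior barrier" and u: "u \<noteq> 0" "u \<notin> W" "- u \<notin> W"
  obtains r where "r \<bullet> u = 0" "\<And>w. w \<in> W \<Longrightarrow> w \<bullet> r < 0" "\<And>x t. x \<in> K \<Longrightarrow> t \<ge> 0 \<Longrightarrow> x + t *\<^sub>R r \<in> K"
proof -
  have W: "W = interior barrier" using W0 by (auto simp: W_def)
  have "interior barrier \<inter> span {u} = {}"
  proof (rule ccontr)
    assume "interior barrier \<inter> span {u} \<noteq> {}"
    then obtain k where k: "k *\<^sub>R u \<in> interior barrier" by (auto simp: span_singleton)
    consider "k = 0" | "k > 0" | "k < 0" by linarith
    then show False
    proof cases
      case 3
      then have "(- k) *\<^sub>R (- u) \<in> interior barrier" using k by simp
      then show ?thesis using interior_barrier_scale 3 u(3) W by (metis neg_0_less_iff_less)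
    qed (use k W0 interior_barrier_scale u(2) W in auto)
  qed
  then obtain r b where r: "r \<noteq> 0" "\<And>w. w \<in> interior barrier \<Longrightarrow> r \<bullet> w \<le> b"
      "\<And>w. w \<in> span {u} \<Longrightarrow> b \<le> r \<bullet> w"
    using separating_hyperplane_sets[OF convex_interior_barrier subspace_imp_convex[OF subspace_span[of "{u}"]] interior_barrier_ne]
    by (metis span_zero empty_iff)
  have "b \<le> 0" using r(3)[OF span_zero] by simp
  \<comment> \<open>A linear functional bounded below on a line through 0 vanishes there.\<close>
  have "r \<bullet> u = 0"
  proof (rule ccontr)
    assume ru: "r \<bullet> u \<noteq> 0"
    have "b \<le> r \<bullet> (((b - 1) / (r \<bullet> u)) *\<^sub>R u)" by (rule r(3)) (simp add: span_base span_mul)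
    then show False using ru by simp
  qed
  have int0: "r \<bullet> w \<le> 0" if "w \<in> interior barrier" for w using r(2)[OF that] \<open>b \<le> 0\<close> by linarith
  then have "interior barrier \<subseteq> {w. r \<bullet> w \<le> 0}" by blast
  then have "closure (interior barrier) \<subseteq> {w. r \<bullet> w \<le> 0}" using closed_halfspace_le by (rule closure_minimal)
  then have bar: "w \<bullet> r \<le> 0" if "w \<in> barrier" for w
    using that closure_subset[of barrier] convex_closure_interior[OF convex_barrier interior_barrier_ne]
    by (auto simp: inner_commute)
  have "w \<bullet> r < 0" if w: "w \<in> W" for w
  proof -
    obtain e where e: "e > 0" "cball w e \<subseteq> barrier" using W_interior[OF w] mem_interior_cball by blast
    have "w + (e / norm r) *\<^sub>R r \<in> cball w e" using e(1) r(1) by (simp add: dist_norm)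
    then have "(w + (e / norm r) *\<^sub>R r) \<bullet> r \<le> 0" using e(2) bar by blast
    moreover have "(e / norm r) * (r \<bullet> r) > 0" using e(1) r(1) by simp
    ultimately show ?thesis by (simp add: inner_add_left)
  qed
  moreover have "x + t *\<^sub>R r \<in> K" if "x \<in> K" "t \<ge> 0" for x t
    by (rule recession_if_polar[OF bar that])
  ultimately show thesis using that \<open>r \<bullet> u = 0\<close> by blast
qed

text \<open>A plane whose normal lies outside \<open>W\<close> and \<open>- W\<close> cuts \<open>K\<close> in an unbounded set; far out,
  chords of the section end in the region already known to lie on the quadric.\<close>

lemma unbounded_section_on_quadric:
  assumes Q: "quadratic Q" and all: "\<And>w. w \<in> W \<Longrightarrow> beyond w \<subseteq> zero_near Q"
    and W0: "0 \<notin> interior barrier" and u: "u \<noteq> 0" "u \<notin> W" "- u \<notin> W"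
    and x: "x \<in> frontier K" "x \<bullet> u = D u"
  shows "Q x = 0"
proof -
  obtain r where r: "r \<bullet> u = 0" "\<And>w. w \<in> W \<Longrightarrow> w \<bullet> r < 0" "\<And>x t. x \<in> K \<Longrightarrow> t \<ge> 0 \<Longrightarrow> x + t *\<^sub>R r \<in> K"
    by (rule recession_in_plane[OF W0 u]) (rule that)
  obtain q y0 where q: "quadratic q" "\<And>x. x \<in> frontier K \<Longrightarrow> x \<bullet> u = D u \<Longrightarrow> q x = 0"
      "y0 \<bullet> u = D u" "q y0 \<noteq> 0"
    using sect[OF u(1)] by blast
  obtain z0 where z0: "z0 \<in> interior K" "z0 \<bullet> u = D u" using meets[OF u(1)] by blast
  obtain w0 where w0: "w0 \<in> W" using W_ne by blast
  have w0r: "r \<bullet> w0 < 0" using r(2)[OF w0] by (simp add: inner_commute)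
  have w0nz: "w0 \<noteq> 0" by (rule W_nz[OF w0])
  obtain d0 where d0: "norm d0 = 1" "d0 \<bullet> u = 0" "d0 \<bullet> w0 = 0" using exists_orthogonal_unit[OF dim] by blast
  have d0nz: "d0 \<noteq> 0" using d0(1) by auto
  \<comment> \<open>Moving along \<open>r\<close> by \<open>s\<close> lowers the height over
    \<open>w0\<close> by the distance to \<open>D w0\<close> plus 1, which puts \<open>z\<close>
    strictly below the plane of \<open>w0\<close>.\<close>
  define s where "s = (\<bar>z0 \<bullet> w0 - D w0\<bar> + 1) / (- (r \<bullet> w0))"
  have s: "s > 0" using w0r by (simp add: s_def divide_pos_neg)
  define z where "z = z0 + s *\<^sub>R r"
  have "s * (r \<bullet> w0) = - (\<bar>z0 \<bullet> w0 - D w0\<bar> + 1)" using w0r by (simp add: s_def)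
  then have zw: "z \<bullet> w0 < D w0" by (simp add: z_def inner_add_left)
  have zu: "z \<bullet> u = D u" using z0 r(1) by (simp add: z_def inner_add_left)
  \<comment> \<open>Twice the step makes \<open>z\<close> a midpoint between the interior point
    \<open>z0\<close> and a point of \<open>K\<close>.\<close>
  have "z0 + (2 * s) *\<^sub>R r \<in> K" using r(3) z0 interior_in_K s by simp
  then have "z0 + (1/2) *\<^sub>R ((z0 + (2 * s) *\<^sub>R r) - z0) \<in> interior K"
    by (intro interior_segment[OF conv z0(1)]) auto
  then have zi: "z \<in> interior K" by (simp add: z_def)
  \<comment> \<open>Projecting \<open>w0\<close> off \<open>d\<close> gives a normal whose level
    through \<open>z\<close> contains the chord along \<open>d\<close>. Near \<open>d0\<close> it
    stays in \<open>W\<close> with \<open>z\<close> below its plane, so the ends of the chord lie in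
    \<open>beyond\<close>.\<close>
  let ?pr = "\<lambda>d. w0 - ((w0 \<bullet> d) / (d \<bullet> d)) *\<^sub>R d"
  have lim: "(?pr \<longlongrightarrow> w0) (nhds d0)"
    using d0(3) by (intro projected_direction_tendsto d0nz) (simp add: inner_commute)
  have "\<forall>\<^sub>F d in nhds d0. ?pr d \<in> W" by (rule topological_tendstoD[OF lim open_W w0])
  moreover have "\<forall>\<^sub>F d in nhds d0. z \<bullet> ?pr d < D (?pr d)"
    by (rule eventually_compose_filterlim[OF below_near[OF w0nz zw] lim])
  moreover have "\<forall>\<^sub>F d in nhds d0. d \<noteq> 0" by (rule t1_space_nhds[OF d0nz])
  ultimately have "\<forall>\<^sub>F d in nhds d0. ?pr d \<in> W \<and> z \<bullet> ?pr d < D (?pr d) \<and> d \<noteq> 0" by eventually_elim blast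
  then obtain e where e: "e > 0" "\<And>d. dist d d0 < e \<Longrightarrow> ?pr d \<in> W \<and> z \<bullet> ?pr d < D (?pr d) \<and> d \<noteq> 0"
    unfolding eventually_nhds_metric by blast
  show ?thesis
  proof (rule chord_principle[OF Q q(1) q(3,4) zu d0(2) e(1) _ x(2) q(2)[OF x]])
    fix d assume d: "d \<bullet> u = 0" "norm (d - d0) < e"
    define w where "w = ?pr d"
    have w: "w \<in> W" "z \<bullet> w < D w" "d \<noteq> 0" using e(2)[of d] d(2) by (auto simp: w_def dist_norm)
    have dw: "d \<bullet> w = 0" using w(3) by (simp add: w_def inner_diff_right inner_commute)
    obtain t1 t2 where t: "t1 > 0" "t2 < 0" "z + t1 *\<^sub>R d \<in> frontier K" "z + t2 *\<^sub>R d \<in> frontier K"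
      by (rule line_frontier_points[OF W_interior[OF w(1)] dw w(3) zi]) (rule that)
    have Q0: "Q y = 0" if y: "y \<in> frontier K" "y \<bullet> w = z \<bullet> w" for y
    proof -
      obtain y' where "y' \<in> interior K" "y' \<bullet> w < y \<bullet> w" by (rule no_minimum[OF W0 w(1)])
      then have "y \<in> beyond w" using y w(2) by (auto simp: beyond_def)
      then have "y \<in> zero_near Q" using all[OF w(1)] by blast
      then show ?thesis by (force simp: zero_near_def)
    qed
    have pl: "(z + t *\<^sub>R d) \<bullet> u = D u" "(z + t *\<^sub>R d) \<bullet> w = z \<bullet> w" for t
      using zu d(1) dw by (simp_all add: inner_add_left)
    have "q (z + t1 *\<^sub>R d) = 0" "q (z + t2 *\<^sub>R d) = 0" "Q (z + t1 *\<^sub>R d) = 0" "Q (z + t2 *\<^sub>R d) = 0"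
      using q(2) Q0 t(3,4) pl by blast+
    then show "\<exists>t1 t2. t1 > 0 \<and> t2 < 0 \<and> q (z + t1 *\<^sub>R d) = 0 \<and> q (z + t2 *\<^sub>R d) = 0 \<and>
        Q (z + t1 *\<^sub>R d) = 0 \<and> Q (z + t2 *\<^sub>R d) = 0"
      using t(1,2) by blast
  qed
qed

text \<open>Replacing \<open>D u\<close> by \<open>- D (- u)\<close> permutes the planes of the family.\<close>

lemma mirror: "plane_sections K (\<lambda>u. - D (- u))"
proof
  show "continuous_on (- {0}) (\<lambda>u. - D (- u))"
    by (intro continuous_on_minus continuous_on_compose2[OF cont] continuous_intros) auto
  fix u :: 'a assume "u \<noteq> 0"
  then have nz: "- u \<noteq> 0" by simp
  have eq: "x \<bullet> u = - D (- u) \<longleftrightarrow> x \<bullet> (- u) = D (- u)" for x by auto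
  show "\<exists>p\<in>interior K. p \<bullet> u = - D (- u)" unfolding eq by (rule meets[OF nz])
  show "\<exists>q. quadratic q \<and> (\<forall>x\<in>frontier K. x \<bullet> u = - D (- u) \<longrightarrow> q x = 0) \<and>
      (\<exists>x. x \<bullet> u = - D (- u) \<and> q x \<noteq> 0)" unfolding eq by (rule sect[OF nz])
qed (use dim closed conv no_line in auto)

text \<open>For \<open>u \<in> W\<close> the region \<open>m.beyond u\<close> consists of levels
  below the plane of \<open>- u\<close>, as \<open>beyond u\<close> does for the plane of
  \<open>u\<close>. Points that no region of either kind reaches satisfy the inequalities of
  \<open>plane_outside_W\<close> and lie on an unbounded section.\<close>

lemma frontier_on_quadric:
  obtains Q y where "quadratic Q" "Q y \<noteq> 0" "\<And>x. x \<in> frontier K \<Longrightarrow> Q x = 0"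
proof -
  interpret m: plane_sections K "\<lambda>u. - D (- u)" by (rule mirror)
  obtain Q u1 x1 where Q: "quadratic Q" "\<exists>y. Q y \<noteq> 0" and u1: "u1 \<in> W" "x1 \<in> beyond u1" "x1 \<in> zero_near Q"
    by (rule quadric_start) (rule that)
  have all: "beyond u \<subseteq> zero_near Q" if "u \<in> W" for u
    by (rule zero_near_all_beyond[OF Q(1) u1 that])
  have nz: "u1 \<noteq> 0" by (rule W_nz[OF u1(1)])
  obtain p where p: "p \<in> interior K" "p \<bullet> u1 = D u1" using meets[OF nz] by blast
  obtain p' where p': "p' \<in> interior K" "p' \<bullet> u1 = - D (- u1)" using m.meets[OF nz] by blast
  \<comment> \<open>Below the lower of the two parallel planes there is a boundary point common to
    both regions, which carries \<open>Q\<close> over to the mirrored family.\<close>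
  obtain p0 where p0: "p0 \<in> interior K" "p0 \<bullet> u1 \<le> D u1" "p0 \<bullet> u1 \<le> - D (- u1)"
    using p p' by (metis linear order_refl)
  obtain y0 where y0: "y0 \<in> interior K" "y0 \<bullet> u1 < p0 \<bullet> u1" using lower_interior_point[OF p0(1) nz] by blast
  obtain y1 where y1: "y1 \<in> interior K" "y1 \<bullet> u1 < y0 \<bullet> u1" using lower_interior_point[OF y0(1) nz] by blast
  obtain x2 where x2: "x2 \<in> frontier K" "x2 \<bullet> u1 = y0 \<bullet> u1" by (rule frontier_point_on_level[OF u1(1) y0(1)])
  have "x2 \<in> beyond u1" "x2 \<in> m.beyond u1"
    unfolding beyond_def m.beyond_def using x2 y0(2) y1 p0 by force+
  then have mall: "m.beyond u \<subseteq> zero_near Q" if "u \<in> W" for u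
    using m.zero_near_all_beyond[OF Q(1) u1(1) _ _ that] all[OF u1(1)] by blast
  have zero: "Q x = 0" if "x \<in> zero_near Q" for x using that by (force simp: zero_near_def)
  have "Q x = 0" if x: "x \<in> frontier K" for x
  proof (cases "0 \<in> interior barrier")
    case True
    obtain u where "u \<in> W" "x \<in> beyond u" by (rule beyond_exists_if_bounded[OF True x])
    then show ?thesis using all zero by blast
  next
    case False
    show ?thesis
    proof (cases "\<exists>u\<in>W. x \<in> beyond u \<union> m.beyond u")
      case True
      then show ?thesis using all mall zero by blast
    next
      case no: False
      have "D u \<le> x \<bullet> u" "x \<bullet> (- u) \<le> D (- u)" if u: "u \<in> W" for u
      proof -
        obtain y where y: "y \<in> interior K" "y \<bullet> u < x \<bullet> u" by (rule no_minimum[OF False u])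
        have "x \<notin> beyond u" "x \<notin> m.beyond u" using no u by blast+
        then show "D u \<le> x \<bullet> u" "x \<bullet> (- u) \<le> D (- u)"
          using x y unfolding beyond_def m.beyond_def by force+
      qed
      then obtain u where u: "u \<noteq> 0" "x \<bullet> u = D u" "u \<notin> W" "- u \<notin> W"
        by (rule plane_outside_W[OF False])
      show ?thesis by (rule unbounded_section_on_quadric[OF Q(1) all False u(1,3,4) x u(2)])
    qed
  qed
  then show thesis using that Q by blast
qed

end

section \<open>Cylinders and reduction to the line-free case\<close>

lemma interior_nonempty_if_full_aff_dim:
  fixes K :: "'a::euclidean_space set"
  assumes "convex K" "aff_dim K = int DIM('a)"
  shows "interior K \<noteq> {}"
proof -
  have "K \<noteq> {}" using assms(2) by auto
  then show ?thesis
    using assms rel_interior_eq_empty interior_rel_interior_gen by metis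
qed

theorem theorem2:
  fixes K :: "'a::euclidean_space set" and \<delta> :: "'a \<Rightarrow> real"
  assumes "DIM('a) \<ge> 3"
    and "closed K" and "convex K" and "aff_dim K = int DIM('a)" and "K \<noteq> UNIV"
    and "continuous_on (sphere 0 1) \<delta>"
    and "\<And>u. u \<in> sphere 0 1 \<Longrightarrow>
           {x. x \<bullet> u = \<delta> u} \<subseteq> K \<or>
           convex_quadric_in {x. x \<bullet> u = \<delta> u} ({x. x \<bullet> u = \<delta> u} \<inter> frontier K)"
  shows "convex_quadric (frontier K)"
proof -
  have int: "interior K \<noteq> {}" by (rule interior_nonempty_if_full_aff_dim[OF assms(3,4)])
  have H: "closed {x. x \<bullet> u = c}" "convex {x. x \<bullet> u = c}" for u :: 'a and c
    using closed_hyperplane[of u c] convex_hyperplane[of u c] by (simp_all add: inner_commute)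
  show ?thesis
  proof (cases "\<exists>x d. d \<noteq> 0 \<and> (\<forall>t. x + t *\<^sub>R d \<in> K)")
    case True
    then obtain p d where d: "d \<noteq> 0" "\<And>t. p + t *\<^sub>R d \<in> K" by blast
    define w where "w = d /\<^sub>R norm d"
    have w: "w \<in> sphere 0 1" "w \<bullet> w = 1" using d(1) by (simp_all add: w_def dot_square_norm)
    have line: "p + t *\<^sub>R w \<in> K" for t using d(2)[of "t / norm d"] by (simp add: w_def divide_inverse)
    have shift: "x + t *\<^sub>R w \<in> K" if x: "x \<in> K" for x t
    proof (cases "t \<ge> 0")
      case True
      then show ?thesis by (intro recession_direction[OF assms(2,3) line x])
    next
      case False
      have "p + t *\<^sub>R (- w) \<in> K" for t using line[of "- t"] by simp
      from recession_direction[OF assms(2,3) this x, of "- t"] False show ?thesis by simp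
    qed
    have "(+) (t *\<^sub>R w) ` K = K" for t
    proof -
      have "x \<in> (+) (t *\<^sub>R w) ` K" if "x \<in> K" for x
        using shift[OF that, of "- t"] by (intro image_eqI[of _ _ "x + (- t) *\<^sub>R w"]) auto
      then show ?thesis using shift by (auto simp: add.commute)
    qed
    then have "(+) (t *\<^sub>R w) ` frontier K = frontier K" for t
      by (metis closure_translation frontier_def interior_translation translation_diff)
    then have fshift: "x + t *\<^sub>R w \<in> frontier K" if "x \<in> frontier K" for x t
      using that by (metis add.commute imageI)
    \<comment> \<open>If the plane were inside \<open>K\<close>, its translates along
      \<open>w\<close> would fill the space.\<close>
    have "\<not> {x. x \<bullet> w = \<delta> w} \<subseteq> K"
    proof
      assume sub: "{x. x \<bullet> w = \<delta> w} \<subseteq> K"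
      have "x \<in> K" for x
      proof -
        have "x - (x \<bullet> w - \<delta> w) *\<^sub>R w \<in> K" using sub w by (auto simp: inner_diff_left)
        from shift[OF this, of "x \<bullet> w - \<delta> w"] show ?thesis by simp
      qed
      then show False using assms(5) by blast
    qed
    then have cq: "convex_quadric_in {x. x \<bullet> w = \<delta> w} ({x. x \<bullet> w = \<delta> w} \<inter> frontier K)"
      using assms(7)[OF w(1)] by blast
    obtain q U where q: "quadratic q" "U \<noteq> {}" "U \<subset> {x. x \<bullet> w = \<delta> w}"
      "\<And>x. x \<in> {x. x \<bullet> w = \<delta> w} \<inter> frontier K \<Longrightarrow> q x = 0" "\<And>x. x \<in> U \<Longrightarrow> q x \<noteq> 0"
      by (rule convex_quadric_in_quadratic[OF cq H]) (rule that)
    \<comment> \<open>The projection along the ruling direction \<open>w\<close> extends the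
      equation of the section to the cylinder.\<close>
    let ?Q = "\<lambda>x. q (x - (x \<bullet> w - \<delta> w) *\<^sub>R w)"
    obtain y where y: "y \<in> U" using q(2) by blast
    show ?thesis
    proof (rule frontier_in_quadric_imp_convex_quadric[OF assms(2,3) int assms(5) quadratic_slide[OF q(1)]])
      show "?Q x = 0" if "x \<in> frontier K" for x
        using q(4)[of "x - (x \<bullet> w - \<delta> w) *\<^sub>R w"] fshift[OF that, of "- (x \<bullet> w - \<delta> w)"] w(2)
        by (simp add: inner_diff_left algebra_simps)
      show "?Q y \<noteq> 0" using q(3,5) y by auto
    qed
  next
    case False
    then have no_line: "\<exists>t. x + t *\<^sub>R d \<notin> K" if "d \<noteq> 0" for x d using that by blast
    define D where "D = (\<lambda>u. norm u * \<delta> (u /\<^sub>R norm u))"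
    have plane: "x \<bullet> u = D u \<longleftrightarrow> x \<bullet> (u /\<^sub>R norm u) = \<delta> (u /\<^sub>R norm u)" if "u \<noteq> 0" for x u
      using that by (simp add: D_def field_simps)
    have sec: "convex_quadric_in {x. x \<bullet> u = D u} ({x. x \<bullet> u = D u} \<inter> frontier K)" if u: "u \<noteq> 0" for u
    proof -
      have "u /\<^sub>R norm u \<in> sphere 0 1" using u by simp
      \<comment> \<open>A plane contained in \<open>K\<close> would contain a line.\<close>
      moreover have "\<not> {x. x \<bullet> u = D u} \<subseteq> K"
      proof
        assume sub: "{x. x \<bullet> u = D u} \<subseteq> K"
        obtain d where d: "norm d = 1" "d \<bullet> u = 0" using exists_orthogonal_unit[OF assms(1)] by metis
        have "(D u / (u \<bullet> u)) *\<^sub>R u + t *\<^sub>R d \<in> K" for t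
          using sub u d(2) by (auto simp: inner_add_left)
        moreover have "d \<noteq> 0" using d(1) by auto
        ultimately show False using no_line by blast
      qed
      ultimately show ?thesis using assms(7)[of "u /\<^sub>R norm u"] plane[OF u] by simp
    qed
    interpret plane_sections K D
    proof
      show "continuous_on (- {0}) D"
        unfolding D_def
        by (intro continuous_intros continuous_on_compose2[OF assms(6)]) (auto split: if_splits simp flip: divide_inverse_commute)
      fix u :: 'a assume u: "u \<noteq> 0"
      obtain q U where q: "quadratic q" "convex U" "U \<noteq> {}" "U \<subset> {x. x \<bullet> u = D u}"
        "openin (top_of_set {x. x \<bullet> u = D u}) U" "{x. x \<bullet> u = D u} \<inter> frontier K = closure U - U"
        "\<And>x. x \<in> {x. x \<bullet> u = D u} \<inter> frontier K \<Longrightarrow> q x = 0" "\<And>x. x \<in> U \<Longrightarrow> q x \<noteq> 0"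
        by (rule convex_quadric_in_quadratic[OF sec[OF u] H]) (rule that)
      show "\<exists>p\<in>interior K. p \<bullet> u = D u"
      proof (rule ccontr)
        assume "\<not> ?thesis"
        then have "{x. x \<bullet> u = D u} \<inter> frontier K = {x. x \<bullet> u = D u} \<inter> K"
          using assms(2) by (auto simp: frontier_def)
        then have Z: "{x. x \<bullet> u = D u} \<inter> K = closure U - U" using q(6) by simp
        obtain z d where "d \<noteq> 0" "\<And>t. z + t *\<^sub>R d \<in> {x. x \<bullet> u = D u} \<inter> K"
          by (rule line_in_convex_relative_boundary[OF assms(1) q(2,3,4,5) Z convex_Int[OF H(2) assms(3)]])
            (rule that)
        then show False using no_line by blast
      qed
      show "\<exists>q. quadratic q \<and> (\<forall>x\<in>frontier K. x \<bullet> u = D u \<longrightarrow> q x = 0) \<and> (\<exists>x. x \<bullet> u = D u \<and> q x \<noteq> 0)"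
        using q by blast
    qed (use assms no_line in auto)
    obtain Q y where "quadratic Q" "Q y \<noteq> 0" "\<And>x. x \<in> frontier K \<Longrightarrow> Q x = 0"
      by (rule frontier_on_quadric) (rule that)
    then show ?thesis
      by (intro frontier_in_quadric_imp_convex_quadric[OF assms(2,3) int assms(5)])
  qed
qed

end
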